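(* Let $\Phi=(\Phi_1,\Phi_2)\in D(\mathcal{A})$ with $\Phi_1=(u,y)$ and $\Phi_2=(v,z,\theta)$. Then $$(v,z)\in\mathbb{W}_1,\qquad \theta\in H^2(0,L_0)\cap H^1_0(0,L_0),$$ $$(u,y)\in\mathbb{W}_1\cap\big(H^3(0,L_0)\times H^3(L_0,L)\big),\qquad \beta_1u_{xx}(L_0)=\beta_2y_{xx}(L_0).$$ In particular, the resolvent $(I-\mathcal{A})^{-1}$ of $\mathcal{A}$ is compact on the energy space $\mathcal{H}$.
   Context: Constants: $0<L_0<L$; $\rho_0,\rho_1,\rho_2,\alpha_1,\alpha_2,\beta_1,\beta_2,\kappa>0$; $\gamma\in\mathbb{R}\setminus\{0\}$. All functions are complex valued. Spaces: $\mathbb{V}_1=\{(u,y)\in H^1(0,L_0)\times H^1(L_0,L): u(0)=0,\ y(L)=0,\ u(L_0)=y(L_0)\}$; $\mathbb{W}_1=\{(u,y)\in (H^2(0,L_0)\times H^2(L_0,L))\cap\mathbb{V}_1: u_x(0)=y_x(L)=0,\ u_x(L_0)=y_x(L_0)\}$; $\mathbb{V}_2=\mathbb{V}_1\times L^2(0,L_0)$; $\mathbb{W}_2=\mathbb{W}_1\times H^1_0(0,L_0)$; $\mathbb{L}_2=L^2(0,L_0)\times L^2(L_0,L)\times L^2(0,L_0)$. With $\mathbb{L}_2$ identified with its dual, $\mathbb{W}_2\subset\mathbb{V}_2\subset\mathbb{L}_2\subset\mathbb{V}_2'\subset\mathbb{W}_2'$ (duals consist of bounded antilinear functionals; an element of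 $\mathbb{W}_2'$ belongs to $\mathbb{V}_2'$ if it extends to a bounded antilinear functional on $\mathbb{V}_2$). Forms: for $(u,y),(\hat u,\hat y)\in\mathbb{W}_1$, $a((u,y),(\hat u,\hat y))=\beta_1\int_0^{L_0}u_{xx}\overline{\hat u_{xx}}\,dx+\beta_2\int_{L_0}^L y_{xx}\overline{\hat y_{xx}}\,dx$; for $(u,y,\theta),(\hat u,\hat y,\hat\theta)\in\mathbb{W}_2$, $b((u,y,\theta),(\hat u,\hat y,\hat\theta))=\gamma\int_0^{L_0}(u_x\overline{\hat\theta_x}-\theta_x\overline{\hat u_x})\,dx+\kappa\int_0^{L_0}\theta_x\overline{\hat\theta_x}\,dx$; for $(u,y,\theta),(\hat u,\hat y,\hat\theta)\in\mathbb{V}_2$, $c((u,y,\theta),(\hat u,\hat y,\hat\theta))=\int_0^{L_0}(\rho_1u\overline{\hat u}+\alpha_1u_x\overline{\hat u_x})\,dx+\int_{L_0}^L(\rho_2y\overline{\hat y}+\alpha_2y_x\overline{\hat y_x})\,dx+\rho_0\int_0^{L_0}\theta\overline{\hat\theta}\,dx$. The forms $a$ and $c$ are used as the inner products of $\mathbb{W}_1$ and $\mathbb{V}_2$. Operators: $C:\mathbb{V}_2\to\mathbb{V}_2'$ is the isomorphism $\langle CU,\hat U\rangle=c(U,\hat U)$; $B:\mathbb{W}_2\to\mathbb{W}_2'$ is given by $\langle BU,\hat U\rangle=b(U,\hat U)$; $A_1:\mathbb{W}_1\to\mathbb{W}_2'$ is given by $\langle A_1Z,(\hat u,\hat y,\hat\theta)\rangle=a(Z,(\hat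 u,\hat y))$. Energy space $\mathcal{H}=\mathbb{W}_1\times\mathbb{V}_2$ with inner product $\langle(\Phi_1,\Phi_2),(\hat\Phi_1,\hat\Phi_2)\rangle_{\mathcal{H}}=a(\Phi_1,\hat\Phi_1)+c(\Phi_2,\hat\Phi_2)$. Write $\Phi_1=(u,y)$, $\Phi_2=(v,z,\theta)$. Operator: $D(\mathcal{A})=\{(\Phi_1,\Phi_2)\in\mathbb{W}_1\times\mathbb{W}_2: B\Phi_2+A_1\Phi_1\in\mathbb{V}_2'\}$, $\mathcal{A}(\Phi_1,\Phi_2)=\big((v,z),-C^{-1}(B\Phi_2+A_1\Phi_1)\big)$. The operator $\mathcal{A}$ is m-dissipative, so that $(I-\mathcal{A})^{-1}$ is a bounded operator on $\mathcal{H}$. *)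

theory Defs
  imports "HOL-Analysis.Analysis"
begin

quotient_type aefun = "real \<Rightarrow> complex" / partial:
  "\<lambda>f g. f \<in> borel_measurable lborel \<and> g \<in> borel_measurable lborel
         \<and> (AE x in lborel. f x = g x)"
proof (rule part_equivpI)
  show "\<exists>f::real \<Rightarrow> complex. f \<in> borel_measurable lborel \<and> f \<in> borel_measurable lborel
         \<and> (AE x in lborel. f x = f x)"
    by (intro exI[of _ "\<lambda>_. 0"]) simp
next
  show "symp (\<lambda>f g::real \<Rightarrow> complex. f \<in> borel_measurable lborel \<and> g \<in> borel_measurable lborel
         \<and> (AE x in lborel. f x = g x))"
    by (rule sympI) (auto simp: eq_commute)
next
  show "transp (\<lambda>f g::real \<Rightarrow> complex. f \<in> borel_measurable lborel \<and> g \<in> borel_measurable lborel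
         \<and> (AE x in lborel. f x = g x))"
    by (rule transpI) auto
qed

class scaleC =
  fixes scaleC :: "complex \<Rightarrow> 'a \<Rightarrow> 'a" (infixr "*\<^sub>C" 75)

instantiation prod :: (scaleC, scaleC) scaleC
begin
definition scaleC_prod :: "complex \<Rightarrow> 'a \<times> 'b \<Rightarrow> 'a \<times> 'b"
  where "scaleC_prod k p = (k *\<^sub>C fst p, k *\<^sub>C snd p)"
instance ..
end

instantiation aefun :: "{ab_group_add, scaleC}"
begin

lift_definition zero_aefun :: aefun is "\<lambda>_. 0" by simp

lift_definition plus_aefun :: "aefun \<Rightarrow> aefun \<Rightarrow> aefun" is "\<lambda>f g x. f x + g x"
  by auto

lift_definition minus_aefun :: "aefun \<Rightarrow> aefun \<Rightarrow> aefun" is "\<lambda>f g x. f x - g x"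
  by auto

lift_definition uminus_aefun :: "aefun \<Rightarrow> aefun" is "\<lambda>f x. - f x"
  by auto

lift_definition scaleC_aefun :: "complex \<Rightarrow> aefun \<Rightarrow> aefun" is "\<lambda>k f x. k * f x"
  by auto

instance
proof
  fix f g h :: aefun
  show "f + g + h = f + (g + h)" by transfer (auto simp: add.assoc)
  show "f + g = g + f" by transfer (auto simp: add.commute)
  show "0 + f = f" by transfer auto
  show "- f + f = 0" by transfer auto
  show "f - g = f + - g" by transfer auto
qed

end

text \<open>
  Elements of \<open>L\<^sup>2(a,b)\<close> are identified with their extensions by zero, so that each
  of them is a unique element of \<^typ>\<open>aefun\<close>.
\<close>

lift_definition in_L2 :: "real \<Rightarrow> real \<Rightarrow> aefun \<Rightarrow> bool" is
  "\<lambda>a b f. (AE x in lborel. x \<notin> {a<..<b} \<longrightarrow> f x = 0)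
           \<and> integrable lborel (\<lambda>x. (cmod (f x))\<^sup>2)"
proof -
  fix a b :: real and f g :: "real \<Rightarrow> complex"
  assume H: "f \<in> borel_measurable lborel \<and> g \<in> borel_measurable lborel
         \<and> (AE x in lborel. f x = g x)"
  have "(AE x in lborel. x \<notin> {a<..<b} \<longrightarrow> f x = 0)
        = (AE x in lborel. x \<notin> {a<..<b} \<longrightarrow> g x = 0)"
    using H by (intro eventually_cong[of "\<lambda>x. f x = g x"]) auto
  moreover have "integrable lborel (\<lambda>x. (cmod (f x))\<^sup>2)
        = integrable lborel (\<lambda>x. (cmod (g x))\<^sup>2)"
    using H by (intro integrable_cong_AE) auto
  ultimately show "((AE x in lborel. x \<notin> {a<..<b} \<longrightarrow> f x = 0)
           \<and> integrable lborel (\<lambda>x. (cmod (f x))\<^sup>2))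
      = ((AE x in lborel. x \<notin> {a<..<b} \<longrightarrow> g x = 0)
           \<and> integrable lborel (\<lambda>x. (cmod (g x))\<^sup>2))"
    by simp
qed

definition L2 :: "real \<Rightarrow> real \<Rightarrow> aefun set"
  where "L2 a b = {f. in_L2 a b f}"

lift_definition L2_inner :: "real \<Rightarrow> real \<Rightarrow> aefun \<Rightarrow> aefun \<Rightarrow> complex" is
  "\<lambda>a b f g. set_lebesgue_integral lborel {a<..<b} (\<lambda>x. f x * cnj (g x))"
proof -
  fix a b :: real and f f' g g' :: "real \<Rightarrow> complex"
  assume f: "f \<in> borel_measurable lborel \<and> f' \<in> borel_measurable lborel
         \<and> (AE x in lborel. f x = f' x)"
    and g: "g \<in> borel_measurable lborel \<and> g' \<in> borel_measurable lborel
         \<and> (AE x in lborel. g x = g' x)"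
  have cnj: "cnj \<in> borel_measurable borel"
    by (intro borel_measurable_continuous_onI continuous_intros)
  have [measurable]: "f \<in> borel_measurable borel" "f' \<in> borel_measurable borel"
    "(\<lambda>x. cnj (g x)) \<in> borel_measurable borel" "(\<lambda>x. cnj (g' x)) \<in> borel_measurable borel"
    using f g by (auto intro: measurable_compose[OF _ cnj])
  have "AE x in lborel. f x * cnj (g x) = f' x * cnj (g' x)"
    using f g by auto
  then show "(LINT x:{a<..<b}|lborel. f x * cnj (g x)) = (LINT x:{a<..<b}|lborel. f' x * cnj (g' x))"
    unfolding set_lebesgue_integral_def
    by (intro integral_cong_AE) (measurable, auto)
qed

definition L2_norm :: "real \<Rightarrow> real \<Rightarrow> aefun \<Rightarrow> real"
  where "L2_norm a b f = sqrt (Re (L2_inner a b f f))"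

lift_definition agrees_on :: "real \<Rightarrow> real \<Rightarrow> aefun \<Rightarrow> (real \<Rightarrow> complex) \<Rightarrow> bool" is
  "\<lambda>a b f h. AE x in lborel. x \<in> {a<..<b} \<longrightarrow> f x = h x"
proof -
  fix a b :: real and f g :: "real \<Rightarrow> complex"
  assume "f \<in> borel_measurable lborel \<and> g \<in> borel_measurable lborel
         \<and> (AE x in lborel. f x = g x)"
  then have "(AE x in lborel. x \<in> {a<..<b} \<longrightarrow> f x = h x)
        = (AE x in lborel. x \<in> {a<..<b} \<longrightarrow> g x = h x)" for h
    by (intro eventually_cong[of "\<lambda>x. f x = g x"]) auto
  then show "(\<lambda>h. AE x in lborel. x \<in> {a<..<b} \<longrightarrow> f x = h x)
        = (\<lambda>h. AE x in lborel. x \<in> {a<..<b} \<longrightarrow> g x = h x)"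
    by (rule ext)
qed

definition smooth :: "(real \<Rightarrow> complex) \<Rightarrow> bool"
  where "smooth \<phi> \<longleftrightarrow> (\<exists>D :: nat \<Rightarrow> real \<Rightarrow> complex.
    D 0 = \<phi> \<and> (\<forall>n x. (D n has_vector_derivative D (Suc n) x) (at x)))"

definition test_function :: "real \<Rightarrow> real \<Rightarrow> (real \<Rightarrow> complex) \<Rightarrow> bool"
  where "test_function a b \<phi> \<longleftrightarrow> smooth \<phi> \<and>
    (\<exists>c d. a < c \<and> d < b \<and> (\<forall>x. x \<notin> {c..d} \<longrightarrow> \<phi> x = 0))"

lemma test_function_measurable:
  assumes "test_function a b \<phi>"
  shows "\<phi> \<in> borel_measurable borel"
    and "(\<lambda>x. vector_derivative \<phi> (at x)) \<in> borel_measurable borel"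
proof -
  obtain D where D: "D 0 = \<phi>" "\<And>n x. (D n has_vector_derivative D (Suc n) x) (at x)"
    using assms unfolding test_function_def smooth_def by blast
  have meas: "D n \<in> borel_measurable borel" for n
    by (intro borel_measurable_continuous_onI continuous_at_imp_continuous_on ballI)
       (rule has_vector_derivative_continuous[OF D(2)])
  have "vector_derivative \<phi> (at x) = D (Suc 0) x" for x
    using D(2)[of 0 x] D(1) by (simp add: vector_derivative_at)
  then show "\<phi> \<in> borel_measurable borel"
    and "(\<lambda>x. vector_derivative \<phi> (at x)) \<in> borel_measurable borel"
    using meas[of 0] meas[of "Suc 0"] D(1) by simp_all
qed

lift_definition weak_deriv_identity :: "real \<Rightarrow> real \<Rightarrow> aefun \<Rightarrow> aefun \<Rightarrow> bool" is
  "\<lambda>a b f g. \<forall>\<phi>. test_function a b \<phi> \<longrightarrow>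
     set_lebesgue_integral lborel {a<..<b} (\<lambda>x. f x * vector_derivative \<phi> (at x))
       = - set_lebesgue_integral lborel {a<..<b} (\<lambda>x. g x * \<phi> x)"
proof -
  fix a b :: real and f f' g g' :: "real \<Rightarrow> complex"
  assume f: "f \<in> borel_measurable lborel \<and> f' \<in> borel_measurable lborel
         \<and> (AE x in lborel. f x = f' x)"
    and g: "g \<in> borel_measurable lborel \<and> g' \<in> borel_measurable lborel
         \<and> (AE x in lborel. g x = g' x)"
  have *: "(LINT x:{a<..<b}|lborel. h x * \<psi> x) = (LINT x:{a<..<b}|lborel. h' x * \<psi> x)"
    if "h \<in> borel_measurable lborel \<and> h' \<in> borel_measurable lborel
         \<and> (AE x in lborel. h x = h' x)" "\<psi> \<in> borel_measurable borel"
    for h h' \<psi> :: "real \<Rightarrow> complex"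
  proof -
    have [measurable]: "h \<in> borel_measurable borel" "h' \<in> borel_measurable borel"
      "\<psi> \<in> borel_measurable borel"
      using that by auto
    have "AE x in lborel. h x * \<psi> x = h' x * \<psi> x"
      using that by auto
    then show ?thesis
      unfolding set_lebesgue_integral_def
      by (intro integral_cong_AE) (measurable, auto)
  qed
  show "(\<forall>\<phi>. test_function a b \<phi> \<longrightarrow>
     (LINT x:{a<..<b}|lborel. f x * vector_derivative \<phi> (at x))
       = - (LINT x:{a<..<b}|lborel. g x * \<phi> x))
   = (\<forall>\<phi>. test_function a b \<phi> \<longrightarrow>
     (LINT x:{a<..<b}|lborel. f' x * vector_derivative \<phi> (at x))
       = - (LINT x:{a<..<b}|lborel. g' x * \<phi> x))"
    by (intro all_cong1 imp_cong refl)
       (simp only: *[OF f test_function_measurable(2)] *[OF g test_function_measurable(1)])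
qed

definition has_weak_deriv :: "real \<Rightarrow> real \<Rightarrow> aefun \<Rightarrow> aefun \<Rightarrow> bool"
  where "has_weak_deriv a b f g \<longleftrightarrow> f \<in> L2 a b \<and> g \<in> L2 a b \<and> weak_deriv_identity a b f g"

definition weak_deriv :: "real \<Rightarrow> real \<Rightarrow> aefun \<Rightarrow> aefun"
  where "weak_deriv a b f = (THE g. has_weak_deriv a b f g)"

primrec Sob :: "nat \<Rightarrow> real \<Rightarrow> real \<Rightarrow> aefun set"
  where "Sob 0 a b = L2 a b"
      | "Sob (Suc k) a b = {f. \<exists>g \<in> Sob k a b. has_weak_deriv a b f g}"

definition H1_norm :: "real \<Rightarrow> real \<Rightarrow> aefun \<Rightarrow> real"
  where "H1_norm a b f = sqrt ((L2_norm a b f)\<^sup>2 + (L2_norm a b (weak_deriv a b f))\<^sup>2)"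

text \<open>\<open>H\<^sup>1\<^sub>0(a,b)\<close> is the closure of the test functions in \<open>H\<^sup>1(a,b)\<close>.\<close>

definition H10 :: "real \<Rightarrow> real \<Rightarrow> aefun set"
  where "H10 a b = {f \<in> Sob 1 a b. \<forall>\<epsilon>>0. \<exists>g \<in> Sob 1 a b.
    (\<exists>\<phi>. test_function a b \<phi> \<and> agrees_on a b g \<phi>) \<and> H1_norm a b (f - g) < \<epsilon>}"

text \<open>
  Point values on the closed interval \<open>[a,b]\<close> are those of the continuous representative,
  which every element of \<open>H\<^sup>1(a,b)\<close> has and which is unique on \<open>[a,b]\<close>.
\<close>

definition point_val :: "real \<Rightarrow> real \<Rightarrow> aefun \<Rightarrow> real \<Rightarrow> complex"
  where "point_val a b f =
    (SOME h. continuous_on {a..b} h \<and> agrees_on a b f h)"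

record beam_params =
  len0 :: real
  len :: real
  rho0 :: real
  rho1 :: real
  rho2 :: real
  alpha1 :: real
  alpha2 :: real
  beta1 :: real
  beta2 :: real
  kappa :: real
  gamma :: real

text \<open>Suffixes \<open>0\<close> and \<open>1\<close> refer to the intervals \<open>(0, L\<^sub>0)\<close> and \<open>(L\<^sub>0, L)\<close>,
  where \<open>L\<^sub>0 = len0 P\<close> and \<open>L = len P\<close>.\<close>

abbreviation Dx0 :: "beam_params \<Rightarrow> aefun \<Rightarrow> aefun"
  where "Dx0 P \<equiv> weak_deriv 0 (len0 P)"

abbreviation Dx1 :: "beam_params \<Rightarrow> aefun \<Rightarrow> aefun"
  where "Dx1 P \<equiv> weak_deriv (len0 P) (len P)"

abbreviation val0 :: "beam_params \<Rightarrow> aefun \<Rightarrow> real \<Rightarrow> complex"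
  where "val0 P \<equiv> point_val 0 (len0 P)"

abbreviation val1 :: "beam_params \<Rightarrow> aefun \<Rightarrow> real \<Rightarrow> complex"
  where "val1 P \<equiv> point_val (len0 P) (len P)"

abbreviation inner0 :: "beam_params \<Rightarrow> aefun \<Rightarrow> aefun \<Rightarrow> complex"
  where "inner0 P \<equiv> L2_inner 0 (len0 P)"

abbreviation inner1 :: "beam_params \<Rightarrow> aefun \<Rightarrow> aefun \<Rightarrow> complex"
  where "inner1 P \<equiv> L2_inner (len0 P) (len P)"

type_synonym pair = "aefun \<times> aefun"
type_synonym triple = "aefun \<times> aefun \<times> aefun"

definition V1 :: "beam_params \<Rightarrow> pair set"
  where "V1 P = {(u, y). u \<in> Sob 1 0 (len0 P) \<and> y \<in> Sob 1 (len0 P) (len P) \<and>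
    val0 P u 0 = 0 \<and> val1 P y (len P) = 0 \<and> val0 P u (len0 P) = val1 P y (len0 P)}"

definition W1 :: "beam_params \<Rightarrow> pair set"
  where "W1 P = {(u, y) \<in> (Sob 2 0 (len0 P) \<times> Sob 2 (len0 P) (len P)) \<inter> V1 P.
    val0 P (Dx0 P u) 0 = 0 \<and> val1 P (Dx1 P y) (len P) = 0 \<and>
    val0 P (Dx0 P u) (len0 P) = val1 P (Dx1 P y) (len0 P)}"

definition V2 :: "beam_params \<Rightarrow> triple set"
  where "V2 P = {(u, y, \<theta>). (u, y) \<in> V1 P \<and> \<theta> \<in> L2 0 (len0 P)}"

definition W2 :: "beam_params \<Rightarrow> triple set"
  where "W2 P = {(u, y, \<theta>). (u, y) \<in> W1 P \<and> \<theta> \<in> H10 0 (len0 P)}"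

fun form_a :: "beam_params \<Rightarrow> pair \<Rightarrow> pair \<Rightarrow> complex"
  where "form_a P (u, y) (u', y') =
      of_real (beta1 P) * inner0 P (Dx0 P (Dx0 P u)) (Dx0 P (Dx0 P u'))
    + of_real (beta2 P) * inner1 P (Dx1 P (Dx1 P y)) (Dx1 P (Dx1 P y'))"

fun form_b :: "beam_params \<Rightarrow> triple \<Rightarrow> triple \<Rightarrow> complex"
  where "form_b P (u, y, \<theta>) (u', y', \<theta>') =
      of_real (gamma P) * (inner0 P (Dx0 P u) (Dx0 P \<theta>') - inner0 P (Dx0 P \<theta>) (Dx0 P u'))
    + of_real (kappa P) * inner0 P (Dx0 P \<theta>) (Dx0 P \<theta>')"

fun form_c :: "beam_params \<Rightarrow> triple \<Rightarrow> triple \<Rightarrow> complex"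
  where "form_c P (u, y, \<theta>) (u', y', \<theta>') =
      of_real (rho1 P) * inner0 P u u' + of_real (alpha1 P) * inner0 P (Dx0 P u) (Dx0 P u')
    + of_real (rho2 P) * inner1 P y y' + of_real (alpha2 P) * inner1 P (Dx1 P y) (Dx1 P y')
    + of_real (rho0 P) * inner0 P \<theta> \<theta>'"

definition norm_V2 :: "beam_params \<Rightarrow> triple \<Rightarrow> real"
  where "norm_V2 P U = sqrt (Re (form_c P U U))"

text \<open>Functionals are \<open>undefined\<close> outside their domain, so that equality of functionals on
  \<open>V2 P\<close> is equality in HOL.\<close>

definition V2_dual :: "beam_params \<Rightarrow> (triple \<Rightarrow> complex) set"
  where "V2_dual P = {f \<in> extensional (V2 P).
    (\<forall>U \<in> V2 P. \<forall>U' \<in> V2 P. f (U + U') = f U + f U') \<and>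
    (\<forall>k. \<forall>U \<in> V2 P. f (k *\<^sub>C U) = cnj k * f U) \<and>
    (\<exists>M. \<forall>U \<in> V2 P. cmod (f U) \<le> M * norm_V2 P U)}"

definition op_C :: "beam_params \<Rightarrow> triple \<Rightarrow> triple \<Rightarrow> complex"
  where "op_C P U = restrict (\<lambda>U'. form_c P U U') (V2 P)"

definition op_B :: "beam_params \<Rightarrow> triple \<Rightarrow> triple \<Rightarrow> complex"
  where "op_B P U = restrict (\<lambda>U'. form_b P U U') (W2 P)"

definition op_A1 :: "beam_params \<Rightarrow> pair \<Rightarrow> triple \<Rightarrow> complex"
  where "op_A1 P Z = restrict (\<lambda>(u', y', \<theta>'). form_a P Z (u', y')) (W2 P)"

text \<open>\<open>V2_extension P F f\<close> expresses that the functional \<open>F\<close> on \<open>W2 P\<close> belongs to the dual of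
  \<open>V2 P\<close> by virtue of its extension \<open>f\<close>, which is unique since \<open>W2 P\<close> is dense in \<open>V2 P\<close>.\<close>

definition V2_extension :: "beam_params \<Rightarrow> (triple \<Rightarrow> complex) \<Rightarrow> (triple \<Rightarrow> complex) \<Rightarrow> bool"
  where "V2_extension P F f \<longleftrightarrow> f \<in> V2_dual P \<and> (\<forall>U \<in> W2 P. f U = F U)"

definition C_inv :: "beam_params \<Rightarrow> (triple \<Rightarrow> complex) \<Rightarrow> triple"
  where "C_inv P F = the_inv_into (V2 P) (op_C P) (THE f. V2_extension P F f)"

definition energy_space :: "beam_params \<Rightarrow> (pair \<times> triple) set"
  where "energy_space P = W1 P \<times> V2 P"

fun energy_inner :: "beam_params \<Rightarrow> pair \<times> triple \<Rightarrow> pair \<times> triple \<Rightarrow> complex"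
  where "energy_inner P (\<Phi>1, \<Phi>2) (\<Psi>1, \<Psi>2) = form_a P \<Phi>1 \<Psi>1 + form_c P \<Phi>2 \<Psi>2"

definition energy_norm :: "beam_params \<Rightarrow> pair \<times> triple \<Rightarrow> real"
  where "energy_norm P \<Phi> = sqrt (Re (energy_inner P \<Phi> \<Phi>))"

definition dom_A :: "beam_params \<Rightarrow> (pair \<times> triple) set"
  where "dom_A P = {(\<Phi>1, \<Phi>2) \<in> W1 P \<times> W2 P.
    \<exists>f. V2_extension P (\<lambda>U. op_B P \<Phi>2 U + op_A1 P \<Phi>1 U) f}"

fun op_A :: "beam_params \<Rightarrow> pair \<times> triple \<Rightarrow> pair \<times> triple"
  where "op_A P (\<Phi>1, (v, z, \<theta>)) =
    ((v, z), - C_inv P (\<lambda>U. op_B P (v, z, \<theta>) U + op_A1 P \<Phi>1 U))"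

definition resolvent_A :: "beam_params \<Rightarrow> pair \<times> triple \<Rightarrow> pair \<times> triple"
  where "resolvent_A P = the_inv_into (dom_A P) (\<lambda>\<Phi>. \<Phi> - op_A P \<Phi>)"

text \<open>\<open>T\<close> is only considered on \<open>X\<close>, a subspace normed by \<open>nrm\<close>; boundedness of \<open>T\<close> follows
  from the condition on sequences.\<close>

definition compact_operator ::
    "'a::{ab_group_add, scaleC} set \<Rightarrow> ('a \<Rightarrow> real) \<Rightarrow> ('a \<Rightarrow> 'a) \<Rightarrow> bool"
  where "compact_operator X nrm T \<longleftrightarrow>
    (\<forall>x \<in> X. T x \<in> X) \<and>
    (\<forall>x \<in> X. \<forall>y \<in> X. T (x + y) = T x + T y) \<and>
    (\<forall>k. \<forall>x \<in> X. T (k *\<^sub>C x) = k *\<^sub>C T x) \<and>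
    (\<forall>F. (\<forall>n::nat. F n \<in> X) \<and> (\<exists>M. \<forall>n. nrm (F n) \<le> M) \<longrightarrow>
       (\<exists>r x. strict_mono r \<and> x \<in> X \<and> (\<lambda>n. nrm (T (F (r n)) - x)) \<longlonglongrightarrow> 0))"

end

(*
An element of V1 is the same thing as an H^1 function on (0, L) vanishing at both ends, and test
functions on (0, L) yield elements of W1. Testing the equation C w = B Phi_2 + A_1 Phi_1 with such
functions shows that the function h equal to beta_1 u_xx on (0, L_0) and beta_2 y_xx on (L_0, L)
satisfies int h phi'' = - int g phi' with g in L^2, so that h lies in H^1(0, L): this gives the H^3
regularity of u and y and the continuity of h at L_0 at once. Testing with (0, 0, phi) gives the
regularity of theta.

Eliminating Phi_1 = F_1 + (v, z), the resolvent equation (I - A) Phi = F becomes a variational problem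
on W2 for the form c + b + a, whose real part is an inner product for which W2 is complete; it is
solved by the lemma of Lax and Milgram. For a bounded sequence of data, Phi_2 is bounded in W2 and
Phi_1 in W1, so that a subsequence of the solutions converges in V2 and V1. For Phi_1 this improves to
convergence in W1, because testing the equation of a difference of two solutions with
(Delta u, Delta y, 0) bounds a(Delta Phi_1, Delta Phi_1) by the V1 norm of Delta Phi_1.
*)

theory Submission
  imports Defs "HOL-Complex_Analysis.Great_Picard" "HOL-Real_Asymp.Real_Asymp"
begin

section \<open>Lax--Milgram on a carrier set\<close>

text \<open>The spaces are subsets of types that carry no norm, their inner products depend on
  \<open>P\<close>, and \<open>weak_deriv\<close> and \<open>point_val\<close> mean something only
  on \<open>Sob 1\<close>. Hilbert space theory is therefore set up relative to a carrier set, for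
  forms that may be degenerate.

  Everything on an interval rests on one fact: an H^1 function is a constant plus the primitive of
  an L2 function. The Hoelder bound of exponent 1/2 for such primitives yields traces, the Poincare
  inequality and, through Arzela and Ascoli, compactness.

  In the regularity proof the zero-order part of \<open>c\<close> does not yet have the required
  form, since it pairs some \<open>G\<close> with the test function itself. It is integrated by
  parts with a primitive \<open>R\<close> of \<open>G\<close>. As the derivatives of test functions
  are only the test functions of mean zero, the identity determines the weak derivative of h up to
  an additive constant, which costs no regularity.

  The operator \<open>C_inv\<close> hides an extension to \<open>V2 P\<close> that must be unique.
  The density of \<open>W2 P\<close> in \<open>V2 P\<close> behind this is proved by duality,
  through integration by parts, and not by approximation.\<close>

class complex_vec = real_vector + scaleC +
  assumes scaleR_eq_scaleC: "r *\<^sub>R x = of_real r *\<^sub>C x"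

instance prod :: (complex_vec, complex_vec) complex_vec
  by standard (auto simp: scaleC_prod_def scaleR_prod_def scaleR_eq_scaleC)

instantiation aefun :: complex_vec
begin
definition scaleR_aefun :: "real \<Rightarrow> aefun \<Rightarrow> aefun"
  where "scaleR_aefun r f = of_real r *\<^sub>C f"
instance
proof
  fix a b :: real and f g :: aefun
  show "a *\<^sub>R (f + g) = a *\<^sub>R f + a *\<^sub>R g"
    unfolding scaleR_aefun_def by transfer (auto simp: algebra_simps)
  show "(a + b) *\<^sub>R f = a *\<^sub>R f + b *\<^sub>R f"
    unfolding scaleR_aefun_def by transfer (auto simp: algebra_simps)
  show "a *\<^sub>R b *\<^sub>R f = (a * b) *\<^sub>R f"
    unfolding scaleR_aefun_def by transfer (auto simp: algebra_simps)
  show "1 *\<^sub>R f = f"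
    unfolding scaleR_aefun_def by transfer auto
  show "a *\<^sub>R f = complex_of_real a *\<^sub>C f"
    by (rule scaleR_aefun_def)
qed
end

section \<open>Subspaces, linear maps and sesquilinear forms on a carrier set\<close>

definition csubspace :: "'a::complex_vec set \<Rightarrow> bool" where
  "csubspace S \<longleftrightarrow> 0 \<in> S \<and> (\<forall>x\<in>S. \<forall>y\<in>S. x + y \<in> S) \<and> (\<forall>k. \<forall>x\<in>S. k *\<^sub>C x \<in> S)"

lemma csubI:
  assumes "0 \<in> S" "\<And>x y. x \<in> S \<Longrightarrow> y \<in> S \<Longrightarrow> x + y \<in> S" "\<And>k x. x \<in> S \<Longrightarrow> k *\<^sub>C x \<in> S"
  shows "csubspace S"
  using assms by (auto simp: csubspace_def)

lemma csub_zero: "csubspace S \<Longrightarrow> 0 \<in> S"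
  and csub_add: "csubspace S \<Longrightarrow> x \<in> S \<Longrightarrow> y \<in> S \<Longrightarrow> x + y \<in> S"
  and csub_scaleC: "csubspace S \<Longrightarrow> x \<in> S \<Longrightarrow> k *\<^sub>C x \<in> S"
  by (auto simp: csubspace_def)

lemma csub_scaleR: "csubspace S \<Longrightarrow> x \<in> S \<Longrightarrow> r *\<^sub>R x \<in> S"
  by (simp add: scaleR_eq_scaleC csub_scaleC)

lemma csub_minus: "csubspace S \<Longrightarrow> x \<in> S \<Longrightarrow> - x \<in> S"
  using csub_scaleR[of S x "-1"] by simp

lemma csub_diff: "csubspace S \<Longrightarrow> x \<in> S \<Longrightarrow> y \<in> S \<Longrightarrow> x - y \<in> S"
  using csub_add[of S x "- y"] csub_minus[of S y] by simp

text \<open>Linearity is demanded on \<open>S\<close> only, because \<open>weak_deriv\<close> is a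
  definite description: it is linear on \<open>Sob 1\<close> and unspecified where no weak
  derivative exists.\<close>

definition clinear_on :: "'a::complex_vec set \<Rightarrow> 'b::complex_vec set \<Rightarrow> ('a \<Rightarrow> 'b) \<Rightarrow> bool" where
  "clinear_on S T f \<longleftrightarrow> (\<forall>x\<in>S. f x \<in> T) \<and> (\<forall>x\<in>S. \<forall>y\<in>S. f (x + y) = f x + f y) \<and>
    (\<forall>k. \<forall>x\<in>S. f (k *\<^sub>C x) = k *\<^sub>C f x)"

definition sesquilinear_on :: "'a::complex_vec set \<Rightarrow> ('a \<Rightarrow> 'a \<Rightarrow> complex) \<Rightarrow> bool" where
  "sesquilinear_on S B \<longleftrightarrow> (\<forall>x\<in>S. \<forall>y\<in>S. \<forall>z\<in>S. B (x + y) z = B x z + B y z \<and> B x (y + z) = B x y + B x z) \<and>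
    (\<forall>k. \<forall>x\<in>S. \<forall>y\<in>S. B (k *\<^sub>C x) y = k * B x y \<and> B x (k *\<^sub>C y) = cnj k * B x y)"

lemma sesqI:
  assumes "\<And>x y z. x \<in> S \<Longrightarrow> y \<in> S \<Longrightarrow> z \<in> S \<Longrightarrow> B (x + y) z = B x z + B y z"
    and "\<And>x y z. x \<in> S \<Longrightarrow> y \<in> S \<Longrightarrow> z \<in> S \<Longrightarrow> B x (y + z) = B x y + B x z"
    and "\<And>k x y. x \<in> S \<Longrightarrow> y \<in> S \<Longrightarrow> B (k *\<^sub>C x) y = k * B x y"
    and "\<And>k x y. x \<in> S \<Longrightarrow> y \<in> S \<Longrightarrow> B x (k *\<^sub>C y) = cnj k * B x y"
  shows "sesquilinear_on S B"
  using assms unfolding sesquilinear_on_def by blast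

lemma sesq_addL: "sesquilinear_on S B \<Longrightarrow> x \<in> S \<Longrightarrow> y \<in> S \<Longrightarrow> z \<in> S \<Longrightarrow> B (x + y) z = B x z + B y z"
  and sesq_addR: "sesquilinear_on S B \<Longrightarrow> x \<in> S \<Longrightarrow> y \<in> S \<Longrightarrow> z \<in> S \<Longrightarrow> B x (y + z) = B x y + B x z"
  and sesq_scaleL: "sesquilinear_on S B \<Longrightarrow> x \<in> S \<Longrightarrow> y \<in> S \<Longrightarrow> B (k *\<^sub>C x) y = k * B x y"
  and sesq_scaleR: "sesquilinear_on S B \<Longrightarrow> x \<in> S \<Longrightarrow> y \<in> S \<Longrightarrow> B x (k *\<^sub>C y) = cnj k * B x y"
  unfolding sesquilinear_on_def by blast+

text \<open>\<open>complex_vec\<close> ties the two scalings together, so \<open>- x\<close> is the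
  complex multiple of \<open>x\<close> by \<open>-1\<close> and homogeneity gives the sign.\<close>

lemma sesq_minusL: "csubspace S \<Longrightarrow> sesquilinear_on S B \<Longrightarrow> x \<in> S \<Longrightarrow> y \<in> S \<Longrightarrow> B (- x) y = - B x y"
  and sesq_minusR: "csubspace S \<Longrightarrow> sesquilinear_on S B \<Longrightarrow> x \<in> S \<Longrightarrow> y \<in> S \<Longrightarrow> B x (- y) = - B x y"
  using sesq_scaleL[of S B x y "-1"] sesq_scaleR[of S B x y "-1"]
    scaleR_eq_scaleC[of "-1" x] scaleR_eq_scaleC[of "-1" y] by simp_all

lemma sesq_diffL:
  "csubspace S \<Longrightarrow> sesquilinear_on S B \<Longrightarrow> x \<in> S \<Longrightarrow> y \<in> S \<Longrightarrow> z \<in> S \<Longrightarrow> B (x - y) z = B x z - B y z"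
  using sesq_addL[of S B x "- y" z] sesq_minusL[of S B y z] csub_minus[of S y] by simp

lemma sesq_diffR:
  "csubspace S \<Longrightarrow> sesquilinear_on S B \<Longrightarrow> x \<in> S \<Longrightarrow> y \<in> S \<Longrightarrow> z \<in> S \<Longrightarrow> B x (y - z) = B x y - B x z"
  using sesq_addR[of S B x y "- z"] sesq_minusR[of S B x z] csub_minus[of S z] by simp

lemma sesq_zeroL: "csubspace S \<Longrightarrow> sesquilinear_on S B \<Longrightarrow> x \<in> S \<Longrightarrow> B 0 x = 0"
  and sesq_zeroR: "csubspace S \<Longrightarrow> sesquilinear_on S B \<Longrightarrow> x \<in> S \<Longrightarrow> B x 0 = 0"
  using sesq_addL[of S B 0 0 x] sesq_addR[of S B x 0 0] csub_zero[of S] by simp_all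

lemma sesq_subset: "sesquilinear_on T B \<Longrightarrow> S \<subseteq> T \<Longrightarrow> sesquilinear_on S B"
  unfolding sesquilinear_on_def by blast

text \<open>The forms of the beam problem are sums of multiples of L2 inner products of linear
  images of the arguments; this rule and the three after it build them.\<close>

lemma sesq_pullback: "clinear_on S T f \<Longrightarrow> clinear_on S T g \<Longrightarrow> sesquilinear_on T B \<Longrightarrow> sesquilinear_on S (\<lambda>x y. B (f x) (g y))"
  unfolding clinear_on_def sesquilinear_on_def by simp

lemma sesq_plus: "sesquilinear_on S A \<Longrightarrow> sesquilinear_on S B \<Longrightarrow> sesquilinear_on S (\<lambda>x y. A x y + B x y)"
  and sesq_minus: "sesquilinear_on S A \<Longrightarrow> sesquilinear_on S B \<Longrightarrow> sesquilinear_on S (\<lambda>x y. A x y - B x y)"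
  and sesq_mult: "sesquilinear_on S A \<Longrightarrow> sesquilinear_on S (\<lambda>x y. k * A x y)"
  unfolding sesquilinear_on_def by (auto simp: algebra_simps)

section \<open>Semi-inner products and their seminorms\<close>

definition form_norm :: "('a \<Rightarrow> 'a \<Rightarrow> complex) \<Rightarrow> 'a \<Rightarrow> real" where
  "form_norm B u = sqrt (Re (B u u))"

text \<open>The form may vanish on nonzero vectors. The passage from a vanishing seminorm to
  equality is a separate matter, settled in \<open>L2_norm_eq_0\<close> and
  \<open>V_definite\<close>.\<close>

locale semi_inner =
  fixes S :: "'a::complex_vec set" and ip :: "'a \<Rightarrow> 'a \<Rightarrow> complex"
  assumes S: "csubspace S" and sesquilinear_on: "sesquilinear_on S ip"
    and cnj_ip: "u \<in> S \<Longrightarrow> v \<in> S \<Longrightarrow> cnj (ip u v) = ip v u"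
    and Re_ip_nonneg: "u \<in> S \<Longrightarrow> 0 \<le> Re (ip u u)"
begin

lemmas S_closed = csub_zero[OF S] csub_add[OF S] csub_scaleC[OF S] csub_scaleR[OF S]
  csub_minus[OF S] csub_diff[OF S]

lemmas ip_simps = sesq_addL[OF sesquilinear_on] sesq_addR[OF sesquilinear_on] sesq_scaleL[OF sesquilinear_on] sesq_scaleR[OF sesquilinear_on]
  sesq_minusL[OF S sesquilinear_on] sesq_minusR[OF S sesquilinear_on] sesq_diffL[OF S sesquilinear_on] sesq_diffR[OF S sesquilinear_on]
  sesq_zeroL[OF S sesquilinear_on] sesq_zeroR[OF S sesquilinear_on]

abbreviation nrm where "nrm \<equiv> form_norm ip"

lemma ip_self: "u \<in> S \<Longrightarrow> ip u u = of_real ((nrm u)\<^sup>2)"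
  using cnj_ip[of u u] Re_ip_nonneg[of u] by (auto simp: form_norm_def complex_eq_iff)

lemma nrm_sq: "u \<in> S \<Longrightarrow> (nrm u)\<^sup>2 = Re (ip u u)"
  using Re_ip_nonneg[of u] by (auto simp: form_norm_def)

lemma nrm_nonneg: "u \<in> S \<Longrightarrow> 0 \<le> nrm u"
  using Re_ip_nonneg[of u] by (simp add: form_norm_def)

lemma Re_ip_commute: "u \<in> S \<Longrightarrow> v \<in> S \<Longrightarrow> Re (ip u v) = Re (ip v u)"
  using cnj_ip[of v u] by (metis complex_cnj cnj.simps(1))

lemma nrm_add_sq: "u \<in> S \<Longrightarrow> v \<in> S \<Longrightarrow> (nrm (u + v))\<^sup>2 = (nrm u)\<^sup>2 + 2 * Re (ip u v) + (nrm v)\<^sup>2"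
  using Re_ip_commute[of u v] by (simp add: nrm_sq S_closed ip_simps)

lemma nrm_scaleC: "u \<in> S \<Longrightarrow> nrm (k *\<^sub>C u) = cmod k * nrm u"
proof -
  assume u: "u \<in> S"
  have "ip (k *\<^sub>C u) (k *\<^sub>C u) = of_real ((cmod k)\<^sup>2) * ip u u"
    using u by (simp add: ip_simps S_closed mult.assoc[symmetric] complex_norm_square del: of_real_power)
  then have "(nrm (k *\<^sub>C u))\<^sup>2 = (cmod k * nrm u)\<^sup>2"
    using u by (simp add: nrm_sq S_closed power_mult_distrib)
  then show ?thesis using u nrm_nonneg S_closed
    by (metis norm_ge_zero power2_eq_iff_nonneg mult_nonneg_nonneg)
qed

lemma nrm_minus: "u \<in> S \<Longrightarrow> nrm (- u) = nrm u"
  by (simp add: form_norm_def ip_simps S_closed)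

lemma nrm_diff_commute: "u \<in> S \<Longrightarrow> v \<in> S \<Longrightarrow> nrm (u - v) = nrm (v - u)"
  using nrm_minus[of "u - v"] by (simp add: S_closed)

lemma nrm_scaleR: "u \<in> S \<Longrightarrow> nrm (r *\<^sub>R u) = \<bar>r\<bar> * nrm u"
  by (simp add: scaleR_eq_scaleC nrm_scaleC)

text \<open>Discriminant argument: the squared seminorm of \<open>u - t z v\<close> is a quadratic
  in the real variable \<open>t\<close> that is never negative. Its value at
  \<open>t = 1 / (nrm v)^2\<close> is the claim, unless \<open>nrm v = 0\<close>.\<close>

lemma cauchy_schwarz: 
  assumes u: "u \<in> S" and v: "v \<in> S"
  shows "cmod (ip u v) \<le> nrm u * nrm v"
proof -
  define z where "z = ip u v"
  have q: "0 \<le> (nrm u)\<^sup>2 - 2 * t * (cmod z)\<^sup>2 + t\<^sup>2 * (cmod z)\<^sup>2 * (nrm v)\<^sup>2" for t :: real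
  proof -
    \<comment> \<open>The factor \<open>z\<close> turns the cross term onto the real axis, where it
      equals \<open>- t |z|^2\<close>.\<close>
    define k where "k = - (of_real t * z)"
    have "0 \<le> (nrm (u + k *\<^sub>C v))\<^sup>2" by simp
    also have "\<dots> = (nrm u)\<^sup>2 + 2 * Re (cnj k * z) + (cmod k * nrm v)\<^sup>2"
      using u v by (simp add: nrm_add_sq S_closed nrm_scaleC ip_simps z_def)
    also have "Re (cnj k * z) = - t * (cmod z)\<^sup>2"
      by (simp add: k_def cmod_power2) (simp add: power2_eq_square algebra_simps)
    also have "cmod k = \<bar>t\<bar> * cmod z" by (simp add: k_def norm_mult)
    finally show ?thesis by (simp add: power_mult_distrib mult.assoc)
  qed
  have "(cmod z)\<^sup>2 \<le> (nrm u * nrm v)\<^sup>2"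
  proof (cases "nrm v = 0")
    \<comment> \<open>Here the quadratic is affine in \<open>t\<close> with slope
      \<open>- 2 |z|^2\<close>. If \<open>z\<close> were nonzero, the value of \<open>t\<close>
      below would make it equal to \<open>- (nrm u)^2 - 2\<close>.\<close>
    case True
    have "(cmod z)\<^sup>2 \<le> 0"
    proof (rule ccontr)
      assume "\<not> ?thesis"
      then have p: "(cmod z)\<^sup>2 > 0" by simp
      have "0 \<le> (nrm u)\<^sup>2 - 2 * (((nrm u)\<^sup>2 + 1) / (cmod z)\<^sup>2) * (cmod z)\<^sup>2"
        using q[of "((nrm u)\<^sup>2 + 1) / (cmod z)\<^sup>2"] True by simp
      also have "\<dots> = (nrm u)\<^sup>2 - 2 * ((nrm u)\<^sup>2 + 1)" using p by (simp add: field_simps)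
      finally show False by (smt (verit) zero_le_power2)
    qed
    then show ?thesis by (smt (verit) zero_le_power2)
  next
    case False
    then have p: "(nrm v)\<^sup>2 > 0" by simp
    have "0 \<le> (nrm u)\<^sup>2 - (cmod z)\<^sup>2 / (nrm v)\<^sup>2"
    proof -
      define b where "b = (nrm v)\<^sup>2"
      have b: "b > 0" using p by (simp only: b_def)
      then have "(1 / b)\<^sup>2 * (cmod z)\<^sup>2 * b = (cmod z)\<^sup>2 / b"
        by (simp add: power2_eq_square)
      then show ?thesis using q[of "1 / b"] by (fold b_def) simp
    qed
    then show ?thesis using p by (simp add: power_mult_distrib field_simps)
  qed
  then show ?thesis
    unfolding z_def using nrm_nonneg[OF u] nrm_nonneg[OF v]
    by (metis mult_nonneg_nonneg power2_le_imp_le)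
qed

lemma nrm_triangle: 
  assumes u: "u \<in> S" and v: "v \<in> S"
  shows "nrm (u + v) \<le> nrm u + nrm v"
proof (rule power2_le_imp_le)
  have "Re (ip u v) \<le> nrm u * nrm v"
    using cauchy_schwarz[OF u v] complex_Re_le_cmod order_trans by blast
  then show "(nrm (u + v))\<^sup>2 \<le> (nrm u + nrm v)\<^sup>2"
    using nrm_add_sq[OF u v] by (simp add: power2_sum)
qed (use u v nrm_nonneg in auto)

lemma nrm_triangle3:
  assumes "u \<in> S" "v \<in> S" "w \<in> S"
  shows "nrm (u - w) \<le> nrm (u - v) + nrm (v - w)"
  using nrm_triangle[of "u - v" "v - w"] assms by (simp add: S_closed)

text \<open>Written with the midpoint, which is how it controls the distance of two near-minimisers
  in \<open>riesz\<close>.\<close>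

lemma parallelogram:
  assumes u: "u \<in> S" and v: "v \<in> S"
  shows "(nrm (u - v))\<^sup>2 = 2 * (nrm u)\<^sup>2 + 2 * (nrm v)\<^sup>2 - 4 * (nrm ((1/2) *\<^sub>R (u + v)))\<^sup>2"
proof -
  have "(nrm (u - v))\<^sup>2 = (nrm u)\<^sup>2 - 2 * Re (ip u v) + (nrm v)\<^sup>2"
    using nrm_add_sq[OF u S_closed(5)[OF v]] u v by (simp add: ip_simps nrm_minus)
  moreover have "(nrm ((1/2) *\<^sub>R (u + v)))\<^sup>2 = (nrm (u + v))\<^sup>2 / 4"
    using u v by (simp add: nrm_scaleR S_closed power_divide)
  ultimately show ?thesis using nrm_add_sq[OF u v] by simp
qed

end

section \<open>Completeness, Riesz representation and the lemma of Lax and Milgram\<close>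

definition form_Cauchy :: "('a::complex_vec \<Rightarrow> 'a \<Rightarrow> complex) \<Rightarrow> (nat \<Rightarrow> 'a) \<Rightarrow> bool" where
  "form_Cauchy B X \<longleftrightarrow> (\<forall>e>0. \<exists>N. \<forall>m\<ge>N. \<forall>n\<ge>N. form_norm B (X m - X n) < e)"

definition form_complete :: "'a::complex_vec set \<Rightarrow> ('a \<Rightarrow> 'a \<Rightarrow> complex) \<Rightarrow> bool" where
  "form_complete S B \<longleftrightarrow> (\<forall>X. (\<forall>n. X n \<in> S) \<longrightarrow> form_Cauchy B X \<longrightarrow>
     (\<exists>l\<in>S. (\<lambda>n. form_norm B (X n - l)) \<longlonglongrightarrow> 0))"

locale semi_hilbert = semi_inner +
  assumes complete: "form_complete S ip"
begin

lemma completeD: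
  assumes "\<And>n. X n \<in> S" "form_Cauchy ip X"
  obtains l where "l \<in> S" "(\<lambda>n. nrm (X n - l)) \<longlonglongrightarrow> 0"
  using complete assms unfolding form_complete_def by blast

end

definition antilinear_on :: "'a::complex_vec set \<Rightarrow> ('a \<Rightarrow> complex) \<Rightarrow> bool" where
  "antilinear_on S f \<longleftrightarrow> (\<forall>x\<in>S. \<forall>y\<in>S. f (x + y) = f x + f y) \<and> (\<forall>k. \<forall>x\<in>S. f (k *\<^sub>C x) = cnj k * f x)"

lemma antilin_scaleR: "antilinear_on S f \<Longrightarrow> x \<in> S \<Longrightarrow> f (r *\<^sub>R x) = of_real r * f x"
  by (simp add: scaleR_eq_scaleC antilinear_on_def)

context semi_hilbert
begin

text \<open>The functional \<open>J v = (nrm v)^2 - 2 Re (l v)\<close> is bounded below, and by the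
  parallelogram law its minimising sequences are Cauchy. The first variation at the limit gives the
  real part of the identity.\<close>

theorem riesz:
  assumes l: "antilinear_on S l" and K: "\<And>v. v \<in> S \<Longrightarrow> cmod (l v) \<le> K * nrm v"
  shows "\<exists>u\<in>S. \<forall>v\<in>S. ip u v = l v"
proof -
  define J where "J v = (nrm v)\<^sup>2 - 2 * Re (l v)" for v
  have ladd: "l (x + y) = l x + l y" if "x \<in> S" "y \<in> S" for x y
    using l that by (auto simp: antilinear_on_def)
  have lR: "l (r *\<^sub>R x) = of_real r * l x" if "x \<in> S" for r x
    using antilin_scaleR[OF l that] .
  have lower: "J v \<ge> - K\<^sup>2" if "v \<in> S" for v
  proof -
    have "Re (l v) \<le> K * nrm v" using K[OF that] complex_Re_le_cmod order_trans by blast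
    moreover have "0 \<le> (nrm v - K)\<^sup>2" by simp
    ultimately have "2 * Re (l v) \<le> (nrm v)\<^sup>2 + K\<^sup>2" by (simp add: power2_diff algebra_simps)
    then show ?thesis by (simp add: J_def)
  qed
  define m where "m = Inf (J ` S)"
  have bdd: "bdd_below (J ` S)" using lower by (auto intro!: bdd_belowI[of _ "- K\<^sup>2"])
  have mle: "m \<le> J v" if "v \<in> S" for v
    unfolding m_def using bdd that by (auto intro: cInf_lower)
  have "\<exists>v\<in>S. J v < m + 1 / real (Suc n)" for n
    using cInf_lessD[of "J ` S" "m + 1 / real (Suc n)"] S_closed(1) unfolding m_def by auto
  then obtain X where X: "\<And>n. X n \<in> S" "\<And>n. J (X n) < m + 1 / real (Suc n)" by metis
  \<comment> \<open>The midpoint also satisfies \<open>m \<le> J w\<close>, so the squared distance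
    is at most twice the sum of the excesses of \<open>X i\<close> and \<open>X j\<close> over the
    infimum.\<close>
  have dist: "(nrm (X i - X j))\<^sup>2 \<le> 2 / real (Suc i) + 2 / real (Suc j)" for i j
  proof -
    define w where "w = (1/2) *\<^sub>R (X i + X j)"
    have w: "w \<in> S" using X(1) by (simp add: w_def S_closed)
    have lw: "Re (l w) = (Re (l (X i)) + Re (l (X j))) / 2"
      using X(1) by (simp add: w_def lR ladd S_closed)
    have "(nrm (X i - X j))\<^sup>2 = 2 * J (X i) + 2 * J (X j) - 4 * J w"
      using parallelogram[OF X(1)[of i] X(1)[of j]] lw unfolding J_def w_def[symmetric] by simp
    then show ?thesis using X(2)[of i] X(2)[of j] mle[OF w] by simp
  qed
  have "form_Cauchy ip X"
    unfolding form_Cauchy_def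
  proof (intro allI impI)
    fix e :: real assume e: "e > 0"
    obtain N where N: "1 / real (Suc N) < e\<^sup>2 / 4"
      using e by (metis nat_approx_posE zero_less_divide_iff zero_less_numeral zero_less_power)
    show "\<exists>N. \<forall>m\<ge>N. \<forall>n\<ge>N. nrm (X m - X n) < e"
    proof (intro exI[of _ N] allI impI)
      fix i j assume "N \<le> i" "N \<le> j"
      then have "1 / real (Suc i) \<le> 1 / real (Suc N)" "1 / real (Suc j) \<le> 1 / real (Suc N)"
        by (auto intro!: divide_left_mono)
      then have "(nrm (X i - X j))\<^sup>2 < e\<^sup>2" using dist[of i j] N by simp
      then show "nrm (X i - X j) < e" using e power2_less_imp_less by fastforce
    qed
  qed
  then obtain u where u: "u \<in> S" "(\<lambda>n. nrm (X n - u)) \<longlonglongrightarrow> 0"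
    using completeD[of X] X(1) by blast
  have re: "Re (ip u w) = Re (l w)" if w: "w \<in> S" for w
  proof -
    define d where "d = Re (ip u w) - Re (l w)"
    have lim: "(\<lambda>n. Re (ip (X n) w)) \<longlonglongrightarrow> Re (ip u w)"
    proof (rule LIMSEQ_I)
      fix r :: real assume r: "r > 0"
      have "(\<lambda>n. nrm (X n - u) * nrm w) \<longlonglongrightarrow> 0 * nrm w" using u(2) by (intro tendsto_intros)
      then have "\<forall>\<^sub>F n in sequentially. nrm (X n - u) * nrm w < r"
        using r by (intro order_tendstoD(2)[of _ 0]) auto
      then obtain N where N: "\<And>n. n \<ge> N \<Longrightarrow> nrm (X n - u) * nrm w < r"
        by (auto simp: eventually_sequentially)
      show "\<exists>no. \<forall>n\<ge>no. norm (Re (ip (X n) w) - Re (ip u w)) < r"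
      proof (intro exI[of _ N] allI impI)
        fix n assume n: "N \<le> n"
        have "norm (Re (ip (X n) w) - Re (ip u w)) = \<bar>Re (ip (X n - u) w)\<bar>"
          using X(1) u w by (simp add: ip_simps)
        also have "\<dots> \<le> nrm (X n - u) * nrm w"
          using cauchy_schwarz[of "X n - u" w] abs_Re_le_cmod[of "ip (X n - u) w"] X(1) u w
          by (simp add: S_closed)
        finally show "norm (Re (ip (X n) w) - Re (ip u w)) < r" using N[OF n] by simp
      qed
    qed
    \<comment> \<open>Minimality is not claimed for \<open>u\<close> itself: \<open>X n\<close> is
      compared with its variation by \<open>t w\<close>, with an error below
      \<open>1 / (n + 1)\<close>, and the inequality is passed to the limit.\<close>
    have q: "0 \<le> 2 * t * d + t\<^sup>2 * (nrm w)\<^sup>2" for t :: real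
    proof -
      have *: "- (1 / real (Suc n)) \<le> 2 * t * (Re (ip (X n) w) - Re (l w)) + t\<^sup>2 * (nrm w)\<^sup>2" for n
      proof -
        have "J (X n) - 1 / real (Suc n) < m" using X(2)[of n] by simp
        also have "m \<le> J (X n + t *\<^sub>R w)" using X(1) w by (intro mle) (simp add: S_closed)
        also have "\<dots> = J (X n) + 2 * t * (Re (ip (X n) w) - Re (l w)) + t\<^sup>2 * (nrm w)\<^sup>2"
          using X(1)[of n] w
          by (simp add: J_def nrm_add_sq S_closed nrm_scaleR ladd lR power_mult_distrib
              scaleR_eq_scaleC[of t w] ip_simps)
             (simp add: scaleR_eq_scaleC[symmetric] nrm_scaleR power_mult_distrib ladd lR algebra_simps)
        finally show ?thesis by simp
      qed
      have l1: "(\<lambda>n. - (1 / real (Suc n))) \<longlonglongrightarrow> - 0"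
        using LIMSEQ_inverse_real_of_nat by (intro tendsto_minus) (simp add: inverse_eq_divide)
      have l2: "(\<lambda>n. 2 * t * (Re (ip (X n) w) - Re (l w)) + t\<^sup>2 * (nrm w)\<^sup>2) \<longlonglongrightarrow> 2 * t * d + t\<^sup>2 * (nrm w)\<^sup>2"
        unfolding d_def by (intro tendsto_intros lim)
      show ?thesis using LIMSEQ_le[OF l1 l2] * by auto
    qed
    have "d = 0"
    proof (rule ccontr)
      assume d: "d \<noteq> 0"
      \<comment> \<open>A positive substitute for \<open>(nrm w)^2\<close>, which may vanish;
        \<open>t = - d / c\<close> then makes the quadratic negative.\<close>
      define c where "c = (nrm w)\<^sup>2 + 1"
      have c: "c > 0" by (simp add: c_def add_nonneg_pos)
      have "0 \<le> 2 * (- d / c) * d + (- d / c)\<^sup>2 * (nrm w)\<^sup>2" by (rule q)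
      also have "\<dots> \<le> 2 * (- d / c) * d + (- d / c)\<^sup>2 * c"
        by (intro add_left_mono mult_left_mono) (auto simp: c_def)
      also have "\<dots> = - d\<^sup>2 / c" using c by (simp add: power2_eq_square field_simps)
      also have "\<dots> < 0" using c d by (simp add: field_simps)
      finally show False by simp
    qed
    then show ?thesis by (simp add: d_def)
  qed
  have "ip u w = l w" if w: "w \<in> S" for w
  proof (rule complex_eqI)
    show "Re (ip u w) = Re (l w)" by (rule re[OF w])
    \<comment> \<open>Both sides are antilinear in \<open>w\<close>, so the real parts at
      \<open>\<i>\<close> times \<open>w\<close> are the imaginary parts at
      \<open>w\<close>.\<close>
    have "Re (ip u (\<i> *\<^sub>C w)) = Re (l (\<i> *\<^sub>C w))" using w by (intro re) (simp add: S_closed)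
    moreover have "l (\<i> *\<^sub>C w) = cnj \<i> * l w" using l w unfolding antilinear_on_def by blast
    ultimately show "Im (ip u w) = Im (l w)" using u w by (simp add: ip_simps)
  qed
  then show ?thesis using u by blast
qed

text \<open>With \<open>T\<close> the Riesz representation of \<open>B\<close>, one solves \<open>T u = f\<close> by applying Riesz' theorem
  to the inner product \<open>ip (T u) (T v)\<close>, which coercivity makes equivalent to \<open>ip\<close>.\<close>

theorem lax_milgram:
  assumes B: "sesquilinear_on S B" and bound: "\<And>u v. u \<in> S \<Longrightarrow> v \<in> S \<Longrightarrow> cmod (B u v) \<le> M * nrm u * nrm v"
    and coercive: "\<And>u. u \<in> S \<Longrightarrow> (nrm u)\<^sup>2 \<le> Re (B u u)"
    and l: "antilinear_on S l" and K: "\<And>v. v \<in> S \<Longrightarrow> cmod (l v) \<le> K * nrm v"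
  shows "\<exists>u\<in>S. \<forall>v\<in>S. B u v = l v"
proof -
  have "\<exists>w\<in>S. \<forall>v\<in>S. ip w v = B u v" if u: "u \<in> S" for u
    using B u bound[OF u] by (intro riesz[where K="M * nrm u"]) (auto simp: antilinear_on_def sesquilinear_on_def)
  then obtain T where T: "\<And>u. u \<in> S \<Longrightarrow> T u \<in> S" "\<And>u v. u \<in> S \<Longrightarrow> v \<in> S \<Longrightarrow> ip (T u) v = B u v"
    by metis
  obtain f where f: "f \<in> S" "\<And>v. v \<in> S \<Longrightarrow> ip f v = l v"
    using riesz[OF l K] by blast
  have ipT: "ip u (T v) = cnj (B v u)" if "u \<in> S" "v \<in> S" for u v
    using T that cnj_ip by metis
  define ip2 where "ip2 u v = ip (T u) (T v)" for u v
  have M0: "nrm (T u) \<le> M * nrm u" if u: "u \<in> S" for u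
  proof (cases "nrm (T u) = 0")
    case True
    have "0 \<le> M * nrm u"
    proof (cases "nrm u = 0")
      case False
      then have p: "nrm u > 0" using nrm_nonneg[OF u] by simp
      have "0 \<le> M * nrm u * nrm u" using bound[OF u u] norm_ge_zero order_trans by blast
      then show ?thesis using p by (simp add: zero_le_mult_iff)
    qed simp
    then show ?thesis using True by simp
  next
    case False
    have "(nrm (T u))\<^sup>2 = Re (B u (T u))" using T u by (simp add: nrm_sq)
    also have "\<dots> \<le> M * nrm u * nrm (T u)"
      using bound[OF u T(1)[OF u]] complex_Re_le_cmod order_trans by blast
    finally show ?thesis using False nrm_nonneg[OF T(1)[OF u]] by (simp add: power2_eq_square)
  qed
  have low: "nrm u \<le> nrm (T u)" if u: "u \<in> S" for u
  proof (cases "nrm u = 0")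
    case True then show ?thesis using nrm_nonneg[OF T(1)[OF u]] by simp
  next
    case False
    have "(nrm u)\<^sup>2 \<le> Re (ip (T u) u)" using coercive u T by simp
    also have "\<dots> \<le> nrm (T u) * nrm u"
      using cauchy_schwarz[OF T(1)[OF u] u] complex_Re_le_cmod order_trans by blast
    finally show ?thesis using False nrm_nonneg[OF u] by (simp add: power2_eq_square)
  qed
  have norm2: "form_norm ip2 u = nrm (T u)" for u by (simp add: form_norm_def ip2_def)
  interpret H2: semi_hilbert S ip2
  proof
    show "csubspace S" by (rule S)
    \<comment> \<open>Riesz representatives are fixed only up to vectors of seminorm zero, so
      \<open>T\<close> is not known to be additive. These two formulas let \<open>ip2\<close>
      inherit sesquilinearity from \<open>B\<close> instead.\<close>
    have ip2: "ip2 u v = B u (T v)" "ip2 u v = cnj (B v (T u))" if "u \<in> S" "v \<in> S" for u v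
      using that T(1) T(2)[of u "T v"] T(2)[of v "T u"] cnj_ip[of "T v" "T u"]
      by (auto simp: ip2_def)
    show "sesquilinear_on S ip2"
    proof (rule sesqI)
      fix x y z assume xyz: "x \<in> S" "y \<in> S" "z \<in> S"
      then show "ip2 (x + y) z = ip2 x z + ip2 y z"
        by (simp add: ip2(1) T(1) S_closed sesq_addL[OF B])
      show "ip2 x (y + z) = ip2 x y + ip2 x z"
        using xyz by (simp add: ip2(2) T(1) S_closed sesq_addL[OF B])
    next
      fix k x y assume "x \<in> S" "y \<in> S"
      then have "ip2 (k *\<^sub>C x) y = k * B x (T y)" "ip2 x (k *\<^sub>C y) = cnj k * cnj (B y (T x))"
        by (simp_all add: ip2(1)[of "k *\<^sub>C x"] ip2(2)[of x "k *\<^sub>C y"] T(1) S_closed sesq_scaleL[OF B])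
      then show "ip2 (k *\<^sub>C x) y = k * ip2 x y" "ip2 x (k *\<^sub>C y) = cnj k * ip2 x y"
        using ip2[OF \<open>x \<in> S\<close> \<open>y \<in> S\<close>] by simp_all
    qed
    show "cnj (ip2 u v) = ip2 v u" if "u \<in> S" "v \<in> S" for u v
      using that T(1) cnj_ip by (simp add: ip2_def)
    show "0 \<le> Re (ip2 u u)" if "u \<in> S" for u
      using that T(1) Re_ip_nonneg by (simp add: ip2_def)
    \<comment> \<open>The lower bound \<open>low\<close> carries Cauchy sequences from
      \<open>ip2\<close> to \<open>ip\<close>, and the upper bound \<open>M0\<close> carries the
      limits back.\<close>
    show "form_complete S ip2"
      unfolding form_complete_def
    proof (intro allI impI)
      fix X assume X: "\<forall>n. X n \<in> S" "form_Cauchy ip2 X"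
      have "form_Cauchy ip X"
        unfolding form_Cauchy_def
      proof (intro allI impI)
        fix e :: real assume "e > 0"
        then obtain N where "\<And>m n. m \<ge> N \<Longrightarrow> n \<ge> N \<Longrightarrow> nrm (T (X m - X n)) < e"
          using X(2) unfolding form_Cauchy_def norm2 by blast
        then show "\<exists>N. \<forall>m\<ge>N. \<forall>n\<ge>N. nrm (X m - X n) < e"
          using X(1) low by (meson S_closed(6) order_le_less_trans)
      qed
      then obtain u where u: "u \<in> S" "(\<lambda>n. nrm (X n - u)) \<longlonglongrightarrow> 0"
        using completeD[of X] X(1) by blast
      have "(\<lambda>n. M * nrm (X n - u)) \<longlonglongrightarrow> M * 0" by (intro tendsto_intros u)
      then have lim: "(\<lambda>n. M * nrm (X n - u)) \<longlonglongrightarrow> 0" by simp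
      have "(\<lambda>n. nrm (T (X n - u))) \<longlonglongrightarrow> 0"
        using X(1) u(1) M0 nrm_nonneg T(1)
        by (intro tendsto_sandwich[OF _ _ tendsto_const lim] always_eventually allI) (auto simp: S_closed)
      then show "\<exists>l\<in>S. (\<lambda>n. form_norm ip2 (X n - l)) \<longlonglongrightarrow> 0" using u(1) by (auto simp: norm2)
    qed
  qed
  have "\<exists>u\<in>S. \<forall>v\<in>S. ip2 u v = ip f (T v)"
  proof (rule H2.riesz[where K="nrm f"])
    show "antilinear_on S (\<lambda>v. ip f (T v))"
      unfolding antilinear_on_def using f(1) by (auto simp: ipT S_closed sesq_addL[OF B] sesq_scaleL[OF B])
    show "cmod (ip f (T v)) \<le> nrm f * form_norm ip2 v" if "v \<in> S" for v
      using cauchy_schwarz[OF f(1) T(1)[OF that]] by (simp add: norm2)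
  qed
  then obtain u where u: "u \<in> S" "\<And>v. v \<in> S \<Longrightarrow> ip (T u) (T v) = ip f (T v)"
    by (auto simp: ip2_def)
  \<comment> \<open>The vector \<open>w\<close> is orthogonal to the range of \<open>T\<close>, so
    \<open>B w w = 0\<close> and coercivity makes it null: \<open>T u\<close> represents the same
    functional as \<open>f\<close>.\<close>
  define w where "w = T u - f"
  have w: "w \<in> S" using u T f by (simp add: w_def S_closed)
  have "ip w (T w) = 0"
    using u w T f unfolding w_def by (simp add: ip_simps S_closed)
  then have "B w w = 0" using ipT[OF w w] by simp
  then have "nrm w = 0" using coercive[OF w] by simp
  then have z: "ip w v = 0" if "v \<in> S" for v using cauchy_schwarz[OF w that] by simp
  have "B u v = l v" if v: "v \<in> S" for v
    using z[OF v] T f u v unfolding w_def by (simp add: ip_simps)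
  then show ?thesis using u by blast
qed

end

section \<open>The spaces of square integrable functions\<close>

lemma borel_measurable_cnj [measurable (raw)]:
  "f \<in> borel_measurable M \<Longrightarrow> (\<lambda>x. cnj (f x)) \<in> borel_measurable M"
  by (erule measurable_compose) (intro borel_measurable_continuous_onI continuous_intros)

section \<open>Classes of functions through representatives; membership in L2\<close>

lemma rep_aefun_measurable [measurable]: "rep_aefun f \<in> borel_measurable borel"
  using Quotient_rep_reflp[OF Quotient_aefun, of f] by simp

lemma rep_aefun_eqI: "AE x in lborel. rep_aefun f x = rep_aefun g x \<Longrightarrow> f = g"
  using Quotient_rel_rep[OF Quotient_aefun, of f g] by simp

lemma rep_abs_aefun: "g \<in> borel_measurable borel \<Longrightarrow> AE x in lborel. rep_aefun (abs_aefun g) x = g x"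
  using Quotient_rep_abs[OF Quotient_aefun, of g] by simp

lemma rep_aefun_zero: "AE x in lborel. rep_aefun 0 x = 0"
  unfolding zero_aefun_def by (rule rep_abs_aefun) simp

lemma rep_aefun_plus: "AE x in lborel. rep_aefun (f + g) x = rep_aefun f x + rep_aefun g x"
  unfolding plus_aefun_def map_fun_def comp_def id_def by (rule rep_abs_aefun) simp

lemma rep_aefun_minus: "AE x in lborel. rep_aefun (f - g) x = rep_aefun f x - rep_aefun g x"
  unfolding minus_aefun_def map_fun_def comp_def id_def by (rule rep_abs_aefun) simp

lemma rep_aefun_scaleC: "AE x in lborel. rep_aefun (k *\<^sub>C f) x = k * rep_aefun f x"
  unfolding scaleC_aefun_def map_fun_def comp_def id_def by (rule rep_abs_aefun) simp

lemma L2_iff: "f \<in> L2 a b \<longleftrightarrow> (AE x in lborel. x \<notin> {a<..<b} \<longrightarrow> rep_aefun f x = 0) \<and>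
    integrable lborel (\<lambda>x. (cmod (rep_aefun f x))\<^sup>2)"
  by (simp add: L2_def in_L2.rep_eq)

lemma L2_D:
  assumes "f \<in> L2 a b"
  shows "AE x in lborel. x \<notin> {a<..<b} \<longrightarrow> rep_aefun f x = 0"
    and "integrable lborel (\<lambda>x. (cmod (rep_aefun f x))\<^sup>2)"
  using assms by (auto simp: L2_iff)

lemma abs_aefun_L2:
  assumes [measurable]: "g \<in> borel_measurable borel"
    and "AE x in lborel. x \<notin> {a<..<b} \<longrightarrow> g x = 0" "integrable lborel (\<lambda>x. (cmod (g x))\<^sup>2)"
  shows "abs_aefun g \<in> L2 a b"
proof -
  note ae = rep_abs_aefun[OF assms(1)]
  have "integrable lborel (\<lambda>x. (cmod (rep_aefun (abs_aefun g) x))\<^sup>2)"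
    by (rule integrable_cong_AE_imp[OF assms(3)]) (use ae in \<open>auto elim!: AE_mp\<close>)
  moreover have "AE x in lborel. x \<notin> {a<..<b} \<longrightarrow> rep_aefun (abs_aefun g) x = 0"
    using assms(2) ae by eventually_elim auto
  ultimately show ?thesis by (simp add: L2_iff)
qed

lemma L2_mult_integrable:
  assumes "f \<in> L2 a b" "g \<in> L2 a b"
  shows "integrable lborel (\<lambda>x. rep_aefun f x * rep_aefun g x)"
    and "integrable lborel (\<lambda>x. rep_aefun f x * cnj (rep_aefun g x))"
proof -
  have *: "integrable lborel (\<lambda>x. (cmod (rep_aefun f x))\<^sup>2 + (cmod (rep_aefun g x))\<^sup>2)"
    using assms by (intro Bochner_Integration.integrable_add L2_D)
  have ineq: "s * t \<le> s\<^sup>2 + t\<^sup>2" if "0 \<le> s" "0 \<le> t" for s t :: real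
  proof -
    have "0 \<le> (s - t)\<^sup>2 + s * t" using that by simp
    then have "s * t \<le> s * t + (s - t)\<^sup>2 + s * t" using that by simp
    then show ?thesis by (simp add: power2_diff)
  qed
  show "integrable lborel (\<lambda>x. rep_aefun f x * rep_aefun g x)"
    by (rule Bochner_Integration.integrable_bound[OF *]) (auto simp: norm_mult intro!: ineq)
  show "integrable lborel (\<lambda>x. rep_aefun f x * cnj (rep_aefun g x))"
    by (rule Bochner_Integration.integrable_bound[OF *]) (auto simp: norm_mult intro!: ineq)
qed

text \<open>Elements of \<open>L2 a b\<close> vanish outside the interval, so the integral may run
  over the whole line. This is what makes inner products on different intervals comparable when
  functions are glued.\<close>

lemma L2_inner_eq:
  assumes "f \<in> L2 a b"
  shows "L2_inner a b f g = (LINT x|lborel. rep_aefun f x * cnj (rep_aefun g x))"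
  unfolding L2_inner.rep_eq set_lebesgue_integral_def
  by (rule integral_cong_AE) (use L2_D(1)[OF assms] in \<open>auto simp: indicator_def elim!: eventually_mono\<close>)

lemma csub_L2: "csubspace (L2 a b)"
proof (rule csubI)
  show "0 \<in> L2 a b"
    unfolding zero_aefun_def by (rule abs_aefun_L2) auto
next
  fix f g assume fg: "f \<in> L2 a b" "g \<in> L2 a b"
  have *: "integrable lborel (\<lambda>x. 2 * (cmod (rep_aefun f x))\<^sup>2 + 2 * (cmod (rep_aefun g x))\<^sup>2)"
    using fg by (intro Bochner_Integration.integrable_add integrable_mult_right L2_D)
  have ineq: "(cmod (s + t))\<^sup>2 \<le> 2 * (cmod s)\<^sup>2 + 2 * (cmod t)\<^sup>2" for s t
  proof -
    have "(cmod (s + t))\<^sup>2 \<le> (cmod s + cmod t)\<^sup>2" by (intro power_mono norm_triangle_ineq) simp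
    also have "\<dots> \<le> \<dots> + (cmod s - cmod t)\<^sup>2" by simp
    also have "\<dots> = 2 * (cmod s)\<^sup>2 + 2 * (cmod t)\<^sup>2" by (simp add: power2_sum power2_diff)
    finally show ?thesis .
  qed
  have "integrable lborel (\<lambda>x. (cmod (rep_aefun f x + rep_aefun g x))\<^sup>2)"
    by (rule Bochner_Integration.integrable_bound[OF *]) (auto intro!: ineq)
  then show "f + g \<in> L2 a b"
    unfolding plus_aefun_def map_fun_def comp_def id_def
    using L2_D(1)[OF fg(1)] L2_D(1)[OF fg(2)]
    by (intro abs_aefun_L2) (auto elim!: AE_mp)
next
  fix k f assume f: "f \<in> L2 a b"
  show "k *\<^sub>C f \<in> L2 a b"
    unfolding scaleC_aefun_def map_fun_def comp_def id_def
    using L2_D[OF f] by (intro abs_aefun_L2) (auto simp: norm_mult power_mult_distrib elim!: AE_mp)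
qed

lemma sesq_L2_inner: "sesquilinear_on (L2 a b) (L2_inner a b)"
proof (rule sesqI)
  fix f g h assume [simp]: "f \<in> L2 a b" "g \<in> L2 a b" "h \<in> L2 a b"
  note [simp] = csub_add[OF csub_L2] csub_scaleC[OF csub_L2] L2_mult_integrable
  show "L2_inner a b (f + g) h = L2_inner a b f h + L2_inner a b g h"
  proof -
    have "L2_inner a b (f + g) h = (LINT x|lborel. rep_aefun f x * cnj (rep_aefun h x)
        + rep_aefun g x * cnj (rep_aefun h x))"
      unfolding L2_inner_eq[OF csub_add[OF csub_L2 \<open>f \<in> L2 a b\<close> \<open>g \<in> L2 a b\<close>]]
      by (rule integral_cong_AE)
         (use rep_aefun_plus[of f g] in \<open>auto simp: distrib_right elim!: eventually_mono\<close>)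
    then show ?thesis
      by (simp add: L2_inner_eq Bochner_Integration.integral_add[OF L2_mult_integrable(2)[of f a b h]
          L2_mult_integrable(2)[of g a b h]])
  qed
  show "L2_inner a b f (g + h) = L2_inner a b f g + L2_inner a b f h"
  proof -
    have "L2_inner a b f (g + h) = (LINT x|lborel. rep_aefun f x * cnj (rep_aefun g x)
        + rep_aefun f x * cnj (rep_aefun h x))"
      unfolding L2_inner_eq[OF \<open>f \<in> L2 a b\<close>]
      by (rule integral_cong_AE)
         (use rep_aefun_plus[of g h] in \<open>auto simp: distrib_left elim!: eventually_mono\<close>)
    then show ?thesis
      by (simp add: L2_inner_eq Bochner_Integration.integral_add[OF L2_mult_integrable(2)[of f a b g]
          L2_mult_integrable(2)[of f a b h]])
  qed
next
  fix k f g assume [simp]: "f \<in> L2 a b" "g \<in> L2 a b"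
  show "L2_inner a b (k *\<^sub>C f) g = k * L2_inner a b f g"
  proof -
    have "L2_inner a b (k *\<^sub>C f) g = (LINT x|lborel. k * (rep_aefun f x * cnj (rep_aefun g x)))"
      unfolding L2_inner_eq[OF csub_scaleC[OF csub_L2 \<open>f \<in> L2 a b\<close>]]
      by (rule integral_cong_AE)
         (use rep_aefun_scaleC[of k f] in \<open>auto elim!: eventually_mono\<close>)
    then show ?thesis by (simp add: L2_inner_eq)
  qed
  show "L2_inner a b f (k *\<^sub>C g) = cnj k * L2_inner a b f g"
  proof -
    have "L2_inner a b f (k *\<^sub>C g) = (LINT x|lborel. cnj k * (rep_aefun f x * cnj (rep_aefun g x)))"
      unfolding L2_inner_eq[OF \<open>f \<in> L2 a b\<close>]
      by (rule integral_cong_AE)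
         (use rep_aefun_scaleC[of k g] in \<open>auto elim!: eventually_mono\<close>)
    then show ?thesis by (simp add: L2_inner_eq)
  qed
qed

lemma L2_inner_self:
  assumes "f \<in> L2 a b"
  shows "L2_inner a b f f = of_real (LINT x|lborel. (cmod (rep_aefun f x))\<^sup>2)"
  unfolding L2_inner_eq[OF assms] complex_norm_square[symmetric] integral_complex_of_real ..

lemma L2_norm_sq:
  assumes "f \<in> L2 a b"
  shows "(L2_norm a b f)\<^sup>2 = (LINT x|lborel. (cmod (rep_aefun f x))\<^sup>2)"
  using L2_inner_self[OF assms] by (simp add: L2_norm_def)

lemma L2_norm_form_norm: "L2_norm a b = form_norm (L2_inner a b)"
  by (rule ext) (simp add: L2_norm_def form_norm_def)

lemma L2_norm_eq_0:
  assumes f: "f \<in> L2 a b" and "L2_norm a b f = 0"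
  shows "f = 0"
proof -
  have "(LINT x|lborel. (cmod (rep_aefun f x))\<^sup>2) = 0" using L2_norm_sq[OF f] assms(2) by simp
  then have "AE x in lborel. (cmod (rep_aefun f x))\<^sup>2 = 0"
    by (subst (asm) integral_nonneg_eq_0_iff_AE) (use L2_D[OF f] in auto)
  then have "AE x in lborel. rep_aefun f x = rep_aefun 0 x"
    using rep_aefun_zero by eventually_elim simp
  then show ?thesis by (rule rep_aefun_eqI)
qed

text \<open>Cauchy-Schwarz for an indicator and \<open>f\<close>, done with nonnegative integrals so
  that integrability is a result. It yields the embedding of L2 into L1 on an interval and the
  Hoelder bound for primitives.\<close>

lemma integral_indicator_le_sqrt:
  fixes f :: "real \<Rightarrow> complex"
  assumes [measurable]: "f \<in> borel_measurable borel" "A \<in> sets borel"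
    and f2: "integrable lborel (\<lambda>x. (cmod (f x))\<^sup>2)" and A: "emeasure lborel A \<le> ennreal m" "0 \<le> m"
  shows "integrable lborel (\<lambda>x. indicator A x *\<^sub>R f x)"
    and "(LINT x|lborel. cmod (indicator A x *\<^sub>R f x)) \<le> sqrt m * sqrt (LINT x|lborel. (cmod (f x))\<^sup>2)"
proof -
  define I where "I = (LINT x|lborel. (cmod (f x))\<^sup>2)"
  have I0: "0 \<le> I" by (simp add: I_def)
  have "(\<integral>\<^sup>+x. ennreal (cmod (indicator A x *\<^sub>R f x)) \<partial>lborel)\<^sup>2
      = (\<integral>\<^sup>+x. (indicator A x :: ennreal) * ennreal (cmod (f x)) \<partial>lborel)\<^sup>2"
    by (auto intro!: arg_cong[of _ _ "\<lambda>x. x\<^sup>2"] nn_integral_cong split: split_indicator)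
  also have "\<dots> \<le> (\<integral>\<^sup>+x. (indicator A x)\<^sup>2 \<partial>lborel) * (\<integral>\<^sup>+x. (ennreal (cmod (f x)))\<^sup>2 \<partial>lborel)"
    by (rule Cauchy_Schwarz_nn_integral) auto
  also have "(\<integral>\<^sup>+x. (indicator A x :: ennreal)\<^sup>2 \<partial>lborel) = (\<integral>\<^sup>+x. indicator A x \<partial>lborel)"
    by (intro nn_integral_cong) (auto split: split_indicator)
  also have "\<dots> = emeasure lborel A" by simp
  also have "(\<integral>\<^sup>+x. (ennreal (cmod (f x)))\<^sup>2 \<partial>lborel) = ennreal I"
    using f2 unfolding I_def by (subst nn_integral_eq_integral[symmetric]) (auto simp: ennreal_power)
  also have "emeasure lborel A * ennreal I \<le> ennreal m * ennreal I"
    by (intro mult_right_mono A) auto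
  also have "\<dots> = (ennreal (sqrt m * sqrt I))\<^sup>2"
    using A I0 by (simp add: ennreal_mult[symmetric] ennreal_power power_mult_distrib)
  finally have le: "(\<integral>\<^sup>+x. ennreal (cmod (indicator A x *\<^sub>R f x)) \<partial>lborel)\<^sup>2 \<le> (ennreal (sqrt m * sqrt I))\<^sup>2" .
  then have "(\<integral>\<^sup>+x. ennreal (cmod (indicator A x *\<^sub>R f x)) \<partial>lborel)\<^sup>2 < \<infinity>"
    by (rule le_less_trans) (simp add: power_less_top_ennreal)
  then have "(\<integral>\<^sup>+x. ennreal (cmod (indicator A x *\<^sub>R f x)) \<partial>lborel) < \<infinity>"
    by (simp add: power_less_top_ennreal)
  then show int: "integrable lborel (\<lambda>x. indicator A x *\<^sub>R f x)"
    by (intro integrableI_bounded) auto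
  have eq: "(\<integral>\<^sup>+x. ennreal (cmod (indicator A x *\<^sub>R f x)) \<partial>lborel)
      = ennreal (LINT x|lborel. cmod (indicator A x *\<^sub>R f x))"
    using int by (intro nn_integral_eq_integral integrable_norm) auto
  have "ennreal ((LINT x|lborel. cmod (indicator A x *\<^sub>R f x))\<^sup>2) \<le> ennreal ((sqrt m * sqrt I)\<^sup>2)"
    using le A I0 unfolding eq by (simp add: ennreal_power)
  then have "(LINT x|lborel. cmod (indicator A x *\<^sub>R f x))\<^sup>2 \<le> (sqrt m * sqrt I)\<^sup>2"
    by (subst (asm) ennreal_le_iff) auto
  then show "(LINT x|lborel. cmod (indicator A x *\<^sub>R f x)) \<le> sqrt m * sqrt (LINT x|lborel. (cmod (f x))\<^sup>2)"
    unfolding I_def by (rule power2_le_imp_le) (use A in auto)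
qed

text \<open>L2 embeds into L1 because the interval has finite length; \<open>max 0\<close> covers an
  empty interval.\<close>

lemma L2_integrable:
  assumes f: "f \<in> L2 a b"
  shows "integrable lborel (rep_aefun f)"
    and "(LINT x|lborel. cmod (rep_aefun f x)) \<le> sqrt (max 0 (b - a)) * L2_norm a b f"
proof -
  have m: "emeasure lborel {a<..<b} \<le> ennreal (max 0 (b - a))"
    by (cases "a \<le> b") (auto simp: max_def)
  have ae: "AE x in lborel. indicator {a<..<b} x *\<^sub>R rep_aefun f x = rep_aefun f x"
    using L2_D(1)[OF f] by eventually_elim auto
  note * = integral_indicator_le_sqrt[OF _ _ L2_D(2)[OF f] m]
  show "integrable lborel (rep_aefun f)"
  proof (rule integrable_cong_AE_imp[OF *(1)])
    show "AE x in lborel. indicator {a<..<b} x *\<^sub>R rep_aefun f x = rep_aefun f x" by (rule ae)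
  qed auto
  have "(LINT x|lborel. cmod (rep_aefun f x)) = (LINT x|lborel. cmod (indicator {a<..<b} x *\<^sub>R rep_aefun f x))"
  proof (rule integral_cong_AE)
    show "AE x in lborel. cmod (rep_aefun f x) = cmod (indicator {a<..<b} x *\<^sub>R rep_aefun f x)"
      using ae by eventually_elim metis
  qed auto
  also have "\<dots> \<le> sqrt (max 0 (b - a)) * sqrt (LINT x|lborel. (cmod (rep_aefun f x))\<^sup>2)"
    by (rule *(2)) auto
  also have "sqrt (LINT x|lborel. (cmod (rep_aefun f x))\<^sup>2) = L2_norm a b f"
    by (simp add: L2_norm_def L2_inner_self[OF f])
  finally show "(LINT x|lborel. cmod (rep_aefun f x)) \<le> sqrt (max 0 (b - a)) * L2_norm a b f" .
qed

lemma L2_semi_inner: "semi_inner (L2 a b) (L2_inner a b)"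
proof
  show "cnj (L2_inner a b f g) = L2_inner a b g f" if "f \<in> L2 a b" "g \<in> L2 a b" for f g
  proof -
    have "cnj (LINT x|lborel. rep_aefun f x * cnj (rep_aefun g x))
        = (LINT x|lborel. cnj (rep_aefun f x * cnj (rep_aefun g x)))"
      by (rule Bochner_Integration.integral_cnj[symmetric])
    then show ?thesis using that by (simp add: L2_inner_eq mult.commute)
  qed
  show "0 \<le> Re (L2_inner a b f f)" if "f \<in> L2 a b" for f
    using L2_inner_self[OF that] by simp
qed (rule csub_L2 sesq_L2_inner)+

text \<open>Riesz--Fischer: an \<open>L\<^sup>2\<close>-Cauchy sequence is \<open>L\<^sup>1\<close>-Cauchy, as the interval is bounded, so a
  subsequence converges almost everywhere; Fatou's lemma shows that its limit is the \<open>L\<^sup>2\<close>-limit.\<close>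

lemma L2_complete: "form_complete (L2 a b) (L2_inner a b)"
  unfolding form_complete_def
proof (intro allI impI)
  fix X assume X: "\<forall>n. X n \<in> L2 a b" and "form_Cauchy (L2_inner a b) X"
  then have C: "\<exists>N. \<forall>m\<ge>N. \<forall>n\<ge>N. L2_norm a b (X m - X n) < e" if "e > 0" for e
    using that by (simp add: form_Cauchy_def L2_norm_form_norm)
  interpret semi_inner "L2 a b" "L2_inner a b" by (rule L2_semi_inner)
  define s where "s n = rep_aefun (X n)" for n
  have [measurable]: "s n \<in> borel_measurable borel" for n by (simp add: s_def)
  have D: "X m - X n \<in> L2 a b" for m n using X by (simp add: S_closed)
  have sdiff: "AE x in lborel. rep_aefun (X m - X n) x = s m x - s n x" for m n
    using rep_aefun_minus by (simp add: s_def)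
  obtain r where r: "strict_mono r" "AE x in lborel. Cauchy (\<lambda>i. s (r i) x)"
  proof (rule cauchy_L1_AE_cauchy_subseq[of lborel s])
    show "integrable lborel (s n)" for n unfolding s_def using X L2_integrable by blast
    fix e :: real assume e: "e > 0"
    \<comment> \<open>The summand 1 keeps the divisor positive when the interval is empty.\<close>
    define K where "K = sqrt (max 0 (b - a)) + 1"
    have K: "K > 0" by (simp add: K_def add_nonneg_pos)
    obtain N where N: "\<And>m n. m \<ge> N \<Longrightarrow> n \<ge> N \<Longrightarrow> L2_norm a b (X m - X n) < e / K"
      using C[of "e / K"] e K by auto
    show "\<exists>N. \<forall>i\<ge>N. \<forall>j\<ge>N. LINT x|lborel. norm (s i x - s j x) < e"
    proof (intro exI[of _ N] allI impI)
      fix i j assume ij: "i \<ge> N" "j \<ge> N"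
      have "(LINT x|lborel. norm (s i x - s j x)) = (LINT x|lborel. cmod (rep_aefun (X i - X j) x))"
        by (rule integral_cong_AE) (use sdiff[of i j] in \<open>auto elim!: eventually_mono\<close>)
      also have "\<dots> \<le> sqrt (max 0 (b - a)) * L2_norm a b (X i - X j)" by (rule L2_integrable[OF D])
      also have "\<dots> \<le> K * L2_norm a b (X i - X j)"
        using nrm_nonneg[OF D] by (intro mult_right_mono) (auto simp: K_def L2_norm_form_norm)
      also have "\<dots> < K * (e / K)" using K N[OF ij] by (intro mult_strict_left_mono)
      finally show "(LINT x|lborel. norm (s i x - s j x)) < e" using K by simp
    qed
  qed auto
  define f where "f x = lim (\<lambda>i. s (r i) x)" for x
  have f[measurable]: "f \<in> borel_measurable borel"
    unfolding f_def by (rule borel_measurable_lim_metric) simp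
  have lim: "AE x in lborel. (\<lambda>i. s (r i) x) \<longlonglongrightarrow> f x"
    using r(2) by eventually_elim (simp add: f_def Cauchy_convergent_iff convergent_LIMSEQ_iff)
  have fatou: "(\<integral>\<^sup>+x. (cmod (f x - s n x))\<^sup>2 \<partial>lborel) \<le> ennreal (e\<^sup>2)"
    if e: "e > 0" and N: "\<And>m. m \<ge> N \<Longrightarrow> L2_norm a b (X m - X n) < e" for e N n
  proof -
    have "(\<integral>\<^sup>+x. (cmod (f x - s n x))\<^sup>2 \<partial>lborel)
        = (\<integral>\<^sup>+x. liminf (\<lambda>i. ennreal ((cmod (s (r i) x - s n x))\<^sup>2)) \<partial>lborel)"
    proof (rule nn_integral_cong_AE)
      show "AE x in lborel. ennreal ((cmod (f x - s n x))\<^sup>2) = liminf (\<lambda>i. ennreal ((cmod (s (r i) x - s n x))\<^sup>2))"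
        using lim
      proof eventually_elim
        case (elim x)
        have "(\<lambda>i. ennreal ((cmod (s (r i) x - s n x))\<^sup>2)) \<longlonglongrightarrow> ennreal ((cmod (f x - s n x))\<^sup>2)"
          by (intro tendsto_intros elim)
        then show ?case by (rule lim_imp_Liminf[OF sequentially_bot, symmetric])
      qed
    qed
    also have "\<dots> \<le> liminf (\<lambda>i. \<integral>\<^sup>+x. ennreal ((cmod (s (r i) x - s n x))\<^sup>2) \<partial>lborel)"
      by (rule nn_integral_liminf) auto
    also have "\<dots> \<le> ennreal (e\<^sup>2)"
    proof (rule Liminf_le[OF sequentially_bot])
      show "\<forall>\<^sub>F i in sequentially. (\<integral>\<^sup>+x. ennreal ((cmod (s (r i) x - s n x))\<^sup>2) \<partial>lborel) \<le> ennreal (e\<^sup>2)"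
        unfolding eventually_sequentially
      proof (intro exI[of _ N] allI impI)
        fix i assume "i \<ge> N"
        then have i: "r i \<ge> N" using seq_suble[OF r(1), of i] by simp
        have "(\<integral>\<^sup>+x. ennreal ((cmod (s (r i) x - s n x))\<^sup>2) \<partial>lborel)
            = (\<integral>\<^sup>+x. ennreal ((cmod (rep_aefun (X (r i) - X n) x))\<^sup>2) \<partial>lborel)"
          by (rule nn_integral_cong_AE) (use sdiff[of "r i" n] in \<open>auto elim!: eventually_mono\<close>)
        also have "\<dots> = ennreal ((L2_norm a b (X (r i) - X n))\<^sup>2)"
          unfolding L2_norm_sq[OF D] by (rule nn_integral_eq_integral[OF L2_D(2)[OF D]]) auto
        also have "\<dots> \<le> ennreal (e\<^sup>2)"
          using N[OF i] nrm_nonneg[OF D, of "r i" n]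
          by (intro ennreal_leI power_mono) (auto simp: L2_norm_form_norm)
        finally show "(\<integral>\<^sup>+x. ennreal ((cmod (s (r i) x - s n x))\<^sup>2) \<partial>lborel) \<le> ennreal (e\<^sup>2)" .
      qed
    qed
    finally show ?thesis .
  qed
  have zero: "AE x in lborel. x \<notin> {a<..<b} \<longrightarrow> f x = 0"
  proof -
    have "AE x in lborel. \<forall>n. x \<notin> {a<..<b} \<longrightarrow> s n x = 0"
      unfolding AE_all_countable s_def using X L2_D(1) by blast
    with lim show ?thesis
      by eventually_elim (auto intro: LIMSEQ_unique[OF _ tendsto_const])
  qed
  have diff: "abs_aefun (\<lambda>x. f x - s n x) \<in> L2 a b"
      "L2_norm a b (abs_aefun (\<lambda>x. f x - s n x)) \<le> e"
    if e: "e > 0" and N: "\<And>m. m \<ge> N \<Longrightarrow> L2_norm a b (X m - X n) < e" for e N n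
  proof -
    have int: "integrable lborel (\<lambda>x. (cmod (f x - s n x))\<^sup>2)"
      by (rule integrableI_bounded) (use le_less_trans[OF fatou[OF e, of N n], of \<infinity>] N in auto)
    show 1: "abs_aefun (\<lambda>x. f x - s n x) \<in> L2 a b"
    proof (rule abs_aefun_L2[OF _ _ int])
      show "AE x in lborel. x \<notin> {a<..<b} \<longrightarrow> f x - s n x = 0"
        using zero L2_D(1)[of "X n" a b] X unfolding s_def by (auto elim!: AE_mp)
    qed simp
    have "ennreal ((L2_norm a b (abs_aefun (\<lambda>x. f x - s n x)))\<^sup>2) = (\<integral>\<^sup>+x. (cmod (f x - s n x))\<^sup>2 \<partial>lborel)"
      unfolding L2_norm_sq[OF 1] nn_integral_eq_integral[OF L2_D(2)[OF 1], symmetric, simplified]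
      by (rule nn_integral_cong_AE)
         (use rep_abs_aefun[of "\<lambda>x. f x - s n x"] in \<open>auto elim!: eventually_mono\<close>)
    also have "\<dots> \<le> ennreal (e\<^sup>2)" by (rule fatou[OF e N])
    finally have "(L2_norm a b (abs_aefun (\<lambda>x. f x - s n x)))\<^sup>2 \<le> e\<^sup>2" by simp
    then show "L2_norm a b (abs_aefun (\<lambda>x. f x - s n x)) \<le> e" using e by (meson less_imp_le power2_le_imp_le)
  qed
  have split: "abs_aefun (\<lambda>x. f x - s n x) = abs_aefun f - X n" for n
    using rep_abs_aefun[of f] rep_abs_aefun[of "\<lambda>x. f x - s n x"] rep_aefun_minus[of "abs_aefun f" "X n"]
    by (intro rep_aefun_eqI) (auto simp: s_def elim!: AE_mp)
  obtain N1 where "\<And>m n. m \<ge> N1 \<Longrightarrow> n \<ge> N1 \<Longrightarrow> L2_norm a b (X m - X n) < 1" using C[of 1] by auto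
  \<comment> \<open>Fatou's lemma only speaks of differences; the limit itself is in L2 because it
    differs from one member of the sequence by an element of L2.\<close>
  then have "abs_aefun f - X N1 \<in> L2 a b" using diff(1)[of 1 N1 N1] split by simp
  then have l: "abs_aefun f \<in> L2 a b" using S_closed(2)[of "abs_aefun f - X N1" "X N1"] X by simp
  have "(\<lambda>n. form_norm (L2_inner a b) (X n - abs_aefun f)) \<longlonglongrightarrow> 0"
  proof (rule LIMSEQ_I)
    fix e :: real assume e: "0 < e"
    obtain N where N: "\<And>m n. m \<ge> N \<Longrightarrow> n \<ge> N \<Longrightarrow> L2_norm a b (X m - X n) < e / 2"
      using C[of "e / 2"] e by auto
    show "\<exists>no. \<forall>n\<ge>no. norm (nrm (X n - abs_aefun f) - 0) < e"
    proof (intro exI[of _ N] allI impI)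
      fix n assume n: "n \<ge> N"
      have "nrm (X n - abs_aefun f) \<le> e / 2"
        using diff(2)[of "e / 2" N n] N[OF _ n] e split[of n] nrm_diff_commute[of "X n" "abs_aefun f"] l X
        by (simp add: L2_norm_form_norm)
      moreover have "0 \<le> nrm (X n - abs_aefun f)" using l X by (intro nrm_nonneg) (simp add: S_closed)
      ultimately show "norm (nrm (X n - abs_aefun f) - 0) < e" using e by simp
    qed
  qed
  then show "\<exists>l\<in>L2 a b. (\<lambda>n. form_norm (L2_inner a b) (X n - l)) \<longlonglongrightarrow> 0" using l by blast
qed

interpretation L2: semi_hilbert "L2 a b" "L2_inner a b" for a b
  using L2_semi_inner L2_complete by (simp add: semi_hilbert_def semi_hilbert_axioms_def)

section \<open>Test functions and the lemma of du Bois-Reymond\<close>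

text \<open>The base point is minus infinity, so that one primitive serves all intervals: for an
  element of \<open>L2 a b\<close> it is zero up to \<open>a\<close> and constant from
  \<open>b\<close> on.\<close>

definition prim :: "(real \<Rightarrow> complex) \<Rightarrow> real \<Rightarrow> complex" where
  "prim f x = (LINT t|lborel. (if t \<le> x then f t else 0))"

lemma integrable_if:
  fixes f :: "real \<Rightarrow> complex"
  assumes "integrable lborel f" "Measurable.pred borel Q"
  shows "integrable lborel (\<lambda>t. if Q t then f t else 0)"
proof (rule Bochner_Integration.integrable_bound[OF assms(1)])
  have [measurable]: "f \<in> borel_measurable borel" "Measurable.pred borel Q" using assms by auto
  show "(\<lambda>t. if Q t then f t else 0) \<in> borel_measurable lborel" by measurable
qed auto

lemma integral_if_mult:
  fixes f :: "real \<Rightarrow> complex"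
  shows "(LINT t|lborel. (if Q t then k * f t else 0)) = k * (LINT t|lborel. (if Q t then f t else 0))"
    and "(LINT t|lborel. (if Q t then f t * k else 0)) = (LINT t|lborel. (if Q t then f t else 0)) * k"
proof -
  have "(\<lambda>t. if Q t then k * f t else 0) = (\<lambda>t. k * (if Q t then f t else 0))"
    "(\<lambda>t. if Q t then f t * k else 0) = (\<lambda>t. (if Q t then f t else 0) * k)" by auto
  then show "(LINT t|lborel. (if Q t then k * f t else 0)) = k * (LINT t|lborel. (if Q t then f t else 0))"
    "(LINT t|lborel. (if Q t then f t * k else 0)) = (LINT t|lborel. (if Q t then f t else 0)) * k"
    by (simp_all only: integral_mult_right_zero integral_mult_left_zero)
qed

lemma prim_measurable [measurable]:
  assumes [measurable]: "f \<in> borel_measurable borel"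
  shows "prim f \<in> borel_measurable borel"
  unfolding prim_def[abs_def] by measurable

lemma prim_norm_le:
  assumes f: "integrable lborel f"
  shows "cmod (prim f x) \<le> (LINT t|lborel. cmod (f t))"
proof -
  have "cmod (prim f x) \<le> (LINT t|lborel. cmod (if t \<le> x then f t else 0))"
    unfolding prim_def by (rule integral_norm_bound)
  also have "\<dots> \<le> (LINT t|lborel. cmod (f t))"
    by (rule integral_mono) (use f in \<open>auto intro!: integrable_norm integrable_if\<close>)
  finally show ?thesis .
qed

text \<open>The primitive is bounded by the L1 norm of its integrand.\<close>

lemma integrable_mult_prim:
  assumes f: "integrable lborel f" and g: "integrable lborel g"
  shows "integrable lborel (\<lambda>x. f x * prim g x)"
proof (rule Bochner_Integration.integrable_bound)
  have [measurable]: "f \<in> borel_measurable borel" "g \<in> borel_measurable borel" using f g by auto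
  show "integrable lborel (\<lambda>x. (LINT t|lborel. cmod (g t)) * cmod (f x))" using f by simp
  show "(\<lambda>x. f x * prim g x) \<in> borel_measurable lborel" by measurable
  show "AE x in lborel. norm (f x * prim g x) \<le> norm ((LINT t|lborel. cmod (g t)) * cmod (f x))"
    using prim_norm_le[OF g] by (auto simp: norm_mult mult.commute intro!: mult_left_mono)
qed

text \<open>Fubini's theorem for \<open>f x * g t\<close>, with the plane split along the diagonal.\<close>

lemma integral_prim_parts:
  assumes f: "integrable lborel f" and g: "integrable lborel g"
  shows "(LINT x|lborel. f x * prim g x) + (LINT x|lborel. prim f x * g x)
       = (LINT x|lborel. f x) * (LINT x|lborel. g x)"
proof -
  have [measurable]: "f \<in> borel_measurable borel" "g \<in> borel_measurable borel" using f g by auto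
  define h where "h x t = f x * g t" for x t
  have int: "integrable (lborel \<Otimes>\<^sub>M lborel) (\<lambda>(x, t). h x t)"
  proof (rule lborel_pair.Fubini_integrable)
    show "(\<lambda>(x, t). h x t) \<in> borel_measurable (lborel \<Otimes>\<^sub>M lborel)"
      unfolding h_def by measurable
    show "integrable lborel (\<lambda>x. LINT y|lborel. norm (case (x, y) of (x, t) \<Rightarrow> h x t))"
      using f by (simp add: h_def norm_mult)
    show "AE x in lborel. integrable lborel (\<lambda>y. case (x, y) of (x, t) \<Rightarrow> h x t)"
      using g by (simp add: h_def)
  qed
  have int1: "integrable (lborel \<Otimes>\<^sub>M lborel) (\<lambda>(x, t). if x \<le> t then h x t else 0)"
  proof (rule Bochner_Integration.integrable_bound[OF int])
    show "(\<lambda>(x, t). if x \<le> t then h x t else 0) \<in> borel_measurable (lborel \<Otimes>\<^sub>M lborel)"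
      unfolding h_def by measurable
  qed auto
  have "(LINT t|lborel. prim f t * g t) = (LINT t|lborel. LINT x|lborel. (if x \<le> t then h x t else 0))"
    unfolding prim_def h_def integral_if_mult ..
  also have "\<dots> = (LINT x|lborel. LINT t|lborel. (if x \<le> t then h x t else 0))"
    by (rule lborel_pair.Fubini_integral) (use int1 in simp)
  finally have 1: "(LINT t|lborel. prim f t * g t) = \<dots>" .
  have 2: "(LINT x|lborel. f x * prim g x) = (LINT x|lborel. LINT t|lborel. (if t \<le> x then h x t else 0))"
    unfolding prim_def h_def integral_if_mult ..
  have ih: "integrable lborel (h x)" for x using g by (simp add: h_def[abs_def])
  have eq: "(LINT t|lborel. (if t \<le> x then h x t else 0)) + (LINT t|lborel. (if x \<le> t then h x t else 0))
      = f x * (LINT t|lborel. g t)" for x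
  proof -
    have "(LINT t|lborel. (if t \<le> x then h x t else 0)) + (LINT t|lborel. (if x \<le> t then h x t else 0))
       = (LINT t|lborel. (if t \<le> x then h x t else 0) + (if x \<le> t then h x t else 0))"
      by (rule Bochner_Integration.integral_add[symmetric]) (intro integrable_if ih, simp)+
    also have "\<dots> = (LINT t|lborel. h x t)"
    proof (rule integral_cong_AE)
      \<comment> \<open>The two half-lines overlap in the single point \<open>x\<close>, a null
        set.\<close>
      show "AE t in lborel. (if t \<le> x then h x t else 0) + (if x \<le> t then h x t else 0) = h x t"
        using AE_lborel_singleton[of x] by eventually_elim auto
    next
      show "(\<lambda>t. (if t \<le> x then h x t else 0) + (if x \<le> t then h x t else 0)) \<in> borel_measurable lborel"
        unfolding h_def by measurable
    qed (auto simp: h_def)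
    finally show ?thesis by (simp add: h_def)
  qed
  have i1: "integrable lborel (\<lambda>x. LINT t|lborel. (if t \<le> x then h x t else 0))"
    using integrable_mult_prim[OF f g] unfolding prim_def h_def integral_if_mult .
  have i2: "integrable lborel (\<lambda>x. LINT t|lborel. (if x \<le> t then h x t else 0))"
    using lborel_pair.integrable_fst'[OF int1] by simp
  show ?thesis
    unfolding 1 2 by (subst Bochner_Integration.integral_add[symmetric, OF i1 i2]) (simp add: eq)
qed

lemma prim_diff:
  assumes "integrable lborel f" "x \<le> y"
  shows "prim f y - prim f x = (LINT t|lborel. indicator {x<..y} t *\<^sub>R f t)"
  unfolding prim_def using assms
  by (subst Bochner_Integration.integral_diff[symmetric])
     (auto intro!: integrable_if Bochner_Integration.integral_cong split: split_indicator)

lemma prim_add: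
  assumes "integrable lborel f" "integrable lborel g"
  shows "prim (\<lambda>x. f x + g x) x = prim f x + prim g x"
  unfolding prim_def using assms
  by (subst Bochner_Integration.integral_add[symmetric])
     (auto intro!: integrable_if Bochner_Integration.integral_cong)

lemma prim_cong_AE:
  assumes [measurable]: "f \<in> borel_measurable borel" "g \<in> borel_measurable borel"
    and "AE x in lborel. f x = g x"
  shows "prim f x = prim g x"
  unfolding prim_def by (rule integral_cong_AE) (use assms(3) in \<open>auto elim!: eventually_mono\<close>)

text \<open>\<open>smooth\<close> asks for the whole sequence of derivatives at once. It arises by
  iterating a choice of derivative inside a family that is closed under differentiation.\<close>

lemma smoothI:
  assumes "\<phi> \<in> F" "\<And>g. g \<in> F \<Longrightarrow> \<exists>g'\<in>F. \<forall>x. (g has_vector_derivative g' x) (at x)"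
  shows "smooth \<phi>"
proof -
  obtain d where d: "\<And>g. g \<in> F \<Longrightarrow> d g \<in> F \<and> (\<forall>x. (g has_vector_derivative d g x) (at x))"
    using assms(2) by metis
  define D where "D n = (d ^^ n) \<phi>" for n
  have "D n \<in> F" for n by (induction n) (auto simp: D_def assms(1) d)
  then show ?thesis
    unfolding smooth_def using d by (intro exI[of _ D]) (auto simp: D_def)
qed

lemma smoothD:
  assumes "smooth \<phi>"
  obtains \<phi>' where "smooth \<phi>'" "\<And>x. (\<phi> has_vector_derivative \<phi>' x) (at x)"
proof -
  obtain D where D: "D 0 = \<phi>" "\<And>n x. (D n has_vector_derivative D (Suc n) x) (at x)"
    using assms unfolding smooth_def by blast
  have "smooth (D 1)"
    unfolding smooth_def by (rule exI[of _ "\<lambda>n. D (Suc n)"]) (use D in auto)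
  then show thesis using that D(1) D(2)[of 0] by auto
qed

lemma smooth_continuous: "smooth \<phi> \<Longrightarrow> continuous_on UNIV \<phi>"
  by (metis smoothD continuous_at_imp_continuous_on has_vector_derivative_continuous)

lemma smooth_vector_derivative:
  assumes "smooth \<phi>"
  shows "smooth (\<lambda>x. vector_derivative \<phi> (at x))"
    and "(\<phi> has_vector_derivative vector_derivative \<phi> (at x)) (at x)"
proof -
  obtain \<phi>' where "smooth \<phi>'" and *: "\<And>x. (\<phi> has_vector_derivative \<phi>' x) (at x)"
    using smoothD[OF assms] by blast
  moreover have "(\<lambda>x. vector_derivative \<phi> (at x)) = \<phi>'" using * by (auto simp: vector_derivative_at)
  ultimately show "smooth (\<lambda>x. vector_derivative \<phi> (at x))"
    "(\<phi> has_vector_derivative vector_derivative \<phi> (at x)) (at x)" by metis+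
qed

lemma smooth_antiderivative:
  assumes "smooth \<phi>'" "\<And>x. (\<phi> has_vector_derivative \<phi>' x) (at x)"
  shows "smooth \<phi>"
proof -
  obtain D where D: "D 0 = \<phi>'" "\<And>n x. (D n has_vector_derivative D (Suc n) x) (at x)"
    using assms unfolding smooth_def by blast
  have "(case_nat \<phi> D n has_vector_derivative case_nat \<phi> D (Suc n) x) (at x)" for n x
    using D assms(2) by (cases n) auto
  then show ?thesis unfolding smooth_def by (intro exI[of _ "case_nat \<phi> D"]) auto
qed

lemma smooth_add: "smooth f \<Longrightarrow> smooth g \<Longrightarrow> smooth (\<lambda>x. f x + g x)"
proof (rule smoothI[where F="{\<lambda>x. f x + g x |f g. smooth f \<and> smooth g}"])
  fix h assume "h \<in> {\<lambda>x. f x + g x |f g. smooth f \<and> smooth g}"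
  then obtain f g where "smooth f" "smooth g" and h: "h = (\<lambda>x. f x + g x)" by auto
  then obtain f' g' where "smooth f'" "smooth g'" "\<And>x. (f has_vector_derivative f' x) (at x)"
    "\<And>x. (g has_vector_derivative g' x) (at x)" by (metis smoothD)
  then show "\<exists>k\<in>{\<lambda>x. f x + g x |f g. smooth f \<and> smooth g}. \<forall>x. (h has_vector_derivative k x) (at x)"
    unfolding h by (intro bexI[of _ "\<lambda>x. f' x + g' x"] allI has_vector_derivative_add) auto
qed auto

lemma smooth_cmult: "smooth f \<Longrightarrow> smooth (\<lambda>x. k * f x)"
proof (rule smoothI[where F="{\<lambda>x. k * f x |f. smooth f}"])
  fix h assume "h \<in> {\<lambda>x. k * f x |f. smooth f}"
  then obtain f where "smooth f" and h: "h = (\<lambda>x. k * f x)" by auto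
  then obtain f' where "smooth f'" "\<And>x. (f has_vector_derivative f' x) (at x)" by (metis smoothD)
  then show "\<exists>h'\<in>{\<lambda>x. k * f x |f. smooth f}. \<forall>x. (h has_vector_derivative h' x) (at x)"
    unfolding h by (intro bexI[of _ "\<lambda>x. k * f' x"] allI has_vector_derivative_mult_right) auto
qed auto

text \<open>The derivative of a product is a sum of two products, so products alone do not form a
  family for \<open>smoothI\<close>, while their sums do.\<close>

inductive_set prod_sums :: "(real \<Rightarrow> complex) set" where
  mult: "smooth f \<Longrightarrow> smooth g \<Longrightarrow> (\<lambda>x. f x * g x) \<in> prod_sums"
| add: "h \<in> prod_sums \<Longrightarrow> k \<in> prod_sums \<Longrightarrow> (\<lambda>x. h x + k x) \<in> prod_sums"

lemma smooth_mult:
  assumes "smooth f" "smooth g"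
  shows "smooth (\<lambda>x. f x * g x)"
proof (rule smoothI[where F=prod_sums])
  show "(\<lambda>x. f x * g x) \<in> prod_sums" using assms by (rule prod_sums.mult)
  fix h assume "h \<in> prod_sums"
  then show "\<exists>h'\<in>prod_sums. \<forall>x. (h has_vector_derivative h' x) (at x)"
  proof induction
    case (mult f g)
    then obtain f' g' where "smooth f'" "smooth g'" "\<And>x. (f has_vector_derivative f' x) (at x)"
      "\<And>x. (g has_vector_derivative g' x) (at x)" by (metis smoothD)
    with mult show ?case
      by (intro bexI[of _ "\<lambda>x. f x * g' x + f' x * g x"] allI has_vector_derivative_mult prod_sums.intros)
  next
    case (add h k)
    then obtain h' k' where "h' \<in> prod_sums" "\<And>x. (h has_vector_derivative h' x) (at x)"
      "k' \<in> prod_sums" "\<And>x. (k has_vector_derivative k' x) (at x)" by blast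
    then show ?case
      by (intro bexI[of _ "\<lambda>x. h' x + k' x"] allI has_vector_derivative_add prod_sums.intros)
  qed
qed

lemma smooth_affine: "smooth f \<Longrightarrow> smooth (\<lambda>x. f (m * x + s))"
proof -
  assume "smooth f"
  then obtain D where D: "D 0 = f" "\<And>n x. (D n has_vector_derivative D (Suc n) x) (at x)"
    unfolding smooth_def by blast
  have "((\<lambda>x. of_real m ^ n * D n (m * x + s)) has_vector_derivative
      of_real m ^ Suc n * D (Suc n) (m * x + s)) (at x)" for n x
  proof -
    have "((\<lambda>x. m * x + s) has_vector_derivative m) (at x)"
      by (auto intro!: derivative_eq_intros simp: has_real_derivative_iff_has_vector_derivative[symmetric])
    from vector_diff_chain_at[OF this D(2)[of n]]
    have "((\<lambda>x. D n (m * x + s)) has_vector_derivative m *\<^sub>R D (Suc n) (m * x + s)) (at x)"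
      by (simp add: o_def)
    from has_vector_derivative_mult_right[OF this, of "of_real m ^ n"] show ?thesis
      by (simp add: scaleR_conv_of_real mult_ac)
  qed
  then show ?thesis
    unfolding smooth_def by (intro exI[of _ "\<lambda>n x. of_real m ^ n * D n (m * x + s)"]) (auto simp: D(1))
qed

text \<open>The classical function \<open>exp (- 1 / x)\<close> extended by zero to the left; the
  polynomial factor in \<open>1 / x\<close> makes the family closed under differentiation.\<close>

definition flat :: "real poly \<Rightarrow> real \<Rightarrow> real" where
  "flat p x = (if x > 0 then poly p (1 / x) * exp (- (1 / x)) else 0)"

lemma poly_exp_tendsto_0: "((\<lambda>t. poly p t * exp (- t)) \<longlongrightarrow> (0::real)) at_top"
proof -
  have "((\<lambda>t. \<Sum>i\<le>degree p. coeff p i * (t ^ i / exp t)) \<longlongrightarrow> (\<Sum>i\<le>degree p. coeff p i * 0)) at_top"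
    by (intro tendsto_sum tendsto_mult_left tendsto_power_div_exp_0)
  then show ?thesis
    by (simp add: poly_altdef sum_distrib_right exp_minus divide_inverse mult.assoc)
qed

text \<open>For \<open>x > 0\<close> the product and chain rules give the factor
  \<open>1 / x^2\<close> and the polynomial \<open>p - pderiv p\<close>, both functions of
  \<open>1 / x\<close>.\<close>

lemma flat_deriv:
  "(flat p has_real_derivative flat ([:0, 0, 1:] * (p - pderiv p)) x) (at x)"
proof -
  consider "x > 0" | "x < 0" | "x = 0" by linarith
  then show ?thesis
  proof cases
    case 1
    have "((\<lambda>x. poly p (1 / x) * exp (- (1 / x))) has_real_derivative
       poly (pderiv p) (1 / x) * (- 1 / x\<^sup>2) * exp (- (1 / x)) + exp (- (1 / x)) * (1 / x\<^sup>2) * poly p (1 / x)) (at x)"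
      using 1 by (auto intro!: derivative_eq_intros simp: power2_eq_square field_simps)
    moreover have "poly (pderiv p) (1 / x) * (- 1 / x\<^sup>2) * exp (- (1 / x)) + exp (- (1 / x)) * (1 / x\<^sup>2) * poly p (1 / x)
       = flat ([:0, 0, 1:] * (p - pderiv p)) x"
      using 1 by (simp add: flat_def field_simps power2_eq_square)
    ultimately have "((\<lambda>x. poly p (1 / x) * exp (- (1 / x))) has_real_derivative
       flat ([:0, 0, 1:] * (p - pderiv p)) x) (at x)" by simp
    then show ?thesis
      by (rule has_field_derivative_transform_within_open[where S="{0<..}"]) (use 1 in \<open>auto simp: flat_def\<close>)
  next
    case 2
    have "((\<lambda>_. 0) has_real_derivative 0) (at x)" by simp
    then have "(flat p has_real_derivative 0) (at x)"
      by (rule has_field_derivative_transform_within_open[where S="{..<0}"]) (use 2 in \<open>auto simp: flat_def\<close>)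
    then show ?thesis using 2 by (simp add: flat_def)
  next
    case 3
    have "((\<lambda>h. flat p h / h) \<longlongrightarrow> 0) (at 0)"
    proof (rule filterlim_split_at)
      show "((\<lambda>h. flat p h / h) \<longlongrightarrow> 0) (at_left 0)"
        by (rule tendsto_eventually) (auto simp: eventually_at_filter flat_def)
      \<comment> \<open>The difference quotient at 0 from the right is again a polynomial in
        \<open>1 / h\<close> times the exponential, which wins as \<open>1 / h\<close> tends to
        infinity.\<close>
      have "((\<lambda>h. poly (pCons 0 p) (inverse h) * exp (- inverse h)) \<longlongrightarrow> 0) (at_right 0)"
        by (rule filterlim_compose[OF poly_exp_tendsto_0 filterlim_inverse_at_top_right])
      then show "((\<lambda>h. flat p h / h) \<longlongrightarrow> 0) (at_right 0)"
        by (rule Lim_transform_eventually)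
           (auto simp: eventually_at_filter flat_def field_simps)
    qed
    then show ?thesis using 3 by (simp add: DERIV_def flat_def)
  qed
qed

definition bump :: "real \<Rightarrow> complex" where "bump x = of_real (flat 1 x)"

lemma smooth_bump: "smooth bump"
proof (rule smoothI[where F="range (\<lambda>p x. of_real (flat p x))"])
  show "bump \<in> range (\<lambda>p x. of_real (flat p x))" by (auto simp: bump_def[abs_def])
  fix g assume "g \<in> range (\<lambda>p x. of_real (flat p x) :: complex)"
  then obtain p where g: "g = (\<lambda>x. of_real (flat p x))" by auto
  have "(g has_vector_derivative of_real (flat ([:0, 0, 1:] * (p - pderiv p)) x)) (at x)" for x
    unfolding g using flat_deriv[of p x]
    by (intro has_vector_derivative_of_real) (simp add: has_real_derivative_iff_has_vector_derivative)
  then show "\<exists>g'\<in>range (\<lambda>p x. of_real (flat p x)). \<forall>x. (g has_vector_derivative g' x) (at x)"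
    by (intro bexI[of _ "\<lambda>x. of_real (flat ([:0, 0, 1:] * (p - pderiv p)) x)"]) auto
qed

lemma bump_simps: "x \<le> 0 \<Longrightarrow> bump x = 0" "0 < x \<Longrightarrow> bump x = of_real (exp (- (1 / x)))"
  "cmod (bump x) \<le> 1"
  by (auto simp: bump_def flat_def)

text \<open>One factor cuts off at \<open>c\<close>, the other at \<open>d\<close>; a large
  \<open>m\<close> steepens both flanks and brings the value near 1 in between.\<close>

definition bump_on :: "real \<Rightarrow> real \<Rightarrow> real \<Rightarrow> real \<Rightarrow> complex" where
  "bump_on m c d x = bump (m * x + (- m * c)) * bump ((- m) * x + m * d)"

lemma bump_on_test:
  assumes "a < c" "d < b" "0 < m"
  shows "test_function a b (bump_on m c d)"
proof -
  have "smooth (bump_on m c d)"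
    unfolding bump_on_def[abs_def] by (intro smooth_mult smooth_affine smooth_bump)
  moreover have "bump_on m c d x = 0" if "x \<notin> {c..d}" for x
  proof -
    have "m * x + (- m * c) \<le> 0 \<or> (- m) * x + m * d \<le> 0"
      using that assms(3) by (auto simp: not_le)
    then show ?thesis by (auto simp: bump_on_def bump_simps)
  qed
  ultimately show ?thesis unfolding test_function_def using assms by blast
qed

lemma cmod_bump_on_le: "cmod (bump_on m c d x) \<le> 1"
  unfolding bump_on_def norm_mult using bump_simps(3) by (intro mult_le_one) auto

text \<open>Moving the ends inwards by \<open>1 / (n + 1)\<close> keeps the support strictly inside,
  as test functions require. With slope \<open>n + 1\<close> the arguments of the two bumps become
  \<open>(n + 1) (x - c) - 1\<close> and \<open>(n + 1) (d - x) - 1\<close>, which tend to infinity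
  at interior points.\<close>

lemma bump_on_limit:
  "(\<lambda>n. bump_on (real (Suc n)) (c + 1 / real (Suc n)) (d - 1 / real (Suc n)) x) \<longlonglongrightarrow> indicator {c<..<d} x"
proof (cases "x \<in> {c<..<d}")
  case True
  have one: "(\<lambda>n. bump (real (Suc n) * e - 1)) \<longlonglongrightarrow> 1" if e: "e > 0" for e
  proof -
    have lim: "filterlim (\<lambda>n. real (Suc n) * e - 1) at_top sequentially"
      using e by real_asymp
    have "(\<lambda>n. of_real (exp (- (1 / (real (Suc n) * e - 1)))) :: complex) \<longlonglongrightarrow> of_real (exp (- 0))"
      by (intro tendsto_intros) (rule real_tendsto_divide_at_top[OF tendsto_const lim])
    moreover have "\<forall>\<^sub>F n in sequentially. of_real (exp (- (1 / (real (Suc n) * e - 1)))) = bump (real (Suc n) * e - 1)"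
      using filterlim_at_top_dense[THEN iffD1, OF lim, rule_format, of 0]
      by eventually_elim (simp add: bump_simps)
    ultimately show ?thesis by (simp add: Lim_transform_eventually)
  qed
  have "(\<lambda>n. bump (real (Suc n) * (x - c) - 1) * bump (real (Suc n) * (d - x) - 1)) \<longlonglongrightarrow> 1 * 1"
    using True by (intro tendsto_mult one) auto
  moreover have "bump_on (real (Suc n)) (c + 1 / real (Suc n)) (d - 1 / real (Suc n)) x
     = bump (real (Suc n) * (x - c) - 1) * bump (real (Suc n) * (d - x) - 1)" for n
    unfolding bump_on_def by (intro arg_cong2[where f="(*)"] arg_cong[of _ _ bump]) (simp_all add: field_simps)
  ultimately show ?thesis using True by simp
next
  case False
  have "bump_on (real (Suc n)) (c + 1 / real (Suc n)) (d - 1 / real (Suc n)) x = 0" for n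
  proof -
    have "real (Suc n) * x + (- real (Suc n) * (c + 1 / real (Suc n))) = real (Suc n) * (x - c) - 1"
      "(- real (Suc n)) * x + real (Suc n) * (d - 1 / real (Suc n)) = real (Suc n) * (d - x) - 1"
      by (simp_all add: field_simps)
    moreover have "real (Suc n) * (x - c) \<le> 0 \<or> real (Suc n) * (d - x) \<le> 0"
      using False by (auto simp: not_less mult_le_0_iff)
    ultimately show ?thesis unfolding bump_on_def by (auto simp: bump_simps)
  qed
  then show ?thesis using False by simp
qed

section \<open>Test functions and their primitives\<close>

lemma test_function_smooth: "test_function a b \<phi> \<Longrightarrow> smooth \<phi>"
  by (simp add: test_function_def)

lemma test_function_outside: "test_function a b \<phi> \<Longrightarrow> x \<notin> {a<..<b} \<Longrightarrow> \<phi> x = 0"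
  unfolding test_function_def by (metis atLeastAtMost_iff greaterThanLessThan_iff less_le_trans le_less_trans)

lemma test_function_cmult: "test_function a b f \<Longrightarrow> test_function a b (\<lambda>x. k * f x)"
  unfolding test_function_def by (auto intro: smooth_cmult)

lemma test_function_add:
  assumes "test_function a b f" "test_function a b g"
  shows "test_function a b (\<lambda>x. f x + g x)"
proof -
  obtain c1 d1 c2 d2 where c: "a < c1" "d1 < b" "\<And>x. x \<notin> {c1..d1} \<Longrightarrow> f x = 0"
    "a < c2" "d2 < b" "\<And>x. x \<notin> {c2..d2} \<Longrightarrow> g x = 0" "smooth f" "smooth g"
    using assms unfolding test_function_def by metis
  have "f x + g x = 0" if "x \<notin> {min c1 c2..max d1 d2}" for x
    using that c(3)[of x] c(6)[of x] by (cases "x < min c1 c2"; cases "x > max d1 d2") auto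
  then show ?thesis unfolding test_function_def
    using c smooth_add[OF c(7,8)] by (metis max_less_iff_conj min_less_iff_conj)
qed

lemma test_function_deriv:
  assumes "test_function a b \<phi>"
  shows "test_function a b (\<lambda>x. vector_derivative \<phi> (at x))"
proof -
  obtain c d where c: "a < c" "d < b" "\<And>x. x \<notin> {c..d} \<Longrightarrow> \<phi> x = 0" "smooth \<phi>"
    using assms unfolding test_function_def by metis
  have "vector_derivative \<phi> (at x) = 0" if x: "x \<notin> {c..d}" for x
  proof -
    have "((\<lambda>_. 0) has_vector_derivative 0) (at x)" by simp
    then have "(\<phi> has_vector_derivative 0) (at x)"
      by (rule has_vector_derivative_transform_within_open[where S="- {c..d}"]) (use c x in auto)
    then show ?thesis by (rule vector_derivative_at)
  qed
  then show ?thesis unfolding test_function_def using c smooth_vector_derivative by blast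
qed

lemma compact_support_integrable:
  fixes f :: "real \<Rightarrow> complex"
  assumes "continuous_on UNIV f" "\<And>x. x \<notin> {c..d} \<Longrightarrow> f x = 0"
  shows "integrable lborel f"
proof -
  have "integrable lborel (\<lambda>x. indicator {c..d} x *\<^sub>R f x)"
    by (rule borel_integrable_compact) (use continuous_on_subset[OF assms(1)] in auto)
  moreover have "(\<lambda>x. indicator {c..d} x *\<^sub>R f x) = f" using assms(2) by (auto simp: indicator_def)
  ultimately show ?thesis by simp
qed

lemma test_function_integrable:
  assumes "test_function a b \<phi>"
  shows "integrable lborel \<phi>"
proof -
  obtain c d where "\<And>x. x \<notin> {c..d} \<Longrightarrow> \<phi> x = 0"
    using assms unfolding test_function_def by metis
  then show ?thesis using test_function_smooth[OF assms] smooth_continuous compact_support_integrable by blast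
qed

lemma test_function_bounded:
  assumes "test_function a b \<phi>"
  obtains B where "\<And>x. cmod (\<phi> x) \<le> B"
proof -
  obtain c d where *: "\<And>x. x \<notin> {c..d} \<Longrightarrow> \<phi> x = 0"
    using assms unfolding test_function_def by metis
  have "continuous_on {c..d} \<phi>" using test_function_smooth[OF assms] smooth_continuous continuous_on_subset by blast
  then have "bounded (\<phi> ` {c..d})" using compact_continuous_image compact_imp_bounded by blast
  then obtain B where "\<And>x. x \<in> {c..d} \<Longrightarrow> cmod (\<phi> x) \<le> B" unfolding bounded_iff by blast
  then have "cmod (\<phi> x) \<le> max B 0" for x using * by (cases "x \<in> {c..d}") fastforce+
  then show thesis using that by blast
qed

lemma prim_compact_deriv:
  assumes "\<And>x. (\<phi> has_vector_derivative \<phi>' x) (at x)" "continuous_on UNIV \<phi>'"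
    and "\<And>x. x < c \<Longrightarrow> \<phi> x = 0 \<and> \<phi>' x = 0"
  shows "prim \<phi>' x = \<phi> x"
proof -
  \<comment> \<open>A base point left of the support, where \<open>\<phi>\<close> vanishes; the
    minimum with \<open>x\<close> keeps the limits of integration in order.\<close>
  define e where "e = min (c - 1) x"
  have "prim \<phi>' x = (LINT t|lborel. indicator {e..x} t *\<^sub>R \<phi>' t)"
    unfolding prim_def by (rule Bochner_Integration.integral_cong) (auto simp: indicator_def e_def assms(3))
  also have "\<dots> = \<phi> x - \<phi> e"
    by (rule integral_FTC_Icc)
       (use assms in \<open>auto simp: e_def intro: has_vector_derivative_at_within continuous_on_subset\<close>)
  also have "\<phi> e = 0" using assms(3) by (simp add: e_def)
  finally show ?thesis by simp
qed

lemma test_function_prim: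
  assumes "test_function a b \<phi>"
  shows "prim (\<lambda>x. vector_derivative \<phi> (at x)) x = \<phi> x"
    and "(LINT x|lborel. vector_derivative \<phi> (at x)) = 0"
proof -
  note d = test_function_deriv[OF assms]
  obtain c1 d1 where 1: "a < c1" "d1 < b" "\<And>x. x \<notin> {c1..d1} \<Longrightarrow> \<phi> x = 0"
    using assms unfolding test_function_def by metis
  obtain c2 d2 where 2: "a < c2" "d2 < b" "\<And>x. x \<notin> {c2..d2} \<Longrightarrow> vector_derivative \<phi> (at x) = 0"
    using d unfolding test_function_def by metis
  show eq: "prim (\<lambda>x. vector_derivative \<phi> (at x)) x = \<phi> x" for x
    by (rule prim_compact_deriv[where c="min c1 c2"])
       (use smooth_vector_derivative[OF test_function_smooth[OF assms]] smooth_continuous 1(3) 2(3) in auto)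
  have "(LINT x|lborel. vector_derivative \<phi> (at x)) = prim (\<lambda>x. vector_derivative \<phi> (at x)) (max d1 d2 + 1)"
    unfolding prim_def
  proof (rule Bochner_Integration.integral_cong)
    show "vector_derivative \<phi> (at x) = (if x \<le> max d1 d2 + 1 then vector_derivative \<phi> (at x) else 0)" for x
      using 2(3)[of x] by (cases "x > d2") auto
  qed simp
  also have "\<dots> = 0" unfolding eq by (rule 1(3)) auto
  finally show "(LINT x|lborel. vector_derivative \<phi> (at x)) = 0" .
qed

text \<open>The primitive is zero left of the support, and right of it equals the total integral,
  which vanishes; hence it has compact support.\<close>

lemma mean_zero_test_function:
  assumes \<psi>: "test_function a b \<psi>" and 0: "(LINT x|lborel. \<psi> x) = 0"
  obtains \<phi> where "test_function a b \<phi>" "\<And>x. vector_derivative \<phi> (at x) = \<psi> x"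
proof -
  obtain c d where cd: "a < c" "d < b" "\<And>x. x \<notin> {c..d} \<Longrightarrow> \<psi> x = 0" "smooth \<psi>"
    using assms unfolding test_function_def by metis
  note cont = smooth_continuous[OF cd(4)]
  have der: "(prim \<psi> has_vector_derivative \<psi> x) (at x)" for x
  proof -
    define e where "e = min c x - 1"
    have eq: "prim \<psi> y = integral {e..y} \<psi>" if "y \<in> {e..x + 1}" for y
    proof -
      have "prim \<psi> y = (LINT t|lborel. indicator {e..y} t *\<^sub>R \<psi> t)"
        unfolding prim_def
      proof (rule Bochner_Integration.integral_cong)
        show "(if t \<le> y then \<psi> t else 0) = indicator {e..y} t *\<^sub>R \<psi> t" for t
          using cd(3)[of t] by (cases "t < c") (auto simp: indicator_def e_def)
      qed simp
      also have "\<dots> = integral {e..y} \<psi>"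
        unfolding set_lebesgue_integral_def[symmetric]
        by (rule set_borel_integral_eq_integral)
           (auto simp: set_integrable_def intro!: borel_integrable_compact continuous_on_subset[OF cont])
      finally show ?thesis .
    qed
    have "((\<lambda>y. integral {e..y} \<psi>) has_vector_derivative \<psi> x) (at x within {e..x + 1})"
      by (rule integral_has_vector_derivative) (use cont continuous_on_subset in \<open>auto simp: e_def\<close>)
    then have "((\<lambda>y. integral {e..y} \<psi>) has_vector_derivative \<psi> x) (at x)"
      by (subst (asm) at_within_interior) (auto simp: e_def)
    then show ?thesis
      by (rule has_vector_derivative_transform_within_open[where S="{e<..<x + 1}"]) (auto simp: eq e_def)
  qed
  have "prim \<psi> x = 0" if "x \<notin> {c..d}" for x
  proof (cases "x < c")
    case True
    have "(\<lambda>t. if t \<le> x then \<psi> t else 0) = (\<lambda>t. 0)" using True cd(3) by (auto simp: fun_eq_iff)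
    then show ?thesis by (simp add: prim_def)
  next
    case False
    have "(\<lambda>t. if t \<le> x then \<psi> t else 0) = \<psi>" using False that cd(3) by (auto simp: fun_eq_iff)
    then show ?thesis using 0 by (simp add: prim_def)
  qed
  then have "test_function a b (prim \<psi>)"
    unfolding test_function_def using cd smooth_antiderivative[OF cd(4) der] by blast
  then show thesis using that der vector_derivative_at by metis
qed

lemma integrable_mult_bounded:
  fixes f \<psi> :: "real \<Rightarrow> complex"
  assumes "integrable lborel f" "\<psi> \<in> borel_measurable borel" "\<And>x. cmod (\<psi> x) \<le> B"
  shows "integrable lborel (\<lambda>x. f x * \<psi> x)"
proof (rule Bochner_Integration.integrable_bound)
  show "integrable lborel (\<lambda>x. of_real B * f x)" using assms(1) by simp
  show "AE x in lborel. cmod (f x * \<psi> x) \<le> cmod (of_real B * f x)"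
    using order_trans[OF assms(3) abs_ge_self]
    by (intro AE_I2) (simp add: norm_mult mult.commute[of "cmod (f _)"] mult_right_mono)
  show "(\<lambda>x. f x * \<psi> x) \<in> borel_measurable lborel" using assms by simp
qed

lemma integrable_mult_test:
  assumes "integrable lborel f" "test_function a b \<psi>"
  shows "integrable lborel (\<lambda>x. f x * \<psi> x)"
  using test_function_bounded[OF assms(2)] integrable_mult_bounded[OF assms(1)]
    test_function_measurable(1)[OF assms(2)] by metis

lemma integral_test_restrict:
  assumes "test_function a b \<psi>"
  shows "(LINT x:{a<..<b}|lborel. f x * \<psi> x) = (LINT x|lborel. f x * \<psi> x)"
  unfolding set_lebesgue_integral_def using test_function_outside[OF assms]
  by (intro Bochner_Integration.integral_cong) (auto simp: indicator_def)

text \<open>Steep bumps converge boundedly to indicators of open subintervals, so \<open>h\<close>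
  integrates to zero over these. A Dynkin argument starting from the half-lines extends this to all
  Borel sets, and a function with vanishing integrals is zero almost everywhere.\<close>

lemma fundamental_lemma:
  assumes h: "integrable lborel h" and zero: "\<And>\<psi>. test_function a b \<psi> \<Longrightarrow> (LINT x|lborel. h x * \<psi> x) = 0"
  shows "AE x in lborel. x \<in> {a<..<b} \<longrightarrow> h x = 0"
proof -
  have [measurable]: "h \<in> borel_measurable borel" using h by auto
  define h' where "h' x = indicator {a<..<b} x *\<^sub>R h x" for x
  have h'[measurable]: "integrable lborel h'"
    unfolding h'_def by (rule integrable_mult_indicator[OF _ h]) simp
  have int: "(LINT x|lborel. indicator {c<..<d} x *\<^sub>R h x) = 0" if "a \<le> c" "d \<le> b" for c d
  proof -
    define b' where "b' n = bump_on (real (Suc n)) (c + 1 / real (Suc n)) (d - 1 / real (Suc n))" for n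
    have t: "test_function a b (b' n)" for n
      unfolding b'_def by (rule bump_on_test) (use that in \<open>auto intro: le_less_trans[OF that(1)] less_le_trans[OF _ that(2)]\<close>)
    have [measurable]: "b' n \<in> borel_measurable borel" for n using test_function_measurable(1)[OF t] .
    have "(\<lambda>n. LINT x|lborel. h x * b' n x) \<longlonglongrightarrow> (LINT x|lborel. h x * indicator {c<..<d} x)"
    proof (rule integral_dominated_convergence[where w="\<lambda>x. cmod (h x)"])
      show "AE x in lborel. (\<lambda>n. h x * b' n x) \<longlonglongrightarrow> h x * indicator {c<..<d} x"
        unfolding b'_def by (intro AE_I2 tendsto_intros bump_on_limit)
      show "AE x in lborel. cmod (h x * b' n x) \<le> cmod (h x)" for n
        unfolding b'_def using cmod_bump_on_le by (intro AE_I2) (auto simp: norm_mult intro!: mult_right_le_one_le)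
    qed (use h in auto)
    moreover have "(LINT x|lborel. h x * b' n x) = 0" for n using zero[OF t] .
    ultimately have "(LINT x|lborel. h x * indicator {c<..<d} x) = 0" by (simp add: LIMSEQ_const_iff)
    moreover have "(\<lambda>x. h x * indicator {c<..<d} x) = (\<lambda>x. indicator {c<..<d} x *\<^sub>R h x)"
      by (auto simp: indicator_def)
    ultimately show ?thesis by simp
  qed
  \<comment> \<open>The total integral is needed for the complement step of the Dynkin
    argument.\<close>
  have tot: "(LINT x|lborel. h' x) = 0" using int[of a b] by (simp add: h'_def[abs_def])
  have all: "(LINT x:A|lborel. h' x) = 0" if "A \<in> sets borel" for A
  proof -
    have A: "A \<in> sigma_sets UNIV (range (lessThan :: real \<Rightarrow> _))"
      using that by (subst (asm) borel_Iio) auto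
    have sb: "B \<in> sigma_sets UNIV (range (lessThan :: real \<Rightarrow> _)) \<Longrightarrow> B \<in> sets borel" for B
      by (subst borel_Iio) auto
    have "Int_stable (range (lessThan :: real \<Rightarrow> _))"
    proof (rule Int_stableI)
      fix A B :: "real set" assume "A \<in> range lessThan" "B \<in> range lessThan"
      then obtain i j where "A = {..<i}" "B = {..<j}" by auto
      then have "A \<inter> B = {..<min i j}" by auto
      then show "A \<inter> B \<in> range lessThan" by blast
    qed
    moreover have "range (lessThan :: real \<Rightarrow> _) \<subseteq> Pow UNIV" by simp
    ultimately show ?thesis
      using A
    proof (induction rule: sigma_sets_induct_disjoint)
      case (basic A)
      then obtain d where A: "A = {..<d}" by auto
      have "(LINT x:A|lborel. h' x) = (LINT x|lborel. indicator {a<..<min d b} x *\<^sub>R h x)"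
        unfolding set_lebesgue_integral_def A h'_def
        by (intro Bochner_Integration.integral_cong) (auto simp: indicator_def)
      then show ?case using int[of a "min d b"] by simp
    next
      case (compl A)
      have "(LINT x:(UNIV - A)|lborel. h' x) = (LINT x|lborel. h' x) - (LINT x:A|lborel. h' x)"
        unfolding set_lebesgue_integral_def
      proof (subst Bochner_Integration.integral_diff[symmetric])
        show "integrable lborel (\<lambda>x. indicator A x *\<^sub>R h' x)"
          using sb[OF compl(1)] by (intro integrable_mult_indicator h') simp
      qed (auto intro!: h' Bochner_Integration.integral_cong simp: indicator_def)
      then show ?case using compl tot by simp
    next
      case (union A)
      have "(LINT x:(\<Union>i. A i)|lborel. h' x) = (\<Sum>i. (LINT x:(A i)|lborel. h' x))"
      proof (rule lebesgue_integral_countable_add)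
        show "A i \<in> sets lborel" for i using union sb by auto
        then show "set_integrable lborel (\<Union>i. A i) h'"
          unfolding set_integrable_def by (intro integrable_mult_indicator h') auto
      qed (use union in \<open>auto simp: disjoint_family_on_def\<close>)
      then show ?case using union by simp
    qed (simp add: set_lebesgue_integral_def)
  qed
  have "AE x in lborel. h' x = 0" by (rule sigma_finite_measure.density_zero[OF lborel.sigma_finite_measure_axioms h']) (use all in auto)
  then show ?thesis by eventually_elim (auto simp: h'_def)
qed

text \<open>If all test functions had integral zero, the fundamental lemma would make the indicator
  of the interval vanish almost everywhere; a test function with nonzero integral is then
  normalised.\<close>

lemma unit_test_function:
  assumes "a < b"
  obtains \<psi> where "test_function a b \<psi>" "(LINT x|lborel. \<psi> x) = 1"
proof -
  have "\<exists>\<psi>. test_function a b \<psi> \<and> (LINT x|lborel. \<psi> x) \<noteq> 0"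
  proof (rule ccontr)
    assume "\<not> ?thesis"
    then have z: "(LINT x|lborel. \<psi> x) = 0" if "test_function a b \<psi>" for \<psi> using that by blast
    define h :: "real \<Rightarrow> complex" where "h x = indicator {a<..<b} x" for x
    have h: "integrable lborel h" unfolding h_def using assms by (intro integrable_real_indicator[THEN integrable_of_real, simplified of_real_indicator] ) auto
    have "(LINT x|lborel. h x * \<psi> x) = 0" if "test_function a b \<psi>" for \<psi>
    proof -
      have "(LINT x|lborel. h x * \<psi> x) = (LINT x|lborel. \<psi> x)"
        using test_function_outside[OF that]
        by (intro Bochner_Integration.integral_cong) (auto simp: h_def indicator_def)
      then show ?thesis using z[OF that] by simp
    qed
    then have "AE x in lborel. x \<in> {a<..<b} \<longrightarrow> h x = 0" by (rule fundamental_lemma[OF h])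
    then have "AE x in lborel. x \<notin> {a<..<b}" by eventually_elim (auto simp: h_def)
    then have "emeasure lborel {a<..<b} = 0"
      by (subst (asm) AE_iff_measurable[of "{a<..<b}"]) auto
    then show False using assms by simp
  qed
  then obtain \<psi> where \<psi>: "test_function a b \<psi>" "(LINT x|lborel. \<psi> x) \<noteq> 0" by blast
  show thesis
    by (rule that[OF test_function_cmult[OF \<psi>(1), of "1 / (LINT x|lborel. \<psi> x)"]]) (use \<psi> in simp)
qed

text \<open>Subtracting a multiple of a fixed \<open>\<psi>0\<close> with integral 1 gives any test
  function mean zero. This identifies the constant as the integral of \<open>h\<close> against
  \<open>\<psi>0\<close> and reduces the claim to the fundamental lemma.\<close>

lemma du_bois_reymond:
  assumes "a < b" and h: "integrable lborel h"
    and zero: "\<And>\<psi>. test_function a b \<psi> \<Longrightarrow> (LINT x|lborel. \<psi> x) = 0 \<Longrightarrow> (LINT x|lborel. h x * \<psi> x) = 0"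
  obtains K where "AE x in lborel. x \<in> {a<..<b} \<longrightarrow> h x = K"
proof -
  obtain \<psi>0 where \<psi>0: "test_function a b \<psi>0" "(LINT x|lborel. \<psi>0 x) = 1"
    using unit_test_function[OF \<open>a < b\<close>] by blast
  define K where "K = (LINT x|lborel. h x * \<psi>0 x)"
  define k :: "real \<Rightarrow> complex" where "k x = K * indicator {a<..<b} x" for x
  have k: "integrable lborel k"
    unfolding k_def using \<open>a < b\<close>
    by (intro integrable_mult_right integrable_real_indicator[THEN integrable_of_real, simplified of_real_indicator]) auto
  have "AE x in lborel. x \<in> {a<..<b} \<longrightarrow> h x - k x = 0"
  proof (rule fundamental_lemma)
    show "integrable lborel (\<lambda>x. h x - k x)" using h k by simp
    fix \<psi> assume \<psi>: "test_function a b \<psi>"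
    define c where "c = (LINT x|lborel. \<psi> x)"
    have t: "test_function a b (\<lambda>x. \<psi> x + (- c) * \<psi>0 x)"
      using \<psi> \<psi>0 by (intro test_function_add test_function_cmult)
    have "(LINT x|lborel. \<psi> x + (- c) * \<psi>0 x) = c + (- c) * 1"
      unfolding c_def by (subst Bochner_Integration.integral_add)
         (use test_function_integrable[OF \<psi>] test_function_integrable[OF \<psi>0(1)] \<psi>0(2) in auto)
    then have "(LINT x|lborel. h x * (\<psi> x + (- c) * \<psi>0 x)) = 0" by (intro zero t) simp
    moreover have "(LINT x|lborel. h x * (\<psi> x + (- c) * \<psi>0 x)) = (LINT x|lborel. h x * \<psi> x + (- c) * (h x * \<psi>0 x))"
      by (simp add: algebra_simps)
    moreover have "\<dots> = (LINT x|lborel. h x * \<psi> x) + (- c) * K"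
      unfolding K_def using integrable_mult_test[OF h \<psi>] integrable_mult_test[OF h \<psi>0(1)]
      by (subst Bochner_Integration.integral_add) auto
    ultimately have 1: "(LINT x|lborel. h x * \<psi> x) = K * c" by simp
    have "(LINT x|lborel. k x * \<psi> x) = (LINT x|lborel. K * \<psi> x)"
      by (rule Bochner_Integration.integral_cong) (use test_function_outside[OF \<psi>] in \<open>auto simp: k_def indicator_def\<close>)
    then have 2: "(LINT x|lborel. k x * \<psi> x) = K * c" by (simp add: c_def)
    show "(LINT x|lborel. (h x - k x) * \<psi> x) = 0"
      using 1 2 integrable_mult_test[OF h \<psi>] integrable_mult_test[OF k \<psi>]
      by (simp add: left_diff_distrib)
  qed
  then have "AE x in lborel. x \<in> {a<..<b} \<longrightarrow> h x = K" by eventually_elim (auto simp: k_def)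
  then show thesis by (rule that)
qed

section \<open>Weak derivatives on an interval\<close>

lemma agrees_on_iff: "agrees_on a b f h \<longleftrightarrow> (AE x in lborel. x \<in> {a<..<b} \<longrightarrow> rep_aefun f x = h x)"
  by (simp add: agrees_on.rep_eq)

lemma L2_eqI:
  assumes "f \<in> L2 a b" "g \<in> L2 a b" "agrees_on a b f (rep_aefun g)"
  shows "f = g"
proof (rule rep_aefun_eqI)
  show "AE x in lborel. rep_aefun f x = rep_aefun g x"
    using assms(3)[unfolded agrees_on_iff] L2_D(1)[OF assms(1)] L2_D(1)[OF assms(2)]
    by eventually_elim metis
qed

lemma weak_deriv_identity_iff:
  "weak_deriv_identity a b f g \<longleftrightarrow> (\<forall>\<phi>. test_function a b \<phi> \<longrightarrow>
     (LINT x|lborel. rep_aefun f x * vector_derivative \<phi> (at x)) = - (LINT x|lborel. rep_aefun g x * \<phi> x))"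
  unfolding weak_deriv_identity.rep_eq
  by (auto simp: integral_test_restrict integral_test_restrict[OF test_function_deriv])

lemma agrees_on_integral_test:
  assumes "agrees_on a b f h" "test_function a b \<psi>" "h \<in> borel_measurable borel"
  shows "(LINT x|lborel. rep_aefun f x * \<psi> x) = (LINT x|lborel. h x * \<psi> x)"
proof (rule integral_cong_AE)
  have [measurable]: "\<psi> \<in> borel_measurable borel" "h \<in> borel_measurable borel"
    using test_function_measurable(1)[OF assms(2)] assms(3) by auto
  show "(\<lambda>x. rep_aefun f x * \<psi> x) \<in> borel_measurable lborel"
    "(\<lambda>x. h x * \<psi> x) \<in> borel_measurable lborel" by measurable
  show "AE x in lborel. rep_aefun f x * \<psi> x = h x * \<psi> x"
    using assms(1)[unfolded agrees_on_iff]
  proof eventually_elim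
    case (elim x)
    then show ?case using test_function_outside[OF assms(2), of x] by (cases "x \<in> {a<..<b}") auto
  qed
qed

lemma integral_prim_test:
  assumes g: "integrable lborel g" and \<phi>: "test_function a b \<phi>"
  shows "(LINT x|lborel. prim g x * vector_derivative \<phi> (at x)) = - (LINT x|lborel. g x * \<phi> x)"
proof -
  have "(LINT x|lborel. g x * prim (\<lambda>x. vector_derivative \<phi> (at x)) x)
      + (LINT x|lborel. prim g x * vector_derivative \<phi> (at x)) = 0"
    using integral_prim_parts[OF g test_function_integrable[OF test_function_deriv[OF \<phi>]]]
    by (simp add: test_function_prim(2)[OF \<phi>])
  then show ?thesis by (simp add: test_function_prim(1)[OF \<phi>] add_eq_0_iff)
qed

text \<open>The constant drops out because the derivative of a test function integrates to zero, and
  Fubini's theorem moves the primitive across.\<close>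

lemma has_weak_deriv_primI:
  assumes f: "f \<in> L2 a b" and g: "g \<in> L2 a b"
    and agr: "agrees_on a b f (\<lambda>x. c + prim (rep_aefun g) x)"
  shows "has_weak_deriv a b f g"
  unfolding has_weak_deriv_def weak_deriv_identity_iff
proof (intro conjI f g allI impI)
  fix \<phi> assume \<phi>: "test_function a b \<phi>"
  note d = test_function_deriv[OF \<phi>] and gi = L2_integrable(1)[OF g]
  have i: "integrable lborel (\<lambda>x. prim (rep_aefun g) x * vector_derivative \<phi> (at x))"
    using integrable_mult_prim[OF test_function_integrable[OF d] gi] by (simp add: mult.commute)
  have "(LINT x|lborel. rep_aefun f x * vector_derivative \<phi> (at x))
      = (LINT x|lborel. (c + prim (rep_aefun g) x) * vector_derivative \<phi> (at x))"
    by (rule agrees_on_integral_test[OF agr d]) simp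
  also have "\<dots> = (LINT x|lborel. c * vector_derivative \<phi> (at x) + prim (rep_aefun g) x * vector_derivative \<phi> (at x))"
    by (simp add: distrib_right)
  also have "\<dots> = c * (LINT x|lborel. vector_derivative \<phi> (at x)) + - (LINT x|lborel. rep_aefun g x * \<phi> x)"
    using i test_function_integrable[OF d] integral_prim_test[OF gi \<phi>] by simp
  finally show "(LINT x|lborel. rep_aefun f x * vector_derivative \<phi> (at x)) = - (LINT x|lborel. rep_aefun g x * \<phi> x)"
    using test_function_prim(2)[OF \<phi>] by simp
qed

text \<open>The difference of \<open>f\<close> and the primitive of \<open>g\<close> annihilates all
  derivatives of test functions. These are the test functions with mean zero, so the lemma of du
  Bois-Reymond makes the difference constant.\<close>

lemma has_weak_deriv_primE:
  assumes ab: "a < b" and "has_weak_deriv a b f g"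
  obtains c where "agrees_on a b f (\<lambda>x. c + prim (rep_aefun g) x)"
proof -
  have f: "f \<in> L2 a b" and g: "g \<in> L2 a b" and id: "weak_deriv_identity a b f g"
    using assms by (auto simp: has_weak_deriv_def)
  note fi = L2_integrable(1)[OF f] and gi = L2_integrable(1)[OF g]
  \<comment> \<open>The cutoff is there for integrability on the line, because beyond
    \<open>b\<close> the primitive continues as a constant.\<close>
  define h where "h x = rep_aefun f x - indicator {a<..<b} x *\<^sub>R prim (rep_aefun g) x" for x
  have pi: "integrable lborel (\<lambda>x. indicator {a<..<b} x *\<^sub>R prim (rep_aefun g) x)"
  proof -
    have "integrable lborel (\<lambda>x. indicator {a<..<b} x * prim (rep_aefun g) x)"
      by (rule integrable_mult_prim[OF _ gi])
         (use ab in \<open>intro integrable_real_indicator[THEN integrable_of_real, simplified of_real_indicator]; simp\<close>)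
    moreover have "(\<lambda>x. indicator {a<..<b} x * prim (rep_aefun g) x)
        = (\<lambda>x. indicator {a<..<b} x *\<^sub>R prim (rep_aefun g) x)" by (auto simp: indicator_def)
    ultimately show ?thesis by simp
  qed
  have h: "integrable lborel h" unfolding h_def using fi pi by simp
  obtain c where c: "AE x in lborel. x \<in> {a<..<b} \<longrightarrow> h x = c"
  proof (rule du_bois_reymond[OF ab h])
    fix \<psi> assume \<psi>: "test_function a b \<psi>" "(LINT x|lborel. \<psi> x) = 0"
    obtain \<phi> where \<phi>: "test_function a b \<phi>" "\<And>x. vector_derivative \<phi> (at x) = \<psi> x"
      using mean_zero_test_function[OF \<psi>] by blast
    have "(LINT x|lborel. h x * \<psi> x) = (LINT x|lborel. rep_aefun f x * \<psi> x)
       - (LINT x|lborel. indicator {a<..<b} x *\<^sub>R prim (rep_aefun g) x * \<psi> x)"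
      using integrable_mult_test[OF fi \<psi>(1)] integrable_mult_test[OF pi \<psi>(1)]
      by (simp add: h_def left_diff_distrib)
    also have "(LINT x|lborel. indicator {a<..<b} x *\<^sub>R prim (rep_aefun g) x * \<psi> x)
       = (LINT x|lborel. prim (rep_aefun g) x * \<psi> x)"
      using test_function_outside[OF \<psi>(1)]
      by (intro Bochner_Integration.integral_cong) (auto simp: indicator_def)
    also have "\<dots> = - (LINT x|lborel. rep_aefun g x * \<phi> x)"
      using integral_prim_test[OF gi \<phi>(1)] by (simp add: \<phi>(2))
    also have "(LINT x|lborel. rep_aefun f x * \<psi> x) = - (LINT x|lborel. rep_aefun g x * \<phi> x)"
      using id[unfolded weak_deriv_identity_iff, rule_format, OF \<phi>(1)] by (simp add: \<phi>(2))
    finally show "(LINT x|lborel. h x * \<psi> x) = 0" by simp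
  qed
  have "agrees_on a b f (\<lambda>x. c + prim (rep_aefun g) x)"
    unfolding agrees_on_iff using c by eventually_elim (auto simp: h_def)
  then show thesis by (rule that)
qed

lemma has_weak_deriv_unique:
  assumes "has_weak_deriv a b f g" "has_weak_deriv a b f g'"
  shows "g = g'"
proof -
  have g: "g \<in> L2 a b" "g' \<in> L2 a b" using assms by (auto simp: has_weak_deriv_def)
  note gi = L2_integrable(1)[OF g(1)] L2_integrable(1)[OF g(2)]
  have "AE x in lborel. x \<in> {a<..<b} \<longrightarrow> rep_aefun g x - rep_aefun g' x = 0"
  proof (rule fundamental_lemma)
    fix \<psi> assume \<psi>: "test_function a b \<psi>"
    have "(LINT x|lborel. rep_aefun g x * \<psi> x) = (LINT x|lborel. rep_aefun g' x * \<psi> x)"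
      using assms \<psi> unfolding has_weak_deriv_def weak_deriv_identity_iff by (metis neg_equal_iff_equal)
    then show "(LINT x|lborel. (rep_aefun g x - rep_aefun g' x) * \<psi> x) = 0"
      using integrable_mult_test[OF gi(1) \<psi>] integrable_mult_test[OF gi(2) \<psi>]
      by (simp add: left_diff_distrib)
  qed (use gi in simp)
  then have "agrees_on a b g (rep_aefun g')" unfolding agrees_on_iff by eventually_elim auto
  then show ?thesis using L2_eqI g by blast
qed

text \<open>Uniqueness resolves the description in \<open>weak_deriv\<close>, so that a derivative
  found by any means is the one meant.\<close>

lemma weak_deriv_eqI: "has_weak_deriv a b f g \<Longrightarrow> weak_deriv a b f = g"
  unfolding weak_deriv_def using has_weak_deriv_unique by blast

lemma integral_rep_plus_test:
  assumes "f \<in> L2 a b" "g \<in> L2 a b" "test_function c d \<psi>"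
  shows "(LINT x|lborel. rep_aefun (f + g) x * \<psi> x)
    = (LINT x|lborel. rep_aefun f x * \<psi> x) + (LINT x|lborel. rep_aefun g x * \<psi> x)"
proof -
  have [measurable]: "\<psi> \<in> borel_measurable borel" using test_function_measurable(1)[OF assms(3)] .
  have "(LINT x|lborel. rep_aefun (f + g) x * \<psi> x)
     = (LINT x|lborel. rep_aefun f x * \<psi> x + rep_aefun g x * \<psi> x)"
    by (rule integral_cong_AE)
       (use rep_aefun_plus[of f g] in \<open>auto simp: distrib_right elim!: eventually_mono\<close>)
  then show ?thesis
    using integrable_mult_test[OF L2_integrable(1)[OF assms(1)] assms(3)]
      integrable_mult_test[OF L2_integrable(1)[OF assms(2)] assms(3)] by simp
qed

lemma integral_rep_scaleC_test:
  assumes "test_function c d \<psi>"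
  shows "(LINT x|lborel. rep_aefun (k *\<^sub>C f) x * \<psi> x) = k * (LINT x|lborel. rep_aefun f x * \<psi> x)"
proof -
  have [measurable]: "\<psi> \<in> borel_measurable borel" using test_function_measurable(1)[OF assms] .
  have "(LINT x|lborel. rep_aefun (k *\<^sub>C f) x * \<psi> x) = (LINT x|lborel. k * (rep_aefun f x * \<psi> x))"
    by (rule integral_cong_AE)
       (use rep_aefun_scaleC[of k f] in \<open>auto elim!: eventually_mono\<close>)
  then show ?thesis by simp
qed

lemma has_weak_deriv_add:
  "has_weak_deriv a b f f' \<Longrightarrow> has_weak_deriv a b g g' \<Longrightarrow> has_weak_deriv a b (f + g) (f' + g')"
  unfolding has_weak_deriv_def weak_deriv_identity_iff
  by (auto simp: csub_add[OF csub_L2] integral_rep_plus_test integral_rep_plus_test[OF _ _ test_function_deriv])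

lemma has_weak_deriv_scaleC:
  "has_weak_deriv a b f f' \<Longrightarrow> has_weak_deriv a b (k *\<^sub>C f) (k *\<^sub>C f')"
  unfolding has_weak_deriv_def weak_deriv_identity_iff
  by (auto simp: csub_scaleC[OF csub_L2] integral_rep_scaleC_test integral_rep_scaleC_test[OF test_function_deriv])

lemma has_weak_deriv_zero: "has_weak_deriv a b 0 0"
proof -
  have "(LINT x|lborel. rep_aefun 0 x * \<psi> x) = 0" for \<psi> :: "real \<Rightarrow> complex"
    by (rule integral_eq_zero_AE) (use rep_aefun_zero in \<open>auto elim!: eventually_mono\<close>)
  then show ?thesis
    unfolding has_weak_deriv_def weak_deriv_identity_iff by (simp add: csub_zero[OF csub_L2])
qed

lemma Sob_Suc_iff:
  "f \<in> Sob (Suc k) a b \<longleftrightarrow> has_weak_deriv a b f (weak_deriv a b f) \<and> weak_deriv a b f \<in> Sob k a b"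
  using weak_deriv_eqI by auto

lemma Sob1_iff: "f \<in> Sob 1 a b \<longleftrightarrow> has_weak_deriv a b f (weak_deriv a b f)"
  unfolding One_nat_def Sob_Suc_iff by (auto simp: has_weak_deriv_def)

lemma Sob2_iff: "f \<in> Sob 2 a b \<longleftrightarrow> f \<in> Sob 1 a b \<and> weak_deriv a b f \<in> Sob 1 a b"
  unfolding numeral_2_eq_2 Sob_Suc_iff[of _ "Suc 0"] using Sob1_iff by auto

lemma Sob3_iff: "f \<in> Sob 3 a b \<longleftrightarrow> f \<in> Sob 1 a b \<and> weak_deriv a b f \<in> Sob 2 a b"
  unfolding numeral_3_eq_3 Sob_Suc_iff[of _ "Suc (Suc 0)"] using Sob1_iff by (simp add: numeral_2_eq_2)

lemma has_weak_deriv_Sob1: "has_weak_deriv a b f g \<Longrightarrow> f \<in> Sob 1 a b"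
  by (auto simp: has_weak_deriv_def)

lemma Sob1_L2: "f \<in> Sob 1 a b \<Longrightarrow> f \<in> L2 a b" "f \<in> Sob 1 a b \<Longrightarrow> weak_deriv a b f \<in> L2 a b"
  unfolding Sob1_iff has_weak_deriv_def by auto

lemma csub_Sob1: "csubspace (Sob 1 a b)"
proof (rule csubI)
  show "0 \<in> Sob 1 a b" by (rule has_weak_deriv_Sob1[OF has_weak_deriv_zero])
  show "f + g \<in> Sob 1 a b" if "f \<in> Sob 1 a b" "g \<in> Sob 1 a b" for f g
    using that unfolding Sob1_iff[of f] Sob1_iff[of g] by (intro has_weak_deriv_Sob1[OF has_weak_deriv_add])
  show "k *\<^sub>C f \<in> Sob 1 a b" if "f \<in> Sob 1 a b" for k f
    using that unfolding Sob1_iff[of f] by (intro has_weak_deriv_Sob1[OF has_weak_deriv_scaleC])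
qed

lemma weak_deriv_add:
  "f \<in> Sob 1 a b \<Longrightarrow> g \<in> Sob 1 a b \<Longrightarrow> weak_deriv a b (f + g) = weak_deriv a b f + weak_deriv a b g"
  unfolding Sob1_iff by (intro weak_deriv_eqI has_weak_deriv_add)

lemma weak_deriv_scaleC:
  "f \<in> Sob 1 a b \<Longrightarrow> weak_deriv a b (k *\<^sub>C f) = k *\<^sub>C weak_deriv a b f"
  unfolding Sob1_iff by (intro weak_deriv_eqI has_weak_deriv_scaleC)

lemma weak_deriv_zero: "weak_deriv a b 0 = 0"
  by (intro weak_deriv_eqI has_weak_deriv_zero)

lemma weak_deriv_diff:
  assumes "f \<in> Sob 1 a b" "g \<in> Sob 1 a b"
  shows "weak_deriv a b (f - g) = weak_deriv a b f - weak_deriv a b g"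
  using weak_deriv_add[OF csub_diff[OF csub_Sob1 assms] assms(2)] by (simp add: algebra_simps)

lemma clin_weak_deriv: "clinear_on (Sob 1 a b) (L2 a b) (weak_deriv a b)"
  unfolding clinear_on_def by (auto simp: Sob1_L2 weak_deriv_add weak_deriv_scaleC simp del: One_nat_def Sob.simps)

lemma clin_Sob1_L2: "clinear_on (Sob 1 a b) (L2 a b) (\<lambda>f. f)"
  unfolding clinear_on_def using Sob1_L2(1) by blast

section \<open>Continuous representatives, point values, and inequalities for them\<close>

lemma rep_diff_prim_le:
  assumes g: "g \<in> L2 a b" and "x \<le> y"
  shows "cmod (prim (rep_aefun g) y - prim (rep_aefun g) x) \<le> sqrt (y - x) * L2_norm a b g"
proof -
  have "cmod (prim (rep_aefun g) y - prim (rep_aefun g) x)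
      = cmod (LINT t|lborel. indicator {x<..y} t *\<^sub>R rep_aefun g t)"
    using assms by (simp add: prim_diff L2_integrable)
  also have "\<dots> \<le> (LINT t|lborel. cmod (indicator {x<..y} t *\<^sub>R rep_aefun g t))"
    by (rule integral_norm_bound)
  also have "\<dots> \<le> sqrt (y - x) * sqrt (LINT x|lborel. (cmod (rep_aefun g x))\<^sup>2)"
    by (rule integral_indicator_le_sqrt(2)[OF _ _ L2_D(2)[OF g]]) (use assms in auto)
  also have "sqrt (LINT x|lborel. (cmod (rep_aefun g x))\<^sup>2) = L2_norm a b g"
    by (simp add: L2_norm_def L2_inner_self[OF g])
  finally show ?thesis .
qed

lemma L2_norm_nonneg: "f \<in> L2 a b \<Longrightarrow> 0 \<le> L2_norm a b f"
  using L2.nrm_nonneg by (simp add: L2_norm_form_norm)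

lemma continuous_on_if_Hoelder_half:
  fixes h :: "real \<Rightarrow> complex"
  assumes "\<And>x y. x \<in> S \<Longrightarrow> y \<in> S \<Longrightarrow> x \<le> y \<Longrightarrow> cmod (h y - h x) \<le> sqrt (y - x) * K"
  shows "continuous_on S h"
  unfolding continuous_on_iff
proof (intro ballI allI impI)
  fix x e assume x: "x \<in> S" and e: "(0::real) < e"
  \<comment> \<open>This inverts the square root in the modulus of continuity;
    \<open>\<bar>K\<bar> + 1\<close> is positive whatever \<open>K\<close> is.\<close>
  define d where "d = (e / (\<bar>K\<bar> + 1))\<^sup>2"
  have d: "d > 0" using e by (simp add: d_def)
  have "dist (h y) (h x) < e" if y: "y \<in> S" "dist y x < d" for y
  proof -
    have "dist (h y) (h x) \<le> sqrt \<bar>y - x\<bar> * K"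
      using assms[of x y] assms[of y x] x y by (cases "x \<le> y") (auto simp: dist_norm norm_minus_commute)
    also have "\<dots> \<le> sqrt \<bar>y - x\<bar> * (\<bar>K\<bar> + 1)" by (intro mult_left_mono) auto
    also have "\<dots> < sqrt d * (\<bar>K\<bar> + 1)"
      using y by (intro mult_strict_right_mono) (auto simp: dist_real_def)
    also have "sqrt d = e / (\<bar>K\<bar> + 1)" using e by (simp add: d_def real_sqrt_abs)
    finally show ?thesis by simp
  qed
  then show "\<exists>d>0. \<forall>x'\<in>S. dist x' x < d \<longrightarrow> dist (h x') (h x) < e" using d by blast
qed

lemma continuous_on_prim: "g \<in> L2 a b \<Longrightarrow> continuous_on S (prim (rep_aefun g))"
  using rep_diff_prim_le by (intro continuous_on_if_Hoelder_half) blast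

text \<open>The set of points of the open interval where the two differ is open, and a nonempty open
  set has positive measure; the endpoints follow by continuity.\<close>

lemma continuous_AE_eq:
  fixes h k :: "real \<Rightarrow> complex"
  assumes "a < b" and h: "continuous_on {a..b} h" and k: "continuous_on {a..b} k"
    and ae: "AE x in lborel. x \<in> {a<..<b} \<longrightarrow> h x = k x" and x: "x \<in> {a..b}"
  shows "h x = k x"
proof -
  define S where "S = {x \<in> {a<..<b}. h x - k x \<in> - {0}}"
  have cont: "continuous_on {a<..<b} (\<lambda>x. h x - k x)"
    by (intro continuous_intros continuous_on_subset[OF h] continuous_on_subset[OF k]) auto
  have op: "open S"
    unfolding S_def by (rule continuous_open_preimage[OF cont, simplified vimage_def Int_def mem_Collect_eq]) auto
  have "S = {}"
  proof (rule ccontr)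
    assume "S \<noteq> {}"
    then obtain y where "y \<in> S" by blast
    then obtain e where e: "e > 0" "ball y e \<subseteq> S" using op open_contains_ball by blast
    have "AE x in lborel. x \<notin> ball y e" using ae by eventually_elim (use e in \<open>auto simp: S_def\<close>)
    then have "emeasure lborel (ball y e) = 0" by (subst (asm) AE_iff_measurable[of "ball y e"]) auto
    then show False using e by (simp add: ball_eq_greaterThanLessThan)
  qed
  then have z: "h y - k y = 0" if "y \<in> {a<..<b}" for y using that by (auto simp: S_def)
  have "h x - k x = 0"
  proof (rule continuous_constant_on_closure[where S="{a<..<b}" and f="\<lambda>x. h x - k x"])
    show "continuous_on (closure {a<..<b}) (\<lambda>x. h x - k x)"
      using h k \<open>a < b\<close> by (auto intro!: continuous_intros)
    show "x \<in> closure {a<..<b}" using x \<open>a < b\<close> by auto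
  qed (rule z)
  then show ?thesis by simp
qed

text \<open>\<open>point_val\<close> chooses some continuous representative. Any two of them agree
  on the closed interval, so every known one computes it.\<close>

lemma point_val_eqI:
  assumes "a < b" "continuous_on {a..b} h" "agrees_on a b f h" "x \<in> {a..b}"
  shows "point_val a b f x = h x"
proof -
  have "continuous_on {a..b} (point_val a b f) \<and> agrees_on a b f (point_val a b f)"
    unfolding point_val_def by (rule someI[of _ h]) (use assms in blast)
  then show ?thesis
    using assms by (intro continuous_AE_eq[OF assms(1)]) (auto simp: agrees_on_iff elim!: AE_mp)
qed

lemma prim_L2_left:
  assumes g: "g \<in> L2 a b" and "x \<le> a"
  shows "prim (rep_aefun g) x = 0"
  unfolding prim_def
  by (rule integral_eq_zero_AE) (use assms(2) L2_D(1)[OF g] in \<open>auto elim!: eventually_mono\<close>)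

lemma point_val_weak_deriv:
  assumes "a < b" "has_weak_deriv a b f g"
  shows "x \<in> {a..b} \<Longrightarrow> point_val a b f x = point_val a b f a + prim (rep_aefun g) x"
    and "agrees_on a b f (\<lambda>x. point_val a b f a + prim (rep_aefun g) x)"
proof -
  have g: "g \<in> L2 a b" using assms by (simp add: has_weak_deriv_def)
  obtain c where c: "agrees_on a b f (\<lambda>x. c + prim (rep_aefun g) x)"
    using has_weak_deriv_primE[OF assms] by blast
  have pv: "point_val a b f x = c + prim (rep_aefun g) x" if "x \<in> {a..b}" for x
    using assms(1) that by (intro point_val_eqI[OF _ _ c]) (auto intro!: continuous_intros continuous_on_prim[OF g])
  have "prim (rep_aefun g) a = 0" by (rule prim_L2_left[OF g]) simp
  then have "c = point_val a b f a" using pv[of a] assms(1) by simp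
  then show "x \<in> {a..b} \<Longrightarrow> point_val a b f x = point_val a b f a + prim (rep_aefun g) x"
    "agrees_on a b f (\<lambda>x. point_val a b f a + prim (rep_aefun g) x)"
    using pv c by auto
qed

lemma prim_L2_right: "g \<in> L2 a b \<Longrightarrow> b \<le> x \<Longrightarrow> prim (rep_aefun g) x = (LINT t|lborel. rep_aefun g t)"
proof -
  assume g: "g \<in> L2 a b" "b \<le> x"
  show ?thesis
    unfolding prim_def
    by (rule integral_cong_AE) (use g(2) L2_D(1)[OF g(1)] in \<open>auto elim!: eventually_mono\<close>)
qed

lemma point_val_Hoelder:
  assumes "a < b" "f \<in> Sob 1 a b" "a \<le> x" "x \<le> y" "y \<le> b"
  shows "cmod (point_val a b f y - point_val a b f x) \<le> sqrt (y - x) * L2_norm a b (weak_deriv a b f)"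
  using point_val_weak_deriv(1)[OF assms(1) assms(2)[unfolded Sob1_iff], of x]
    point_val_weak_deriv(1)[OF assms(1) assms(2)[unfolded Sob1_iff], of y]
    rep_diff_prim_le[OF Sob1_L2(2)[OF assms(2)] assms(4)] assms by simp

lemma point_val_continuous: "a < b \<Longrightarrow> f \<in> Sob 1 a b \<Longrightarrow> continuous_on {a..b} (point_val a b f)"
  by (rule continuous_on_if_Hoelder_half[of _ _ "L2_norm a b (weak_deriv a b f)"]) (auto intro!: point_val_Hoelder simp del: One_nat_def Sob.simps)

lemma agrees_on_point_val:
  assumes "a < b" "f \<in> Sob 1 a b"
  shows "agrees_on a b f (point_val a b f)"
  unfolding agrees_on_iff
  using point_val_weak_deriv(2)[OF assms(1) assms(2)[unfolded Sob1_iff], unfolded agrees_on_iff]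
proof eventually_elim
  case (elim x)
  then show ?case using point_val_weak_deriv(1)[OF assms(1) assms(2)[unfolded Sob1_iff], of x] by auto
qed

lemma L2_norm_le_bound:
  assumes "a < b" "f \<in> L2 a b" "agrees_on a b f h" "\<And>x. x \<in> {a..b} \<Longrightarrow> cmod (h x) \<le> B" "0 \<le> B"
  shows "L2_norm a b f \<le> sqrt (b - a) * B"
proof -
  have "(L2_norm a b f)\<^sup>2 = (LINT x|lborel. (cmod (rep_aefun f x))\<^sup>2)" by (rule L2_norm_sq[OF assms(2)])
  also have "\<dots> \<le> (LINT x|lborel. B\<^sup>2 * indicator {a<..<b} x)"
  proof (rule integral_mono_AE)
    show "AE x in lborel. (cmod (rep_aefun f x))\<^sup>2 \<le> B\<^sup>2 * indicator {a<..<b} x"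
      using assms(3)[unfolded agrees_on_iff] L2_D(1)[OF assms(2)]
    proof eventually_elim
      case (elim x)
      then show ?case using assms(4)[of x] by (cases "x \<in> {a<..<b}") (auto intro!: power_mono)
    qed
  qed (use L2_D(2)[OF assms(2)] assms(1) in \<open>auto intro!: integrable_mult_right\<close>)
  also have "\<dots> = (sqrt (b - a) * B)\<^sup>2" using assms(1) by (simp add: power_mult_distrib)
  finally show ?thesis by (rule power2_le_imp_le) (use assms in auto)
qed

text \<open>Starting from the zero at \<open>x0\<close>, the Hoelder bound gives the pointwise bound
  \<open>sqrt (b - a)\<close> times the norm of the derivative; integrating its square supplies the
  second factor \<open>sqrt (b - a)\<close>.\<close>

lemma poincare:
  assumes "a < b" "f \<in> Sob 1 a b" "x0 \<in> {a..b}" "point_val a b f x0 = 0"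
  shows "L2_norm a b f \<le> (b - a) * L2_norm a b (weak_deriv a b f)"
proof -
  define N where "N = L2_norm a b (weak_deriv a b f)"
  have N: "0 \<le> N" unfolding N_def by (rule L2_norm_nonneg[OF Sob1_L2(2)[OF assms(2)]])
  have "L2_norm a b f \<le> sqrt (b - a) * (sqrt (b - a) * N)"
  proof (rule L2_norm_le_bound[OF assms(1) Sob1_L2(1)[OF assms(2)] agrees_on_point_val[OF assms(1,2)]])
    fix x assume x: "x \<in> {a..b}"
    have "cmod (point_val a b f x) \<le> sqrt \<bar>x - x0\<bar> * N"
      using point_val_Hoelder[OF assms(1,2), of x x0] point_val_Hoelder[OF assms(1,2), of x0 x] x assms(3,4)
      by (cases "x \<le> x0") (auto simp: N_def)
    also have "\<dots> \<le> sqrt (b - a) * N" using x assms(3) N by (intro mult_right_mono) auto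
    finally show "cmod (point_val a b f x) \<le> sqrt (b - a) * N" .
  qed (use N assms(1) in auto)
  then show ?thesis using assms(1) by (simp add: N_def mult.assoc[symmetric])
qed

text \<open>A value of \<open>f\<close> exceeds the values elsewhere by at most the Hoelder bound,
  so it is controlled by the mean of the modulus of \<open>f\<close>. The constant is
  \<open>1 / s + s\<close> with \<open>s = sqrt (b - a)\<close>.\<close>

lemma point_val_bound:
  assumes "a < b"
  obtains C where "0 < C" "\<And>f x. f \<in> Sob 1 a b \<Longrightarrow> x \<in> {a..b} \<Longrightarrow>
    cmod (point_val a b f x) \<le> C * (L2_norm a b f + L2_norm a b (weak_deriv a b f))"
proof -
  define s where "s = sqrt (b - a)"
  have s: "s > 0" "s\<^sup>2 = b - a" using assms by (auto simp: s_def)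
  have "cmod (point_val a b f x) \<le> (1 / s + s) * (L2_norm a b f + L2_norm a b (weak_deriv a b f))"
    if f: "f \<in> Sob 1 a b" and x: "x \<in> {a..b}" for f x
  proof -
    define N where "N = L2_norm a b (weak_deriv a b f)"
    have N: "0 \<le> N" unfolding N_def by (rule L2_norm_nonneg[OF Sob1_L2(2)[OF f]])
    \<comment> \<open>A lower bound for the modulus of \<open>f\<close> on the whole interval;
      integrating it and estimating L1 by L2 gives \<open>s p\<close> at most the L2 norm of
      \<open>f\<close>.\<close>
    define p where "p = cmod (point_val a b f x) - s * N"
    have le: "p \<le> cmod (point_val a b f y)" if y: "y \<in> {a..b}" for y
    proof -
      have "cmod (point_val a b f x - point_val a b f y) \<le> sqrt \<bar>x - y\<bar> * N"
        using point_val_Hoelder[OF assms f, of x y] point_val_Hoelder[OF assms f, of y x] x y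
        by (cases "x \<le> y") (auto simp: N_def norm_minus_commute)
      also have "\<dots> \<le> s * N" unfolding s_def using x y N by (intro mult_right_mono) auto
      finally show ?thesis
        unfolding p_def using norm_triangle_ineq2[of "point_val a b f x" "point_val a b f y"] by simp
    qed
    have "p * (b - a) = (LINT y|lborel. p * indicator {a<..<b} y)" using assms by simp
    also have "\<dots> \<le> (LINT y|lborel. cmod (rep_aefun f y))"
    proof (rule integral_mono_AE)
      show "AE y in lborel. p * indicator {a<..<b} y \<le> cmod (rep_aefun f y)"
        using agrees_on_point_val[OF assms f, unfolded agrees_on_iff]
        by eventually_elim (use le in \<open>auto simp: indicator_def\<close>)
    qed (use L2_integrable(1)[OF Sob1_L2(1)[OF f]] assms in \<open>auto intro!: integrable_mult_right\<close>)
    also have "\<dots> \<le> s * L2_norm a b f"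
      using L2_integrable(2)[OF Sob1_L2(1)[OF f]] assms by (simp add: s_def)
    finally have "s * (s * p) \<le> s * L2_norm a b f" using s(2) by (simp add: power2_eq_square mult_ac)
    then have "s * p \<le> L2_norm a b f" using s by simp
    then have "p \<le> 1 / s * L2_norm a b f" using s by (simp add: field_simps)
    moreover have "0 \<le> 1 / s * N" "0 \<le> s * L2_norm a b f"
      using s N L2_norm_nonneg[OF Sob1_L2(1)[OF f]] by auto
    ultimately show ?thesis unfolding p_def N_def[symmetric] by (simp add: algebra_simps)
  qed
  moreover have "0 < 1 / s + s" using s by (simp add: add_pos_pos)
  ultimately show thesis using that by blast
qed

lemma cnj_prim:
  assumes "integrable lborel g"
  shows "prim (\<lambda>x. cnj (g x)) x = cnj (prim g x)"
  unfolding prim_def Bochner_Integration.integral_cnj[symmetric]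
  by (rule Bochner_Integration.integral_cong) auto

text \<open>Both functions are written as a boundary value plus a primitive, conjugated for
  \<open>g\<close>. The product of the primitives is treated by \<open>integral_prim_parts\<close>,
  and the terms with the constants assemble the boundary values at \<open>b\<close>.\<close>

lemma L2_inner_parts:
  assumes ab: "a < b" and f: "f \<in> Sob 1 a b" and g: "g \<in> Sob 1 a b"
  shows "L2_inner a b (weak_deriv a b f) g + L2_inner a b f (weak_deriv a b g)
    = point_val a b f b * cnj (point_val a b g b) - point_val a b f a * cnj (point_val a b g a)"
proof -
  define p where "p = rep_aefun (weak_deriv a b f)"
  define q where "q x = cnj (rep_aefun (weak_deriv a b g) x)" for x
  define F where "F = point_val a b f a"
  define G where "G = cnj (point_val a b g a)"
  note f' = Sob1_L2(2)[OF f] and g' = Sob1_L2(2)[OF g]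
  have p: "integrable lborel p" unfolding p_def by (rule L2_integrable[OF f'])
  have q: "integrable lborel q" unfolding q_def using L2_integrable[OF g'] by simp
  have [measurable]: "p \<in> borel_measurable borel" "q \<in> borel_measurable borel" using p q by auto
  have pq: "prim q x = cnj (prim (rep_aefun (weak_deriv a b g)) x)" for x
    unfolding q_def by (rule cnj_prim[OF L2_integrable(1)[OF g']])
  have 1: "L2_inner a b (weak_deriv a b f) g = (LINT x|lborel. p x * G + p x * prim q x)"
    unfolding L2_inner_eq[OF f'] p_def[symmetric]
  proof (rule integral_cong_AE)
    show "AE x in lborel. p x * cnj (rep_aefun g x) = p x * G + p x * prim q x"
      using L2_D(1)[OF f'] point_val_weak_deriv(2)[OF ab g[unfolded Sob1_iff], unfolded agrees_on_iff]
    proof eventually_elim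
      case (elim x)
      then show ?case by (cases "x \<in> {a<..<b}") (auto simp: p_def G_def pq distrib_left)
    qed
  qed auto
  have 2: "L2_inner a b f (weak_deriv a b g) = (LINT x|lborel. F * q x + prim p x * q x)"
    unfolding L2_inner_eq[OF Sob1_L2(1)[OF f]] q_def[symmetric]
  proof (rule integral_cong_AE)
    show "AE x in lborel. rep_aefun f x * q x = F * q x + prim p x * q x"
      using L2_D(1)[OF g'] point_val_weak_deriv(2)[OF ab f[unfolded Sob1_iff], unfolded agrees_on_iff]
    proof eventually_elim
      case (elim x)
      then show ?case by (cases "x \<in> {a<..<b}") (auto simp: p_def q_def F_def distrib_right)
    qed
  qed auto
  have i: "integrable lborel (\<lambda>x. prim p x * q x)"
    using integrable_mult_prim[OF q p] by (simp add: mult.commute)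
  have Fb: "point_val a b f b = F + integral\<^sup>L lborel p"
    using point_val_weak_deriv(1)[OF ab f[unfolded Sob1_iff], of b] ab prim_L2_right[OF f', of b]
    by (simp add: F_def p_def)
  have Gb: "cnj (point_val a b g b) = G + integral\<^sup>L lborel q"
    using point_val_weak_deriv(1)[OF ab g[unfolded Sob1_iff], of b] ab prim_L2_right[OF g', of b]
    by (simp add: G_def q_def[abs_def])
  show ?thesis
    unfolding 1 2 Fb Gb F_def[symmetric] G_def[symmetric]
    using p q i integrable_mult_prim[OF p q] integral_prim_parts[OF p q]
    by (simp add: algebra_simps)
qed

text \<open>This makes elements of L2 out of functions on the line; one function thus yields a piece
  on each of two adjacent intervals.\<close>

definition restr :: "real \<Rightarrow> real \<Rightarrow> (real \<Rightarrow> complex) \<Rightarrow> aefun" where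
  "restr a b \<phi> = abs_aefun (\<lambda>x. indicator {a<..<b} x *\<^sub>R \<phi> x)"

lemma rep_restr:
  assumes "continuous_on UNIV \<phi>"
  shows "AE x in lborel. rep_aefun (restr a b \<phi>) x = indicator {a<..<b} x *\<^sub>R \<phi> x"
proof -
  have [measurable]: "\<phi> \<in> borel_measurable borel" using assms by (rule borel_measurable_continuous_onI)
  show ?thesis unfolding restr_def by (rule rep_abs_aefun) measurable
qed

lemma fn_L2:
  assumes "continuous_on UNIV \<phi>"
  shows "restr a b \<phi> \<in> L2 a b"
proof -
  have [measurable]: "\<phi> \<in> borel_measurable borel" using assms by (rule borel_measurable_continuous_onI)
  have c: "continuous_on {a..b} (\<lambda>x. (cmod (\<phi> x))\<^sup>2)"
    by (intro continuous_intros continuous_on_subset[OF assms]) auto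
  have "integrable lborel (\<lambda>x. indicator {a..b} x *\<^sub>R (cmod (\<phi> x))\<^sup>2)"
    by (rule borel_integrable_compact) (use c in auto)
  then have "integrable lborel (\<lambda>x. (cmod (indicator {a<..<b} x *\<^sub>R \<phi> x))\<^sup>2)"
    by (rule Bochner_Integration.integrable_bound) (auto simp: indicator_def)
  then show ?thesis unfolding restr_def by (intro abs_aefun_L2) auto
qed

lemma restr_add:
  assumes "continuous_on UNIV \<phi>" "continuous_on UNIV \<psi>"
  shows "restr a b (\<lambda>x. \<phi> x + \<psi> x) = restr a b \<phi> + restr a b \<psi>"
proof (rule rep_aefun_eqI)
  have c: "continuous_on UNIV (\<lambda>x. \<phi> x + \<psi> x)" using assms by (intro continuous_intros)
  show "AE x in lborel. rep_aefun (restr a b (\<lambda>x. \<phi> x + \<psi> x)) x = rep_aefun (restr a b \<phi> + restr a b \<psi>) x"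
    using rep_restr[OF assms(1), of a b] rep_restr[OF assms(2), of a b] rep_restr[OF c, of a b]
      rep_aefun_plus[of "restr a b \<phi>" "restr a b \<psi>"]
    by eventually_elim (simp add: scaleR_add_right)
qed

lemma restr_cmult:
  assumes "continuous_on UNIV \<phi>"
  shows "restr a b (\<lambda>x. k * \<phi> x) = k *\<^sub>C restr a b \<phi>"
proof (rule rep_aefun_eqI)
  have c: "continuous_on UNIV (\<lambda>x. k * \<phi> x)" using assms by (intro continuous_intros)
  show "AE x in lborel. rep_aefun (restr a b (\<lambda>x. k * \<phi> x)) x = rep_aefun (k *\<^sub>C restr a b \<phi>) x"
    using rep_restr[OF assms(1), of a b] rep_restr[OF c, of a b] rep_aefun_scaleC[of k "restr a b \<phi>"]
    by eventually_elim simp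
qed

lemma restr_split:
  assumes "a < m" "m < b" "continuous_on UNIV \<phi>"
  shows "restr a b \<phi> = restr a m \<phi> + restr m b \<phi>"
proof (rule rep_aefun_eqI)
  show "AE x in lborel. rep_aefun (restr a b \<phi>) x = rep_aefun (restr a m \<phi> + restr m b \<phi>) x"
    using rep_restr[OF assms(3), of a b] rep_restr[OF assms(3), of a m] rep_restr[OF assms(3), of m b]
      rep_aefun_plus[of "restr a m \<phi>" "restr m b \<phi>"] AE_lborel_singleton[of m]
    by eventually_elim (use assms in \<open>auto simp: indicator_def\<close>)
qed

lemma L2_inner_restr:
  assumes f: "f \<in> L2 a b" and \<phi>: "continuous_on UNIV \<phi>"
  shows "L2_inner a b f (restr a b \<phi>) = (LINT x|lborel. rep_aefun f x * cnj (\<phi> x))"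
  unfolding L2_inner_eq[OF f]
proof (rule integral_cong_AE)
  have [measurable]: "\<phi> \<in> borel_measurable borel" using \<phi> by (rule borel_measurable_continuous_onI)
  show "(\<lambda>x. rep_aefun f x * cnj (\<phi> x)) \<in> borel_measurable lborel" by measurable
  show "AE x in lborel. rep_aefun f x * cnj (rep_aefun (restr a b \<phi>) x) = rep_aefun f x * cnj (\<phi> x)"
    using L2_D(1)[OF f] rep_restr[OF \<phi>, of a b] by eventually_elim (auto simp: indicator_def)
qed auto

lemma restr_weak_deriv:
  assumes ab: "a < b" and d: "\<And>x. (\<phi> has_vector_derivative \<phi>' x) (at x)" and c: "continuous_on UNIV \<phi>'"
  shows "has_weak_deriv a b (restr a b \<phi>) (restr a b \<phi>')"
    and "x \<in> {a..b} \<Longrightarrow> point_val a b (restr a b \<phi>) x = \<phi> x"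
proof -
  have c0: "continuous_on UNIV \<phi>"
    using d continuous_at_imp_continuous_on has_vector_derivative_continuous by blast
  have p: "prim (rep_aefun (restr a b \<phi>')) x = \<phi> x - \<phi> a" if x: "x \<in> {a<..<b}" for x
  proof -
    have [measurable]: "\<phi>' \<in> borel_measurable borel" using c by (rule borel_measurable_continuous_onI)
    have "prim (rep_aefun (restr a b \<phi>')) x = (LINT t|lborel. indicator {a..x} t *\<^sub>R \<phi>' t)"
      unfolding prim_def
    proof (rule integral_cong_AE)
      show "AE t in lborel. (if t \<le> x then rep_aefun (restr a b \<phi>') t else 0) = indicator {a..x} t *\<^sub>R \<phi>' t"
        using rep_restr[OF c, of a b] AE_lborel_singleton[of a]
        by eventually_elim (use x in \<open>auto simp: indicator_def\<close>)
    qed auto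
    also have "\<dots> = \<phi> x - \<phi> a"
      using x by (intro integral_FTC_Icc)
         (auto intro: has_vector_derivative_at_within d continuous_on_subset[OF c])
    finally show ?thesis .
  qed
  have "agrees_on a b (restr a b \<phi>) (\<lambda>x. \<phi> a + prim (rep_aefun (restr a b \<phi>')) x)"
    unfolding agrees_on_iff using rep_restr[OF c0, of a b] by eventually_elim (auto simp: p)
  then show "has_weak_deriv a b (restr a b \<phi>) (restr a b \<phi>')"
    by (intro has_weak_deriv_primI fn_L2 c c0)
  have "agrees_on a b (restr a b \<phi>) \<phi>"
    unfolding agrees_on_iff using rep_restr[OF c0, of a b] by eventually_elim auto
  then show "x \<in> {a..b} \<Longrightarrow> point_val a b (restr a b \<phi>) x = \<phi> x"
    by (intro point_val_eqI[OF ab]) (auto intro: continuous_on_subset[OF c0])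
qed

lemma restr_smooth:
  assumes "a < b" "smooth \<phi>"
  shows "has_weak_deriv a b (restr a b \<phi>) (restr a b (\<lambda>x. vector_derivative \<phi> (at x)))"
    and "x \<in> {a..b} \<Longrightarrow> point_val a b (restr a b \<phi>) x = \<phi> x"
proof -
  note d = smooth_vector_derivative[OF assms(2)]
  show "has_weak_deriv a b (restr a b \<phi>) (restr a b (\<lambda>x. vector_derivative \<phi> (at x)))"
    by (rule restr_weak_deriv(1)[OF assms(1) d(2) smooth_continuous[OF d(1)]])
  show "x \<in> {a..b} \<Longrightarrow> point_val a b (restr a b \<phi>) x = \<phi> x"
    by (rule restr_weak_deriv(2)[OF assms(1) d(2) smooth_continuous[OF d(1)]])
qed

lemma test_function_cnj:
  assumes "test_function a b \<phi>"
  shows "test_function a b (\<lambda>x. cnj (\<phi> x))"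
    and "vector_derivative (\<lambda>x. cnj (\<phi> x)) (at x) = cnj (vector_derivative \<phi> (at x))"
proof -
  obtain D where D: "D 0 = \<phi>" "\<And>n x. (D n has_vector_derivative D (Suc n) x) (at x)"
    using assms unfolding test_function_def smooth_def by blast
  have D': "((\<lambda>x. cnj (D n x)) has_vector_derivative cnj (D (Suc n) x)) (at x)" for n x
    by (rule has_vector_derivative_cnj[OF D(2)])
  have "smooth (\<lambda>x. cnj (\<phi> x))"
    unfolding smooth_def using D(1) D' by (intro exI[of _ "\<lambda>n x. cnj (D n x)"]) auto
  then show "test_function a b (\<lambda>x. cnj (\<phi> x))" using assms unfolding test_function_def by auto
  show "vector_derivative (\<lambda>x. cnj (\<phi> x)) (at x) = cnj (vector_derivative \<phi> (at x))"
    using vector_derivative_at[OF D'[of 0]] vector_derivative_at[OF D(2)[of 0]] D(1) by simp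
qed

lemma test_function_continuous: "test_function a b \<phi> \<Longrightarrow> continuous_on UNIV \<phi>"
  "test_function a b \<phi> \<Longrightarrow> continuous_on UNIV (\<lambda>x. vector_derivative \<phi> (at x))"
  using smooth_continuous test_function_smooth test_function_deriv by blast+

text \<open>The inner product conjugates its second argument and the conjugate of a test function is
  a test function. In this form the identity passes to L2 limits and matches the sesquilinear forms
  of the beam.\<close>

lemma has_weak_deriv_inner_iff:
  "has_weak_deriv a b f g \<longleftrightarrow> f \<in> L2 a b \<and> g \<in> L2 a b \<and> (\<forall>\<phi>. test_function a b \<phi> \<longrightarrow>
     L2_inner a b f (restr a b (\<lambda>x. vector_derivative \<phi> (at x))) = - L2_inner a b g (restr a b \<phi>))"
proof -
  have "weak_deriv_identity a b f g \<longleftrightarrow> (\<forall>\<phi>. test_function a b \<phi> \<longrightarrow>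
     L2_inner a b f (restr a b (\<lambda>x. vector_derivative \<phi> (at x))) = - L2_inner a b g (restr a b \<phi>))"
    (is "_ \<longleftrightarrow> ?R") if fg: "f \<in> L2 a b" "g \<in> L2 a b"
  proof
    assume id: "weak_deriv_identity a b f g"
    show ?R
    proof (intro allI impI)
      fix \<phi> assume "test_function a b \<phi>"
      note t = this test_function_cnj[OF this]
      show "L2_inner a b f (restr a b (\<lambda>x. vector_derivative \<phi> (at x))) = - L2_inner a b g (restr a b \<phi>)"
        using id[unfolded weak_deriv_identity_iff, rule_format, OF t(2)]
        by (simp add: L2_inner_restr fg test_function_continuous[OF t(1)] t(3))
    qed
  next
    assume R: ?R
    show "weak_deriv_identity a b f g" unfolding weak_deriv_identity_iff
    proof (intro allI impI)
      fix \<phi> assume "test_function a b \<phi>"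
      note t = test_function_cnj[OF this]
      show "(LINT x|lborel. rep_aefun f x * vector_derivative \<phi> (at x)) = - (LINT x|lborel. rep_aefun g x * \<phi> x)"
        using R[rule_format, OF t(1)] fg test_function_continuous[OF t(1)] t(2) by (simp add: L2_inner_restr)
    qed
  qed
  then show ?thesis unfolding has_weak_deriv_def by blast
qed

lemma L2_inner_tendsto:
  assumes "\<And>n. X n \<in> L2 a b" "f \<in> L2 a b" "h \<in> L2 a b" "(\<lambda>n. form_norm (L2_inner a b) (X n - f)) \<longlonglongrightarrow> 0"
  shows "(\<lambda>n. L2_inner a b (X n) h) \<longlonglongrightarrow> L2_inner a b f h"
proof (rule Lim_null_comparison[THEN LIM_zero_cancel])
  show "\<forall>\<^sub>F n in sequentially. norm (L2_inner a b (X n) h - L2_inner a b f h)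
      \<le> form_norm (L2_inner a b) (X n - f) * form_norm (L2_inner a b) h"
  proof (rule always_eventually, rule allI)
    fix n
    have "L2_inner a b (X n) h - L2_inner a b f h = L2_inner a b (X n - f) h"
      using assms by (simp add: L2.ip_simps)
    then show "norm (L2_inner a b (X n) h - L2_inner a b f h)
      \<le> form_norm (L2_inner a b) (X n - f) * form_norm (L2_inner a b) h"
      using L2.cauchy_schwarz[of "X n - f" a b h] assms by (simp add: L2.S_closed)
  qed
  show "(\<lambda>n. form_norm (L2_inner a b) (X n - f) * form_norm (L2_inner a b) h) \<longlonglongrightarrow> 0"
    using tendsto_mult_right[OF assms(4)] by simp
qed

text \<open>Closed graph of the weak derivative: for a fixed test function both sides of the
  identity are continuous in L2.\<close>

lemma has_weak_deriv_closed:
  assumes X: "\<And>n. has_weak_deriv a b (X n) (Y n)" and fg: "f \<in> L2 a b" "g \<in> L2 a b"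
    and "(\<lambda>n. form_norm (L2_inner a b) (X n - f)) \<longlonglongrightarrow> 0" "(\<lambda>n. form_norm (L2_inner a b) (Y n - g)) \<longlonglongrightarrow> 0"
  shows "has_weak_deriv a b f g"
  unfolding has_weak_deriv_inner_iff
proof (intro conjI fg allI impI)
  fix \<phi> assume \<phi>: "test_function a b \<phi>"
  have L: "X n \<in> L2 a b" "Y n \<in> L2 a b" for n using X by (auto simp: has_weak_deriv_def)
  note c = test_function_continuous[OF \<phi>]
  have "(\<lambda>n. L2_inner a b (X n) (restr a b (\<lambda>x. vector_derivative \<phi> (at x))))
     \<longlonglongrightarrow> L2_inner a b f (restr a b (\<lambda>x. vector_derivative \<phi> (at x)))"
    by (intro L2_inner_tendsto L fg fn_L2 c assms)
  moreover have "(\<lambda>n. - L2_inner a b (Y n) (restr a b \<phi>)) \<longlonglongrightarrow> - L2_inner a b g (restr a b \<phi>)"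
    by (intro tendsto_minus L2_inner_tendsto L fg fn_L2 c assms)
  moreover have "L2_inner a b (X n) (restr a b (\<lambda>x. vector_derivative \<phi> (at x))) = - L2_inner a b (Y n) (restr a b \<phi>)" for n
    using X \<phi> unfolding has_weak_deriv_inner_iff by blast
  ultimately show "L2_inner a b f (restr a b (\<lambda>x. vector_derivative \<phi> (at x))) = - L2_inner a b g (restr a b \<phi>)"
    by (simp add: LIMSEQ_unique)
qed

text \<open>The hypothesis is the weak derivative identity for test functions of the form
  \<open>\<phi>'\<close>, that is, of mean zero. Its defect on a general \<open>\<eta>\<close>
  depends on the integral of \<open>\<eta>\<close> alone, and a constant function accounts for
  it.\<close>

lemma weak_deriv_of_second_order_identity:
  assumes ab: "a < b" and f: "f \<in> L2 a b" and g: "g \<in> L2 a b"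
    and id: "\<And>\<phi>. test_function a b \<phi> \<Longrightarrow>
      L2_inner a b f (restr a b (\<lambda>x. vector_derivative (\<lambda>x. vector_derivative \<phi> (at x)) (at x)))
       = - L2_inner a b g (restr a b (\<lambda>x. vector_derivative \<phi> (at x)))"
  shows "\<exists>k. has_weak_deriv a b f (g - restr a b (\<lambda>_. k))"
proof -
  obtain \<psi>0 where \<psi>0: "test_function a b \<psi>0" "(LINT x|lborel. \<psi>0 x) = 1"
    using unit_test_function[OF ab] by blast
  \<comment> \<open>The defect of the identity "g is the weak derivative of f" at
    \<open>\<eta>\<close>; it vanishes on test functions with mean zero.\<close>
  define E where "E \<eta> = L2_inner a b f (restr a b (\<lambda>x. vector_derivative \<eta> (at x))) + L2_inner a b g (restr a b \<eta>)" for \<eta>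
  define K where "K = E \<psi>0"
  have k: "restr a b (\<lambda>_. K) \<in> L2 a b" by (intro fn_L2 continuous_intros)
  have "has_weak_deriv a b f (g - restr a b (\<lambda>_. K))"
    unfolding has_weak_deriv_inner_iff
  proof (intro conjI f allI impI)
    show "g - restr a b (\<lambda>_. K) \<in> L2 a b" using g k by (simp add: L2.S_closed)
    fix \<eta> assume \<eta>: "test_function a b \<eta>"
    define c where "c = (LINT x|lborel. \<eta> x)"
    define \<psi> where "\<psi> x = \<eta> x + (- c) * \<psi>0 x" for x
    have \<psi>: "test_function a b \<psi>"
      unfolding \<psi>_def using \<eta> \<psi>0 by (intro test_function_add test_function_cmult)
    have "(LINT x|lborel. \<psi> x) = c + (- c) * 1"
      unfolding c_def \<psi>_def by (subst Bochner_Integration.integral_add)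
         (use test_function_integrable[OF \<eta>] test_function_integrable[OF \<psi>0(1)] \<psi>0(2) in auto)
    then have "(LINT x|lborel. \<psi> x) = 0" by simp
    then obtain \<phi> where \<phi>: "test_function a b \<phi>" "\<And>x. vector_derivative \<phi> (at x) = \<psi> x"
      using mean_zero_test_function[OF \<psi>] by blast
    have 0: "E \<psi> = 0" using id[OF \<phi>(1)] by (simp add: E_def \<phi>(2))
    have dv: "vector_derivative \<psi> (at x) = vector_derivative \<eta> (at x) + (- c) * vector_derivative \<psi>0 (at x)" for x
    proof -
      have "(\<psi> has_vector_derivative vector_derivative \<eta> (at x) + (- c) * vector_derivative \<psi>0 (at x)) (at x)"
        unfolding \<psi>_def
        by (intro has_vector_derivative_add has_vector_derivative_mult_right smooth_vector_derivative(2)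
            test_function_smooth[OF \<eta>] test_function_smooth[OF \<psi>0(1)])
      then show ?thesis by (rule vector_derivative_at)
    qed
    have sp: "restr a b \<psi> = restr a b \<eta> + (- c) *\<^sub>C restr a b \<psi>0"
      "restr a b (\<lambda>x. vector_derivative \<psi> (at x)) = restr a b (\<lambda>x. vector_derivative \<eta> (at x))
        + (- c) *\<^sub>C restr a b (\<lambda>x. vector_derivative \<psi>0 (at x))"
    proof -
      have "\<psi> = (\<lambda>x. \<eta> x + (- c) * \<psi>0 x)" by (rule ext) (simp only: \<psi>_def)
      then show "restr a b \<psi> = restr a b \<eta> + (- c) *\<^sub>C restr a b \<psi>0"
        using test_function_continuous[OF \<eta>] test_function_continuous[OF \<psi>0(1)]
        by (simp only: restr_add restr_cmult continuous_on_mult_left)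
      show "restr a b (\<lambda>x. vector_derivative \<psi> (at x)) = restr a b (\<lambda>x. vector_derivative \<eta> (at x))
        + (- c) *\<^sub>C restr a b (\<lambda>x. vector_derivative \<psi>0 (at x))"
        unfolding dv using test_function_continuous[OF \<eta>] test_function_continuous[OF \<psi>0(1)]
        by (simp only: restr_add restr_cmult continuous_on_mult_left)
    qed
    have L: "restr a b \<eta> \<in> L2 a b" "restr a b \<psi>0 \<in> L2 a b" "restr a b (\<lambda>x. vector_derivative \<eta> (at x)) \<in> L2 a b"
      "restr a b (\<lambda>x. vector_derivative \<psi>0 (at x)) \<in> L2 a b"
      using test_function_continuous[OF \<eta>] test_function_continuous[OF \<psi>0(1)] by (auto intro: fn_L2)
    \<comment> \<open>The defect is antilinear in its argument, whence the conjugate of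
      \<open>c\<close>; pairing the constant \<open>K\<close> with \<open>\<eta>\<close> below
      produces the same conjugate.\<close>
    have "E \<psi> = E \<eta> - cnj c * K"
      unfolding K_def E_def sp using f g L by (simp add: L2.ip_simps L2.S_closed algebra_simps)
    then have 1: "E \<eta> = cnj c * K" using 0 by simp
    have "L2_inner a b (restr a b (\<lambda>_. K)) (restr a b \<eta>) = (LINT x|lborel. K * cnj (\<eta> x))"
      unfolding L2_inner_restr[OF k test_function_continuous(1)[OF \<eta>]]
    proof (rule integral_cong_AE)
      have [measurable]: "\<eta> \<in> borel_measurable borel" using test_function_measurable(1)[OF \<eta>] .
      show "(\<lambda>x. rep_aefun (restr a b (\<lambda>_. K)) x * cnj (\<eta> x)) \<in> borel_measurable lborel"
        "(\<lambda>x. K * cnj (\<eta> x)) \<in> borel_measurable lborel" by measurable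
      show "AE x in lborel. rep_aefun (restr a b (\<lambda>_. K)) x * cnj (\<eta> x) = K * cnj (\<eta> x)"
        using rep_restr[OF continuous_on_const, of a b K]
        by eventually_elim (use test_function_outside[OF \<eta>] in \<open>auto simp: indicator_def\<close>)
    qed
    then have "L2_inner a b (restr a b (\<lambda>_. K)) (restr a b \<eta>) = K * cnj c" by (simp add: c_def)
    then show "L2_inner a b f (restr a b (\<lambda>x. vector_derivative \<eta> (at x))) = - L2_inner a b (g - restr a b (\<lambda>_. K)) (restr a b \<eta>)"
      using 1 g k L by (simp add: L2.ip_simps E_def algebra_simps add_eq_0_iff2)
  qed
  then show ?thesis by blast
qed

section \<open>The H^1 inner product, H^1_0, and compactness\<close>

definition h1_inner :: "real \<Rightarrow> real \<Rightarrow> aefun \<Rightarrow> aefun \<Rightarrow> complex" where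
  "h1_inner a b f g = L2_inner a b f g + L2_inner a b (weak_deriv a b f) (weak_deriv a b g)"

text \<open>Stated for an array of distances, so that the Cauchy property can be transferred between
  norms on different spaces and added up over components.\<close>

definition dcauchy :: "(nat \<Rightarrow> nat \<Rightarrow> real) \<Rightarrow> bool" where
  "dcauchy d \<longleftrightarrow> (\<forall>e>0. \<exists>N. \<forall>m\<ge>N. \<forall>n\<ge>N. d m n < e)"

lemma form_Cauchy_iff: "form_Cauchy B X \<longleftrightarrow> dcauchy (\<lambda>m n. form_norm B (X m - X n))"
  by (simp add: form_Cauchy_def dcauchy_def)

lemma dcauchy_mult_le:
  assumes "dcauchy d" "0 \<le> C" "\<And>m n. d' m n \<le> C * d m n"
  shows "dcauchy d'"
  unfolding dcauchy_def
proof (intro allI impI)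
  fix e :: real assume e: "e > 0"
  have "0 < e / (C + 1)" using e assms(2) by simp
  then obtain N where N: "\<And>m n. m \<ge> N \<Longrightarrow> n \<ge> N \<Longrightarrow> d m n < e / (C + 1)"
    using assms(1) unfolding dcauchy_def by meson
  show "\<exists>N. \<forall>m\<ge>N. \<forall>n\<ge>N. d' m n < e"
  proof (intro exI[of _ N] allI impI)
    fix m n assume "N \<le> m" "N \<le> n"
    have "d' m n \<le> C * d m n" by (rule assms)
    also have "\<dots> \<le> C * (e / (C + 1))"
      using N[OF \<open>N \<le> m\<close> \<open>N \<le> n\<close>] assms(2) by (intro mult_left_mono) auto
    also have "\<dots> < e" using e assms(2) by (simp add: field_simps)
    finally show "d' m n < e" .
  qed
qed

lemma form_CauchyI:
  assumes "form_Cauchy B X" "0 \<le> C" "\<And>m n. form_norm A (Y m - Y n) \<le> C * form_norm B (X m - X n)"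
  shows "form_Cauchy A Y"
  using dcauchy_mult_le[OF assms(1)[unfolded form_Cauchy_iff] assms(2,3)] by (simp only: form_Cauchy_iff)

lemma form_Cauchy_subseq: "form_Cauchy B X \<Longrightarrow> strict_mono r \<Longrightarrow> form_Cauchy B (X \<circ> r)"
  unfolding form_Cauchy_def by (metis comp_apply order_trans seq_suble)

lemma h1_semi_inner: "semi_inner (Sob 1 a b) (h1_inner a b)"
proof
  show "csubspace (Sob 1 a b)" by (rule csub_Sob1)
  have "sesquilinear_on (Sob 1 a b) (\<lambda>f g. L2_inner a b f g + L2_inner a b (weak_deriv a b f) (weak_deriv a b g))"
    by (rule sesq_plus[OF sesq_pullback[OF clin_Sob1_L2 clin_Sob1_L2 L2.sesquilinear_on]
          sesq_pullback[OF clin_weak_deriv clin_weak_deriv L2.sesquilinear_on]])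
  then show "sesquilinear_on (Sob 1 a b) (h1_inner a b)" by (simp add: h1_inner_def[abs_def])
  show "cnj (h1_inner a b u v) = h1_inner a b v u" if "u \<in> Sob 1 a b" "v \<in> Sob 1 a b" for u v
    unfolding h1_inner_def using Sob1_L2[OF that(1)] Sob1_L2[OF that(2)] by (simp add: L2.cnj_ip)
  show "0 \<le> Re (h1_inner a b u u)" if "u \<in> Sob 1 a b" for u
    unfolding h1_inner_def using Sob1_L2[OF that] by (simp add: L2.Re_ip_nonneg)
qed

lemma form_norm_h1:
  assumes "f \<in> Sob 1 a b"
  shows "form_norm (h1_inner a b) f = sqrt ((L2_norm a b f)\<^sup>2 + (L2_norm a b (weak_deriv a b f))\<^sup>2)"
  using L2.nrm_sq[OF Sob1_L2(1)[OF assms]] L2.nrm_sq[OF Sob1_L2(2)[OF assms]]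
  by (simp add: form_norm_def[of "h1_inner a b"] h1_inner_def L2_norm_form_norm)

lemma H1_norm_form_norm: "f \<in> Sob 1 a b \<Longrightarrow> H1_norm a b f = form_norm (h1_inner a b) f"
  by (simp only: form_norm_h1 H1_norm_def)

lemma L2_norm_le_h1:
  assumes "f \<in> Sob 1 a b"
  shows "L2_norm a b f \<le> form_norm (h1_inner a b) f"
    and "L2_norm a b (weak_deriv a b f) \<le> form_norm (h1_inner a b) f"
    and "form_norm (h1_inner a b) f \<le> L2_norm a b f + L2_norm a b (weak_deriv a b f)"
  unfolding form_norm_h1[OF assms]
  using L2_norm_nonneg[OF Sob1_L2(1)[OF assms]] L2_norm_nonneg[OF Sob1_L2(2)[OF assms]]
  by (auto intro: real_le_rsqrt real_le_lsqrt sqrt_sum_squares_le_sum)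

text \<open>The functions and their derivatives converge separately in L2, and the closed graph of
  the weak derivative links the two limits.\<close>

lemma h1_complete: "form_complete (Sob 1 a b) (h1_inner a b)"
  unfolding form_complete_def
proof (intro allI impI)
  fix X assume X: "\<forall>n. X n \<in> Sob 1 a b" and C: "form_Cauchy (h1_inner a b) X"
  have d: "X m - X n \<in> Sob 1 a b" for m n using X csub_diff[OF csub_Sob1] by blast
  have "form_Cauchy (L2_inner a b) X"
    by (rule form_CauchyI[OF C, where C=1]) (use L2_norm_le_h1(1)[OF d] in \<open>simp_all add: L2_norm_form_norm\<close>)
  then obtain f where f: "f \<in> L2 a b" "(\<lambda>n. form_norm (L2_inner a b) (X n - f)) \<longlonglongrightarrow> 0"
    using L2.completeD[of X] X Sob1_L2(1) by metis
  have "form_Cauchy (L2_inner a b) (\<lambda>n. weak_deriv a b (X n))"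
    by (rule form_CauchyI[OF C, where C=1])
       (use L2_norm_le_h1(2)[OF d] X in \<open>simp_all add: L2_norm_form_norm weak_deriv_diff del: One_nat_def Sob.simps\<close>)
  then obtain g where g: "g \<in> L2 a b" "(\<lambda>n. form_norm (L2_inner a b) (weak_deriv a b (X n) - g)) \<longlonglongrightarrow> 0"
    using L2.completeD[of "\<lambda>n. weak_deriv a b (X n)"] X Sob1_L2(2) by metis
  have hwd: "has_weak_deriv a b f g"
    by (rule has_weak_deriv_closed[OF _ f(1) g(1) f(2) g(2)]) (use X Sob1_iff in blast)
  have fS: "f \<in> Sob 1 a b" and wf: "weak_deriv a b f = g"
    using has_weak_deriv_Sob1[OF hwd] weak_deriv_eqI[OF hwd] by auto
  have dn: "X n - f \<in> Sob 1 a b" for n using X fS csub_diff[OF csub_Sob1] by blast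
  have "(\<lambda>n. form_norm (h1_inner a b) (X n - f)) \<longlonglongrightarrow> 0"
  proof (rule tendsto_sandwich[OF _ _ tendsto_const])
    show "(\<lambda>n. form_norm (L2_inner a b) (X n - f) + form_norm (L2_inner a b) (weak_deriv a b (X n) - g)) \<longlonglongrightarrow> 0"
      using tendsto_add[OF f(2) g(2)] by simp
    show "\<forall>\<^sub>F n in sequentially. form_norm (h1_inner a b) (X n - f)
        \<le> form_norm (L2_inner a b) (X n - f) + form_norm (L2_inner a b) (weak_deriv a b (X n) - g)"
    proof (rule always_eventually, rule allI)
      fix n
      have "weak_deriv a b (X n - f) = weak_deriv a b (X n) - g"
        using weak_deriv_diff[OF _ fS, of "X n"] X wf by simp
      then show "form_norm (h1_inner a b) (X n - f)
        \<le> form_norm (L2_inner a b) (X n - f) + form_norm (L2_inner a b) (weak_deriv a b (X n) - g)"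
        using L2_norm_le_h1(3)[OF dn[of n]] by (simp add: L2_norm_form_norm)
    qed
    show "\<forall>\<^sub>F n in sequentially. 0 \<le> form_norm (h1_inner a b) (X n - f)"
      using semi_inner.nrm_nonneg[OF h1_semi_inner dn] by simp
  qed
  then show "\<exists>l\<in>Sob 1 a b. (\<lambda>n. form_norm (h1_inner a b) (X n - l)) \<longlonglongrightarrow> 0" using fS by blast
qed

interpretation h1: semi_hilbert "Sob 1 a b" "h1_inner a b" for a b
  using h1_semi_inner h1_complete by (simp only: semi_hilbert_def semi_hilbert_axioms_def)

lemma point_val_add:
  assumes "a < b" "f \<in> Sob 1 a b" "g \<in> Sob 1 a b" "x \<in> {a..b}"
  shows "point_val a b (f + g) x = point_val a b f x + point_val a b g x"
proof (rule point_val_eqI[OF assms(1) _ _ assms(4)])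
  show "continuous_on {a..b} (\<lambda>x. point_val a b f x + point_val a b g x)"
    using assms by (intro continuous_intros point_val_continuous)
  show "agrees_on a b (f + g) (\<lambda>x. point_val a b f x + point_val a b g x)"
    using agrees_on_point_val[OF assms(1,2)] agrees_on_point_val[OF assms(1,3)] rep_aefun_plus[of f g]
    unfolding agrees_on_iff by eventually_elim auto
qed

lemma point_val_scaleC:
  assumes "a < b" "f \<in> Sob 1 a b" "x \<in> {a..b}"
  shows "point_val a b (k *\<^sub>C f) x = k * point_val a b f x"
proof (rule point_val_eqI[OF assms(1) _ _ assms(3)])
  show "continuous_on {a..b} (\<lambda>x. k * point_val a b f x)"
    using assms by (intro continuous_intros point_val_continuous)
  show "agrees_on a b (k *\<^sub>C f) (\<lambda>x. k * point_val a b f x)"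
    using agrees_on_point_val[OF assms(1,2)] rep_aefun_scaleC[of k f]
    unfolding agrees_on_iff by eventually_elim auto
qed

lemma point_val_zero: "a < b \<Longrightarrow> x \<in> {a..b} \<Longrightarrow> point_val a b 0 x = 0"
  using point_val_scaleC[of a b 0 x 0] h1.S_closed(1) scaleR_eq_scaleC[of 0 "0::aefun"] by simp

text \<open>Evaluation is continuous in H^1 by \<open>point_val_bound\<close>, so boundary and
  interface conditions survive limits.\<close>

lemma point_val_tendsto:
  assumes ab: "a < b" and X: "\<And>n. X n \<in> Sob 1 a b" "f \<in> Sob 1 a b" and x: "x \<in> {a..b}"
    and lim: "(\<lambda>n. form_norm (h1_inner a b) (X n - f)) \<longlonglongrightarrow> 0"
  shows "(\<lambda>n. point_val a b (X n) x) \<longlonglongrightarrow> point_val a b f x"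
proof -
  obtain C where C: "0 < C" "\<And>f x. f \<in> Sob 1 a b \<Longrightarrow> x \<in> {a..b} \<Longrightarrow>
    cmod (point_val a b f x) \<le> C * (L2_norm a b f + L2_norm a b (weak_deriv a b f))"
    using point_val_bound[OF ab] by blast
  show ?thesis
  proof (rule Lim_null_comparison[THEN LIM_zero_cancel])
    show "\<forall>\<^sub>F n in sequentially. norm (point_val a b (X n) x - point_val a b f x)
        \<le> C * 2 * form_norm (h1_inner a b) (X n - f)"
    proof (rule always_eventually, rule allI)
      fix n
      have d: "X n - f \<in> Sob 1 a b" using X by (rule h1.S_closed)
      have "point_val a b (X n - f) x = point_val a b (X n) x - point_val a b f x"
        using point_val_add[OF ab d X(2) x] by simp
      then have "norm (point_val a b (X n) x - point_val a b f x)
          \<le> C * (L2_norm a b (X n - f) + L2_norm a b (weak_deriv a b (X n - f)))"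
        using C(2)[OF d x] by simp
      also have "\<dots> \<le> C * (form_norm (h1_inner a b) (X n - f) + form_norm (h1_inner a b) (X n - f))"
        using L2_norm_le_h1[OF d] C(1) by (intro mult_left_mono add_mono) auto
      finally show "norm (point_val a b (X n) x - point_val a b f x) \<le> C * 2 * form_norm (h1_inner a b) (X n - f)"
        by simp
    qed
    show "(\<lambda>n. C * 2 * form_norm (h1_inner a b) (X n - f)) \<longlonglongrightarrow> 0"
      using tendsto_mult_left[OF lim, of "C * 2"] by simp
  qed
qed

lemma H10_iff: "f \<in> H10 a b \<longleftrightarrow> f \<in> Sob 1 a b \<and> (\<forall>\<epsilon>>0. \<exists>g \<in> Sob 1 a b.
    (\<exists>\<phi>. test_function a b \<phi> \<and> agrees_on a b g \<phi>) \<and> form_norm (h1_inner a b) (f - g) < \<epsilon>)"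
proof -
  have "H1_norm a b (f - g) = form_norm (h1_inner a b) (f - g)" if "f \<in> Sob 1 a b" "g \<in> Sob 1 a b" for g
    by (rule H1_norm_form_norm[OF h1.S_closed(6)[OF that]])
  then show ?thesis
    unfolding H10_def mem_Collect_eq by (simp cong: conj_cong bex_cong del: One_nat_def Sob.simps)
qed

lemma H10_Sob1: "f \<in> H10 a b \<Longrightarrow> f \<in> Sob 1 a b"
  by (simp add: H10_def)

lemma test_function_H10:
  assumes "a < b" "test_function a b \<phi>"
  shows "restr a b \<phi> \<in> H10 a b"
  unfolding H10_iff
proof (intro conjI allI impI)
  show 1: "restr a b \<phi> \<in> Sob 1 a b"
    by (rule has_weak_deriv_Sob1[OF restr_smooth(1)[OF assms(1) test_function_smooth[OF assms(2)]]])
  have "agrees_on a b (restr a b \<phi>) \<phi>"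
    unfolding agrees_on_iff using rep_restr[OF test_function_continuous(1)[OF assms(2)], of a b]
    by eventually_elim auto
  moreover have "form_norm (h1_inner a b) (restr a b \<phi> - restr a b \<phi>) = 0"
    using h1.ip_simps(9)[OF h1.S_closed(1)] by (simp add: form_norm_def)
  ultimately show "\<exists>g\<in>Sob 1 a b. (\<exists>\<phi>. test_function a b \<phi> \<and> agrees_on a b g \<phi>) \<and>
      form_norm (h1_inner a b) (restr a b \<phi> - g) < e" if "e > 0" for e
    using 1 assms(2) that by (intro bexI[of _ "restr a b \<phi>"]) auto
qed

lemma csub_H10: "csubspace (H10 a b)"
proof (rule csubI)
  have "agrees_on a b 0 (\<lambda>_. 0)" unfolding agrees_on_iff using rep_aefun_zero by eventually_elim auto
  \<comment> \<open>For the zero function any \<open>c > a\<close> and \<open>d < b\<close> will do,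
    even with \<open>{c..d}\<close> empty.\<close>
  moreover have "test_function a b (\<lambda>_. 0)"
    unfolding test_function_def smooth_def
    by (intro conjI exI[of _ "\<lambda>_ _. 0"] exI[of _ "a + 1"] exI[of _ "b - 1"]) auto
  moreover have "form_norm (h1_inner a b) (0 - 0) = 0"
    using h1.ip_simps(9)[OF h1.S_closed(1)] by (simp add: form_norm_def)
  ultimately show "0 \<in> H10 a b"
    unfolding H10_iff using h1.S_closed(1) by (metis)
next
  fix f g assume fg: "f \<in> H10 a b" "g \<in> H10 a b"
  note S = fg[THEN H10_Sob1]
  show "f + g \<in> H10 a b" unfolding H10_iff
  proof (intro conjI allI impI)
    show "f + g \<in> Sob 1 a b" using S by (rule h1.S_closed)
    fix e :: real assume e: "e > 0"
    obtain p \<phi> where p: "p \<in> Sob 1 a b" "test_function a b \<phi>" "agrees_on a b p \<phi>"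
      "form_norm (h1_inner a b) (f - p) < e / 2"
      using fg(1) e unfolding H10_iff by (meson half_gt_zero)
    obtain q \<psi> where q: "q \<in> Sob 1 a b" "test_function a b \<psi>" "agrees_on a b q \<psi>"
      "form_norm (h1_inner a b) (g - q) < e / 2"
      using fg(2) e unfolding H10_iff by (meson half_gt_zero)
    have "agrees_on a b (p + q) (\<lambda>x. \<phi> x + \<psi> x)"
      using p(3) q(3) rep_aefun_plus[of p q] unfolding agrees_on_iff by eventually_elim auto
    moreover have "form_norm (h1_inner a b) ((f + g) - (p + q)) < e"
      using h1.nrm_triangle[OF h1.S_closed(6)[OF S(1) p(1)] h1.S_closed(6)[OF S(2) q(1)]] p(4) q(4)
      by (simp add: algebra_simps)
    ultimately show "\<exists>g'\<in>Sob 1 a b. (\<exists>\<phi>. test_function a b \<phi> \<and> agrees_on a b g' \<phi>) \<and>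
        form_norm (h1_inner a b) (f + g - g') < e"
      using h1.S_closed(2)[OF p(1) q(1)] test_function_add[OF p(2) q(2)] by blast
  qed
next
  fix k f assume f: "f \<in> H10 a b"
  note S = f[THEN H10_Sob1]
  show "k *\<^sub>C f \<in> H10 a b" unfolding H10_iff
  proof (intro conjI allI impI)
    show "k *\<^sub>C f \<in> Sob 1 a b" using S by (rule h1.S_closed)
    fix e :: real assume e: "e > 0"
    define d where "d = e / (cmod k + 1)"
    have k: "cmod k + 1 > 0" by (simp add: add_nonneg_pos)
    have "d > 0" using e k by (simp add: d_def)
    then obtain p \<phi> where p: "p \<in> Sob 1 a b" "test_function a b \<phi>" "agrees_on a b p \<phi>"
      "form_norm (h1_inner a b) (f - p) < d"
      using f unfolding H10_iff by blast
    have "agrees_on a b (k *\<^sub>C p) (\<lambda>x. k * \<phi> x)"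
      using p(3) rep_aefun_scaleC[of k p] unfolding agrees_on_iff by eventually_elim auto
    moreover have "form_norm (h1_inner a b) (k *\<^sub>C f - k *\<^sub>C p) < e"
    proof -
      have D: "f - p \<in> Sob 1 a b" using S p(1) by (rule h1.S_closed)
      have "k *\<^sub>C f - k *\<^sub>C p = k *\<^sub>C (f - p)"
        by transfer (auto simp: algebra_simps)
      then have "form_norm (h1_inner a b) (k *\<^sub>C f - k *\<^sub>C p) = cmod k * form_norm (h1_inner a b) (f - p)"
        using h1.nrm_scaleC[OF D] by simp
      also have "\<dots> \<le> (cmod k + 1) * form_norm (h1_inner a b) (f - p)"
        using h1.nrm_nonneg[OF D] by (intro mult_right_mono) auto
      also have "\<dots> < (cmod k + 1) * d" using k p(4) by (intro mult_strict_left_mono)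
      also have "\<dots> = e" using k by (simp add: d_def)
      finally show ?thesis .
    qed
    ultimately show "\<exists>g'\<in>Sob 1 a b. (\<exists>\<phi>. test_function a b \<phi> \<and> agrees_on a b g' \<phi>) \<and>
        form_norm (h1_inner a b) (k *\<^sub>C f - g') < e"
      using h1.S_closed(3)[OF p(1)] test_function_cmult[OF p(2)] by blast
  qed
qed

lemma H10_closed:
  assumes X: "\<And>n. X n \<in> H10 a b" and f: "f \<in> Sob 1 a b"
    and lim: "(\<lambda>n. form_norm (h1_inner a b) (X n - f)) \<longlonglongrightarrow> 0"
  shows "f \<in> H10 a b"
  unfolding H10_iff
proof (intro conjI f allI impI)
  fix e :: real assume e: "e > 0"
  have "\<forall>\<^sub>F n in sequentially. form_norm (h1_inner a b) (X n - f) < e / 2"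
    using e by (intro order_tendstoD(2)[OF lim]) auto
  then obtain n where n: "form_norm (h1_inner a b) (X n - f) < e / 2"
    by (auto simp: eventually_sequentially)
  obtain p \<phi> where p: "p \<in> Sob 1 a b" "test_function a b \<phi>" "agrees_on a b p \<phi>"
      "form_norm (h1_inner a b) (X n - p) < e / 2"
    using X[of n] e unfolding H10_iff by (meson half_gt_zero)
  have "form_norm (h1_inner a b) (f - p) < e"
    using h1.nrm_triangle3[OF f H10_Sob1[OF X[of n]] p(1)] n p(4) h1.nrm_diff_commute[OF f H10_Sob1[OF X[of n]]]
    by simp
  then show "\<exists>g\<in>Sob 1 a b. (\<exists>\<phi>. test_function a b \<phi> \<and> agrees_on a b g \<phi>) \<and>
        form_norm (h1_inner a b) (f - g) < e"
    using p by blast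
qed

text \<open>The continuous representatives are uniformly bounded by \<open>point_val_bound\<close>
  and equicontinuous by the Hoelder bound, so Arzela and Ascoli give a uniformly convergent
  subsequence, which is Cauchy in L2 on a bounded interval.\<close>

lemma H1_compact:
  assumes ab: "a < b" and X: "\<And>n. X n \<in> Sob 1 a b" and M: "\<And>n. form_norm (h1_inner a b) (X n) \<le> M"
  obtains r where "strict_mono (r :: nat \<Rightarrow> nat)" "form_Cauchy (L2_inner a b) (X \<circ> r)"
proof -
  obtain C where C: "0 < C" "\<And>f x. f \<in> Sob 1 a b \<Longrightarrow> x \<in> {a..b} \<Longrightarrow>
    cmod (point_val a b f x) \<le> C * (L2_norm a b f + L2_norm a b (weak_deriv a b f))"
    using point_val_bound[OF ab] by blast
  have M': "L2_norm a b (weak_deriv a b (X n)) \<le> M" "L2_norm a b (X n) \<le> M" for n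
    using L2_norm_le_h1[OF X[of n]] M[of n] by auto
  have M0: "0 \<le> M" using h1.nrm_nonneg[OF X] M order_trans by blast
  define F where "F n = point_val a b (X n)" for n
  obtain g k where k: "strict_mono (k :: nat \<Rightarrow> nat)"
    "\<And>e. 0 < e \<Longrightarrow> \<exists>N. \<forall>n x. n \<ge> N \<and> x \<in> {a..b} \<longrightarrow> norm (F (k n) x - g x) < e"
  proof (rule Arzela_Ascoli[of "{a..b}" F "C * (M + M)"])
    show "norm (F n x) \<le> C * (M + M)" if "x \<in> {a..b}" for n x
    proof -
      have "norm (F n x) \<le> C * (L2_norm a b (X n) + L2_norm a b (weak_deriv a b (X n)))"
        unfolding F_def by (rule C(2)[OF X that])
      also have "\<dots> \<le> C * (M + M)" using M' C(1) by (intro mult_left_mono add_mono) auto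
      finally show ?thesis .
    qed
    show "\<exists>d. 0 < d \<and> (\<forall>n y. y \<in> {a..b} \<and> norm (x - y) < d \<longrightarrow> norm (F n x - F n y) < e)"
      if x: "x \<in> {a..b}" and e: "0 < e" for x e
    proof (intro exI[of _ "(e / (M + 1))\<^sup>2"] conjI allI impI)
      show "0 < (e / (M + 1))\<^sup>2" using e M0 by simp
      fix n y assume y: "y \<in> {a..b} \<and> norm (x - y) < (e / (M + 1))\<^sup>2"
      have "norm (F n x - F n y) \<le> sqrt \<bar>x - y\<bar> * L2_norm a b (weak_deriv a b (X n))"
        using point_val_Hoelder[OF ab X, of x y n] point_val_Hoelder[OF ab X, of y x n] x y
        by (cases "x \<le> y") (auto simp: F_def norm_minus_commute)
      also have "\<dots> \<le> sqrt \<bar>x - y\<bar> * (M + 1)" using M'(1)[of n] by (intro mult_left_mono) auto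
      also have "\<dots> < sqrt ((e / (M + 1))\<^sup>2) * (M + 1)"
        using y M0 by (intro mult_strict_right_mono real_sqrt_less_mono) auto
      also have "\<dots> = e" using e M0 by simp
      finally show "norm (F n x - F n y) < e" .
    qed
  qed (auto intro: that)
  have "form_Cauchy (L2_inner a b) (X \<circ> k)"
    unfolding form_Cauchy_def
  proof (intro allI impI)
    fix e :: real assume e: "e > 0"
    define s where "s = sqrt (b - a)"
    have s: "s > 0" using ab by (simp add: s_def)
    \<comment> \<open>Two values within \<open>e / (4 * s)\<close> of the limit differ by at most
      \<open>e / (2 * s)\<close>; the factor \<open>s\<close> from the length of the interval leaves
      \<open>e / 2\<close>.\<close>
    obtain N where N: "\<And>n x. n \<ge> N \<Longrightarrow> x \<in> {a..b} \<Longrightarrow> norm (F (k n) x - g x) < e / (4 * s)"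
      using k(2)[of "e / (4 * s)"] e s by (auto simp del: norm_conv_dist)
    show "\<exists>N. \<forall>m\<ge>N. \<forall>n\<ge>N. form_norm (L2_inner a b) ((X \<circ> k) m - (X \<circ> k) n) < e"
    proof (intro exI[of _ N] allI impI)
      fix m n assume mn: "N \<le> m" "N \<le> n"
      have "L2_norm a b (X (k m) - X (k n)) \<le> sqrt (b - a) * (e / (2 * s))"
      proof (rule L2_norm_le_bound[OF ab])
        show "X (k m) - X (k n) \<in> L2 a b" using Sob1_L2(1)[OF X] by (simp add: L2.S_closed)
        show "agrees_on a b (X (k m) - X (k n)) (\<lambda>x. F (k m) x - F (k n) x)"
          using agrees_on_point_val[OF ab X[of "k m"]] agrees_on_point_val[OF ab X[of "k n"]]
            rep_aefun_minus[of "X (k m)" "X (k n)"]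
          unfolding agrees_on_iff F_def by eventually_elim auto
        show "cmod (F (k m) x - F (k n) x) \<le> e / (2 * s)" if x: "x \<in> {a..b}" for x
          using norm_triangle_ineq4[of "F (k m) x - g x" "F (k n) x - g x"] N[OF mn(1) x] N[OF mn(2) x]
          by simp
      qed (use e s in auto)
      also have "\<dots> < e" using e s by (simp add: s_def[symmetric])
      finally show "form_norm (L2_inner a b) ((X \<circ> k) m - (X \<circ> k) n) < e" by (simp add: L2_norm_form_norm)
    qed
  qed
  then show thesis using that k(1) by blast
qed

text \<open>One common subsequence for finitely many sequences on possibly different intervals, by
  successive extraction; all components of the solutions are treated with it at once.\<close>

lemma H1_compact_list:
  assumes "\<And>a b X. (a, b, X) \<in> set Q \<Longrightarrow> a < b \<and> (\<forall>n. X n \<in> Sob 1 a b) \<and> (\<exists>M. \<forall>n. form_norm (h1_inner a b) (X n) \<le> M)"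
  shows "\<exists>r. strict_mono (r :: nat \<Rightarrow> nat) \<and> (\<forall>(a, b, X) \<in> set Q. form_Cauchy (L2_inner a b) (X \<circ> r))"
  using assms
proof (induction Q)
  case Nil
  then show ?case by (auto intro: strict_mono_id)
next
  case (Cons q Q)
  obtain a b X where q: "q = (a, b, X)" by (cases q)
  obtain r where r: "strict_mono r" "\<forall>(a, b, X) \<in> set Q. form_Cauchy (L2_inner a b) (X \<circ> r)"
    using Cons.IH Cons.prems by (metis list.set_intros(2))
  have X: "a < b" "\<And>n. X n \<in> Sob 1 a b" "\<exists>M. \<forall>n. form_norm (h1_inner a b) (X n) \<le> M"
    using Cons.prems[of a b X] q by auto
  then obtain M where M: "\<And>n. form_norm (h1_inner a b) (X n) \<le> M" by blast
  obtain s where s: "strict_mono s" "form_Cauchy (L2_inner a b) ((X \<circ> r) \<circ> s)"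
    using H1_compact[of a b "X \<circ> r" M] X M by auto
  have "form_Cauchy (L2_inner c d) ((Y \<circ> r) \<circ> s)" if "(c, d, Y) \<in> set Q" for c d Y
    using r(2) that form_Cauchy_subseq[OF _ s(1)] by blast
  then have "\<forall>(a, b, X) \<in> set (q # Q). form_Cauchy (L2_inner a b) (X \<circ> (r \<circ> s))"
    using s(2) q by (auto simp: o_assoc)
  then show ?case using strict_mono_o[OF r(1) s(1)] by blast
qed

declare Sob.simps [simp del] One_nat_def [simp del]

section \<open>Gluing and cutting at an interior point of an interval\<close>

lemma L2_mono: "f \<in> L2 c d \<Longrightarrow> a \<le> c \<Longrightarrow> d \<le> b \<Longrightarrow> f \<in> L2 a b"
  unfolding L2_iff by (auto elim!: eventually_mono)

lemma L2_inner_enlarge: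
  assumes "f \<in> L2 c d" "a \<le> c" "d \<le> b"
  shows "L2_inner a b f g = L2_inner c d f g"
  using L2_inner_eq[OF assms(1)] L2_inner_eq[OF L2_mono[OF assms]] by simp

lemma L2_inner_disjoint:
  assumes "f \<in> L2 a b" "g \<in> L2 c d" "b \<le> c \<or> d \<le> a"
  shows "L2_inner a b f g = 0"
  unfolding L2_inner_eq[OF assms(1)]
proof (rule integral_eq_zero_AE)
  show "AE x in lborel. rep_aefun f x * cnj (rep_aefun g x) = 0"
    using L2_D(1)[OF assms(1)] L2_D(1)[OF assms(2)] by eventually_elim (use assms(3) in force)
qed

text \<open>Extensions by zero from the two sides have disjoint supports, so the cross terms
  vanish.\<close>

lemma L2_inner_glue:
  assumes "a < m" "m < b" "f \<in> L2 a m" "f' \<in> L2 a m" "g \<in> L2 m b" "g' \<in> L2 m b"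
  shows "L2_inner a b (f + g) (f' + g') = L2_inner a m f f' + L2_inner m b g g'"
proof -
  have L: "f \<in> L2 a b" "f' \<in> L2 a b" "g \<in> L2 a b" "g' \<in> L2 a b"
    using assms L2_mono[of _ a m a b] L2_mono[of _ m b a b] by auto
  have "L2_inner a b f g' = 0" "L2_inner a b g f' = 0"
    using assms L2_inner_enlarge[of f a m a b g'] L2_inner_enlarge[of g m b a b f']
      L2_inner_disjoint[of f a m g' m b] L2_inner_disjoint[of g m b f' a m] by auto
  then show ?thesis
    using L assms L2_inner_enlarge[of f a m a b f'] L2_inner_enlarge[of g m b a b g']
    by (simp add: L2.ip_simps L2.S_closed)
qed

lemma prim_rep_plus:
  assumes "p \<in> L2 a b" "q \<in> L2 c d"
  shows "prim (rep_aefun (p + q)) x = prim (rep_aefun p) x + prim (rep_aefun q) x"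
proof -
  have "prim (rep_aefun (p + q)) x = prim (\<lambda>x. rep_aefun p x + rep_aefun q x) x"
    by (rule prim_cong_AE) (use rep_aefun_plus in auto)
  then show ?thesis using assms by (simp add: prim_add L2_integrable)
qed

text \<open>Left of \<open>m\<close> the primitive of \<open>q\<close> is still zero; right of
  \<open>m\<close> the primitive of \<open>p\<close> has reached its total, the increment of
  \<open>f\<close>. Equality of the values at \<open>m\<close> makes the two formulas one.\<close>

lemma glue_agrees_on:
  assumes am: "a < m" and mb: "m < b" and f: "has_weak_deriv a m f p" and g: "has_weak_deriv m b g q"
    and eq: "point_val a m f m = point_val m b g m"
  shows "agrees_on a b (f + g) (\<lambda>x. point_val a m f a + prim (rep_aefun (p + q)) x)"
    and "point_val m b g m = point_val a m f a + integral\<^sup>L lborel (rep_aefun p)"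
proof -
  have L: "f \<in> L2 a m" "p \<in> L2 a m" "g \<in> L2 m b" "q \<in> L2 m b"
    using f g by (auto simp: has_weak_deriv_def)
  show m: "point_val m b g m = point_val a m f a + integral\<^sup>L lborel (rep_aefun p)"
    using point_val_weak_deriv(1)[OF am f, of m] prim_L2_right[OF L(2), of m] am eq by simp
  show "agrees_on a b (f + g) (\<lambda>x. point_val a m f a + prim (rep_aefun (p + q)) x)"
    unfolding agrees_on_iff prim_rep_plus[OF L(2,4)]
    using rep_aefun_plus[of f g] L2_D(1)[OF L(1)] L2_D(1)[OF L(3)] AE_lborel_singleton[of m]
      point_val_weak_deriv(2)[OF am f, unfolded agrees_on_iff]
      point_val_weak_deriv(2)[OF mb g, unfolded agrees_on_iff]
  proof eventually_elim
    case (elim x)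
    show ?case
    proof (intro impI)
      assume x: "x \<in> {a<..<b}"
      show "rep_aefun (f + g) x = point_val a m f a + (prim (rep_aefun p) x + prim (rep_aefun q) x)"
      proof (cases "x < m")
        case True
        then show ?thesis using elim x prim_L2_left[OF L(4), of x] by auto
      next
        case False
        then show ?thesis using elim x prim_L2_right[OF L(2), of x] m by auto
      qed
    qed
  qed
qed

lemma glue_weak_deriv:
  assumes am: "a < m" and mb: "m < b" and f: "has_weak_deriv a m f p" and g: "has_weak_deriv m b g q"
    and eq: "point_val a m f m = point_val m b g m"
  shows "has_weak_deriv a b (f + g) (p + q)"
    and "point_val a b (f + g) a = point_val a m f a" "point_val a b (f + g) b = point_val m b g b"
proof -
  have L: "f \<in> L2 a m" "p \<in> L2 a m" "g \<in> L2 m b" "q \<in> L2 m b"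
    using f g by (auto simp: has_weak_deriv_def)
  have L': "f + g \<in> L2 a b" "p + q \<in> L2 a b"
    using L am mb L2_mono[of _ a m a b] L2_mono[of _ m b a b] by (auto simp: L2.S_closed)
  note agr = glue_agrees_on[OF am mb f g eq]
  show "has_weak_deriv a b (f + g) (p + q)" by (rule has_weak_deriv_primI[OF L' agr(1)])
  have pv: "point_val a b (f + g) x = point_val a m f a + (prim (rep_aefun p) x + prim (rep_aefun q) x)"
    if "x \<in> {a..b}" for x
    using am mb that continuous_on_prim[OF L(2)] continuous_on_prim[OF L(4)] prim_rep_plus[OF L(2,4)]
    by (subst point_val_eqI[OF _ _ agr(1)]) (auto intro!: continuous_on_add continuous_on_const)
  show "point_val a b (f + g) a = point_val a m f a"
    using pv[of a] am mb prim_L2_left[OF L(2), of a] prim_L2_left[OF L(4), of a] by simp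
  show "point_val a b (f + g) b = point_val m b g b"
    using pv[of b] am mb prim_L2_right[OF L(2), of b] agr(2) point_val_weak_deriv(1)[OF mb g, of b] by simp
qed

lemma L2_split:
  assumes "a < m" "m < b" and G: "G \<in> L2 a b"
  obtains f g where "f \<in> L2 a m" "g \<in> L2 m b" "G = f + g"
proof -
  define f where "f x = indicator {a<..<m} x *\<^sub>R rep_aefun G x" for x
  define g where "g x = indicator {m<..<b} x *\<^sub>R rep_aefun G x" for x
  have [measurable]: "f \<in> borel_measurable borel" "g \<in> borel_measurable borel"
    by (simp_all add: f_def[abs_def] g_def[abs_def])
  have "abs_aefun f \<in> L2 a m"
    by (rule abs_aefun_L2) (auto simp: f_def indicator_def intro!: Bochner_Integration.integrable_bound[OF L2_D(2)[OF G]])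
  moreover have "abs_aefun g \<in> L2 m b"
    by (rule abs_aefun_L2) (auto simp: g_def indicator_def intro!: Bochner_Integration.integrable_bound[OF L2_D(2)[OF G]])
  moreover have "G = abs_aefun f + abs_aefun g"
  proof (rule rep_aefun_eqI)
    show "AE x in lborel. rep_aefun G x = rep_aefun (abs_aefun f + abs_aefun g) x"
      using rep_abs_aefun[OF \<open>f \<in> borel_measurable borel\<close>] rep_abs_aefun[OF \<open>g \<in> borel_measurable borel\<close>]
        rep_aefun_plus[of "abs_aefun f" "abs_aefun g"] L2_D(1)[OF G] AE_lborel_singleton[of m]
      by eventually_elim (use assms in \<open>auto simp: f_def g_def indicator_def\<close>)
  qed
  ultimately show thesis by (rule that)
qed

lemma L2_zero_of_test:
  assumes r: "r \<in> L2 a b" and z: "\<And>\<phi>. test_function a b \<phi> \<Longrightarrow> L2_inner a b r (restr a b \<phi>) = 0"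
  shows "r = 0"
proof -
  have "AE x in lborel. x \<in> {a<..<b} \<longrightarrow> rep_aefun r x = 0"
  proof (rule fundamental_lemma[OF L2_integrable(1)[OF r]])
    fix \<psi> assume "test_function a b \<psi>"
    note t = test_function_cnj(1)[OF this]
    show "(LINT x|lborel. rep_aefun r x * \<psi> x) = 0"
      using z[OF t] L2_inner_restr[OF r test_function_continuous(1)[OF t]] by simp
  qed
  then have "AE x in lborel. rep_aefun r x = rep_aefun 0 x"
    using L2_D(1)[OF r] rep_aefun_zero by eventually_elim auto
  then show ?thesis by (rule rep_aefun_eqI)
qed

text \<open>A function in H^1 of the whole interval has a representative that is continuous at
  \<open>m\<close>. For the weighted second derivatives the third conclusion is the transmission
  condition.\<close>

lemma unglue_weak_deriv:
  assumes am: "a < m" and mb: "m < b" and L: "f \<in> L2 a m" "p \<in> L2 a m" "g \<in> L2 m b" "q \<in> L2 m b"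
    and fg: "has_weak_deriv a b (f + g) (p + q)"
  shows "has_weak_deriv a m f p" "has_weak_deriv m b g q" "point_val a m f m = point_val m b g m"
proof -
  obtain c where c: "agrees_on a b (f + g) (\<lambda>x. c + prim (rep_aefun (p + q)) x)"
    using has_weak_deriv_primE[OF _ fg] am mb by auto
  define I where "I = integral\<^sup>L lborel (rep_aefun p)"
  have 1: "agrees_on a m f (\<lambda>x. c + prim (rep_aefun p) x)"
    unfolding agrees_on_iff
    using rep_aefun_plus[of f g] L2_D(1)[OF L(3)] c[unfolded agrees_on_iff prim_rep_plus[OF L(2,4)]]
    by eventually_elim (use mb prim_L2_left[OF L(4)] in auto)
  have 2: "agrees_on m b g (\<lambda>x. (c + I) + prim (rep_aefun q) x)"
    unfolding agrees_on_iff
    using rep_aefun_plus[of f g] L2_D(1)[OF L(1)] c[unfolded agrees_on_iff prim_rep_plus[OF L(2,4)]]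
    by eventually_elim (use am prim_L2_right[OF L(2)] in \<open>auto simp: I_def\<close>)
  show "has_weak_deriv a m f p" by (rule has_weak_deriv_primI[OF L(1,2) 1])
  show "has_weak_deriv m b g q" by (rule has_weak_deriv_primI[OF L(3,4) 2])
  have "point_val a m f m = c + prim (rep_aefun p) m"
    by (rule point_val_eqI[OF am _ 1]) (use am in \<open>auto intro!: continuous_intros continuous_on_prim[OF L(2)]\<close>)
  moreover have "point_val m b g m = (c + I) + prim (rep_aefun q) m"
    by (rule point_val_eqI[OF mb _ 2]) (use mb in \<open>auto intro!: continuous_intros continuous_on_prim[OF L(4)]\<close>)
  ultimately show "point_val a m f m = point_val m b g m"
    using prim_L2_left[OF L(4), of m] prim_L2_right[OF L(2), of m] by (simp add: I_def)
qed

section \<open>The spaces and forms of the beam problem\<close>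

lemma clin_comp: "clinear_on S T f \<Longrightarrow> clinear_on T U g \<Longrightarrow> clinear_on S U (\<lambda>x. g (f x))"
  unfolding clinear_on_def by auto

lemma clin_weak: "clinear_on S T f \<Longrightarrow> T \<subseteq> U \<Longrightarrow> clinear_on S U f"
  unfolding clinear_on_def by auto

lemma Sob1_sub_L2: "Sob 1 a b \<subseteq> L2 a b"
  using Sob1_L2(1) by blast

locale beam =
  fixes P :: beam_params
  assumes len0_pos: "0 < len0 P" and len0_less: "len0 P < len P"
    and pos: "rho0 P > 0" "rho1 P > 0" "rho2 P > 0" "alpha1 P > 0" "alpha2 P > 0"
      "beta1 P > 0" "beta2 P > 0" "kappa P > 0"
begin

abbreviation "n0 \<equiv> L2_norm 0 (len0 P)"
abbreviation "n1 \<equiv> L2_norm (len0 P) (len P)"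
abbreviation "h0 \<equiv> form_norm (h1_inner 0 (len0 P))"
abbreviation "h1 \<equiv> form_norm (h1_inner (len0 P) (len P))"

section \<open>Membership in the spaces, their subspace properties, and linear maps on them\<close>

lemma V1_iff: "(u, y) \<in> V1 P \<longleftrightarrow> u \<in> Sob 1 0 (len0 P) \<and> y \<in> Sob 1 (len0 P) (len P) \<and>
    val0 P u 0 = 0 \<and> val1 P y (len P) = 0 \<and> val0 P u (len0 P) = val1 P y (len0 P)"
  by (simp add: V1_def)

text \<open>The end and interface conditions on the first derivatives are those of \<open>V1\<close>
  once more. Subspace and closedness properties of \<open>W1\<close> thus follow from those of
  \<open>V1\<close>.\<close>

lemma W1_iff: "(u, y) \<in> W1 P \<longleftrightarrow> (u, y) \<in> V1 P \<and> (Dx0 P u, Dx1 P y) \<in> V1 P"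
  by (auto simp: W1_def V1_def Sob2_iff)

lemma V2_iff: "(u, y, \<theta>) \<in> V2 P \<longleftrightarrow> (u, y) \<in> V1 P \<and> \<theta> \<in> L2 0 (len0 P)"
  by (simp add: V2_def)

lemma W2_iff: "(u, y, \<theta>) \<in> W2 P \<longleftrightarrow> (u, y) \<in> W1 P \<and> \<theta> \<in> H10 0 (len0 P)"
  by (simp add: W2_def)

lemma W1_V1: "Z \<in> W1 P \<Longrightarrow> Z \<in> V1 P"
  by (cases Z) (simp add: W1_iff)

lemma W2_V2: "U \<in> W2 P \<Longrightarrow> U \<in> V2 P"
  by (cases U) (auto simp: W2_iff V2_iff W1_iff dest!: H10_Sob1 intro: Sob1_L2)

lemma V1_D:
  assumes "(u, y) \<in> V1 P"
  shows "u \<in> Sob 1 0 (len0 P)" "y \<in> Sob 1 (len0 P) (len P)" "u \<in> L2 0 (len0 P)" "y \<in> L2 (len0 P) (len P)"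
    "Dx0 P u \<in> L2 0 (len0 P)" "Dx1 P y \<in> L2 (len0 P) (len P)"
  using assms Sob1_L2 by (auto simp: V1_iff)

lemma W1_D:
  assumes "(u, y) \<in> W1 P"
  shows "Dx0 P u \<in> Sob 1 0 (len0 P)" "Dx1 P y \<in> Sob 1 (len0 P) (len P)"
    "Dx0 P (Dx0 P u) \<in> L2 0 (len0 P)" "Dx1 P (Dx1 P y) \<in> L2 (len0 P) (len P)"
  using assms V1_D by (auto simp: W1_iff)

lemma csub_V1: "csubspace (V1 P)"
proof (rule csubI)
  show "0 \<in> V1 P"
    using len0_pos len0_less by (simp add: zero_prod_def V1_iff point_val_zero h1.S_closed)
  show "Z + Z' \<in> V1 P" if "Z \<in> V1 P" "Z' \<in> V1 P" for Z Z'
    using that len0_pos len0_less by (cases Z; cases Z') (auto simp: V1_iff point_val_add h1.S_closed)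
  show "k *\<^sub>C Z \<in> V1 P" if "Z \<in> V1 P" for k Z
    using that len0_pos len0_less by (cases Z) (auto simp: V1_iff scaleC_prod_def point_val_scaleC h1.S_closed)
qed

lemma csub_W1: "csubspace (W1 P)"
proof (rule csubI)
  show "0 \<in> W1 P"
    using csub_zero[OF csub_V1] by (simp add: zero_prod_def W1_iff weak_deriv_zero)
  show "Z + Z' \<in> W1 P" if "Z \<in> W1 P" "Z' \<in> W1 P" for Z Z'
  proof (cases Z; cases Z')
    fix u y u' y' assume Z: "Z = (u, y)" "Z' = (u', y')"
    have V: "(u, y) \<in> V1 P" "(u', y') \<in> V1 P" "(Dx0 P u, Dx1 P y) \<in> V1 P" "(Dx0 P u', Dx1 P y') \<in> V1 P"
      using that Z by (auto simp: W1_iff)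
    show ?thesis
      using csub_add[OF csub_V1 V(1,2)] csub_add[OF csub_V1 V(3,4)] V1_D[OF V(1)] V1_D[OF V(2)]
      by (simp add: Z W1_iff weak_deriv_add)
  qed
  show "k *\<^sub>C Z \<in> W1 P" if "Z \<in> W1 P" for k Z
  proof (cases Z)
    fix u y assume Z: "Z = (u, y)"
    have V: "(u, y) \<in> V1 P" "(Dx0 P u, Dx1 P y) \<in> V1 P" using that Z by (auto simp: W1_iff)
    show ?thesis
      using csub_scaleC[OF csub_V1 V(1), of k] csub_scaleC[OF csub_V1 V(2), of k] V1_D[OF V(1)]
      by (simp add: Z W1_iff weak_deriv_scaleC scaleC_prod_def)
  qed
qed

lemma csub_prod:
  assumes "csubspace S" "csubspace T"
  shows "csubspace (S \<times> T)"
  using assms by (auto simp: csubspace_def zero_prod_def scaleC_prod_def)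

lemma V2_alt: "V2 P = {U. (fst U, fst (snd U)) \<in> V1 P \<and> snd (snd U) \<in> L2 0 (len0 P)}"
  by (auto simp: V2_def)

lemma W2_alt: "W2 P = {U. (fst U, fst (snd U)) \<in> W1 P \<and> snd (snd U) \<in> H10 0 (len0 P)}"
  by (auto simp: W2_def)

lemma csub_assoc:
  fixes S :: "('a::complex_vec \<times> 'b::complex_vec) set" and T :: "'c::complex_vec set"
  assumes "csubspace S" "csubspace T"
  shows "csubspace {U :: 'a \<times> 'b \<times> 'c. (fst U, fst (snd U)) \<in> S \<and> snd (snd U) \<in> T}"
proof (rule csubI)
  show "0 \<in> {U :: 'a \<times> 'b \<times> 'c. (fst U, fst (snd U)) \<in> S \<and> snd (snd U) \<in> T}"
    using csub_zero[OF assms(1)] csub_zero[OF assms(2)] by (simp add: zero_prod_def)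
  show "U + U' \<in> {U. (fst U, fst (snd U)) \<in> S \<and> snd (snd U) \<in> T}"
    if "U \<in> {U. (fst U, fst (snd U)) \<in> S \<and> snd (snd U) \<in> T}"
      "U' \<in> {U. (fst U, fst (snd U)) \<in> S \<and> snd (snd U) \<in> T}" for U U' :: "'a \<times> 'b \<times> 'c"
    using that csub_add[OF assms(1), of "(fst U, fst (snd U))" "(fst U', fst (snd U'))"]
      csub_add[OF assms(2)] by simp
  show "k *\<^sub>C U \<in> {U. (fst U, fst (snd U)) \<in> S \<and> snd (snd U) \<in> T}"
    if "U \<in> {U. (fst U, fst (snd U)) \<in> S \<and> snd (snd U) \<in> T}" for k and U :: "'a \<times> 'b \<times> 'c"
    using that csub_scaleC[OF assms(1), of "(fst U, fst (snd U))"] csub_scaleC[OF assms(2)]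
    by (simp add: scaleC_prod_def)
qed

lemma csub_V2: "csubspace (V2 P)"
  unfolding V2_alt by (rule csub_assoc[OF csub_V1 csub_L2])

lemma csub_W2: "csubspace (W2 P)"
  unfolding W2_alt by (rule csub_assoc[OF csub_W1 csub_H10])

lemma clin_V2:
  "clinear_on (V2 P) (Sob 1 0 (len0 P)) fst"
  "clinear_on (V2 P) (Sob 1 (len0 P) (len P)) (\<lambda>U. fst (snd U))"
  "clinear_on (V2 P) (L2 0 (len0 P)) (\<lambda>U. snd (snd U))"
  unfolding clinear_on_def by (auto simp: V2_def V1_iff scaleC_prod_def)

lemma clin_V2_L2:
  "clinear_on (V2 P) (L2 0 (len0 P)) fst"
  "clinear_on (V2 P) (L2 (len0 P) (len P)) (\<lambda>U. fst (snd U))"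
  "clinear_on (V2 P) (L2 0 (len0 P)) (\<lambda>U. Dx0 P (fst U))"
  "clinear_on (V2 P) (L2 (len0 P) (len P)) (\<lambda>U. Dx1 P (fst (snd U)))"
  using clin_weak[OF clin_V2(1) Sob1_sub_L2] clin_weak[OF clin_V2(2) Sob1_sub_L2]
    clin_comp[OF clin_V2(1) clin_weak_deriv] clin_comp[OF clin_V2(2) clin_weak_deriv] by auto

lemma clin_W1:
  "clinear_on (W1 P) (L2 0 (len0 P)) (\<lambda>Z. Dx0 P (Dx0 P (fst Z)))"
  "clinear_on (W1 P) (L2 (len0 P) (len P)) (\<lambda>Z. Dx1 P (Dx1 P (snd Z)))"
proof -
  have 1: "clinear_on (W1 P) (Sob 1 0 (len0 P)) (\<lambda>Z. Dx0 P (fst Z))"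
    unfolding clinear_on_def by (auto simp: W1_iff V1_iff scaleC_prod_def weak_deriv_add weak_deriv_scaleC)
  have 2: "clinear_on (W1 P) (Sob 1 (len0 P) (len P)) (\<lambda>Z. Dx1 P (snd Z))"
    unfolding clinear_on_def by (auto simp: W1_iff V1_iff scaleC_prod_def weak_deriv_add weak_deriv_scaleC)
  show "clinear_on (W1 P) (L2 0 (len0 P)) (\<lambda>Z. Dx0 P (Dx0 P (fst Z)))"
    "clinear_on (W1 P) (L2 (len0 P) (len P)) (\<lambda>Z. Dx1 P (Dx1 P (snd Z)))"
    using clin_comp[OF 1 clin_weak_deriv] clin_comp[OF 2 clin_weak_deriv] by auto
qed

lemma clin_W2_W1: "clinear_on (W2 P) (W1 P) (\<lambda>U. (fst U, fst (snd U)))"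
  unfolding clinear_on_def by (auto simp: W2_def scaleC_prod_def)

lemma clin_W2_V2: "clinear_on (W2 P) (V2 P) (\<lambda>U. U)"
  unfolding clinear_on_def using W2_V2 by auto

lemma clin_W2_L2:
  "clinear_on (W2 P) (L2 0 (len0 P)) (\<lambda>U. Dx0 P (fst U))"
  "clinear_on (W2 P) (L2 0 (len0 P)) (\<lambda>U. Dx0 P (snd (snd U)))"
proof -
  have "clinear_on (W2 P) (Sob 1 0 (len0 P)) (\<lambda>U. snd (snd U))"
    unfolding clinear_on_def by (auto simp: W2_def scaleC_prod_def dest: H10_Sob1)
  then show "clinear_on (W2 P) (L2 0 (len0 P)) (\<lambda>U. Dx0 P (snd (snd U)))"
    by (rule clin_comp[OF _ clin_weak_deriv])
  show "clinear_on (W2 P) (L2 0 (len0 P)) (\<lambda>U. Dx0 P (fst U))"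
    using clin_comp[OF clin_W2_V2 clin_V2_L2(3)] .
qed

text \<open>An inner product on \<open>W2 P\<close> whose quadratic form is the real part of that of \<open>c + b + a\<close>.\<close>

definition form_w :: "triple \<Rightarrow> triple \<Rightarrow> complex" where
  "form_w U U' = form_c P U U' + form_a P (fst U, fst (snd U)) (fst U', fst (snd U'))
     + of_real (kappa P) * inner0 P (Dx0 P (snd (snd U))) (Dx0 P (snd (snd U')))"

section \<open>Sesquilinearity and diagonal values of the forms\<close>

lemma sesq_form_c: "sesquilinear_on (V2 P) (form_c P)"
proof -
  have "form_c P = (\<lambda>U U'. of_real (rho1 P) * inner0 P (fst U) (fst U')
    + of_real (alpha1 P) * inner0 P (Dx0 P (fst U)) (Dx0 P (fst U'))
    + of_real (rho2 P) * inner1 P (fst (snd U)) (fst (snd U'))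
    + of_real (alpha2 P) * inner1 P (Dx1 P (fst (snd U))) (Dx1 P (fst (snd U')))
    + of_real (rho0 P) * inner0 P (snd (snd U)) (snd (snd U')))"
    by (auto simp: fun_eq_iff)
  then show ?thesis
    by (simp only:) (intro sesq_plus sesq_mult sesq_pullback[OF _ _ sesq_L2_inner] clin_V2_L2 clin_V2(3))
qed

lemma sesq_form_a: "sesquilinear_on (W1 P) (form_a P)"
proof -
  have "form_a P = (\<lambda>U U'. of_real (beta1 P) * inner0 P (Dx0 P (Dx0 P (fst U))) (Dx0 P (Dx0 P (fst U')))
    + of_real (beta2 P) * inner1 P (Dx1 P (Dx1 P (snd U))) (Dx1 P (Dx1 P (snd U'))))"
    by (auto simp: fun_eq_iff)
  then show ?thesis
    by (simp only:) (intro sesq_plus sesq_mult sesq_pullback[OF _ _ sesq_L2_inner] clin_W1)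
qed

lemma sesq_form_b: "sesquilinear_on (W2 P) (form_b P)"
proof -
  have "form_b P = (\<lambda>U U'. of_real (gamma P) * (inner0 P (Dx0 P (fst U)) (Dx0 P (snd (snd U')))
      - inner0 P (Dx0 P (snd (snd U))) (Dx0 P (fst U')))
    + of_real (kappa P) * inner0 P (Dx0 P (snd (snd U))) (Dx0 P (snd (snd U'))))"
    by (auto simp: fun_eq_iff)
  then show ?thesis
    by (simp only:) (intro sesq_plus sesq_minus sesq_mult sesq_pullback[OF _ _ sesq_L2_inner] clin_W2_L2)
qed

lemma sesq_form_w: "sesquilinear_on (W2 P) form_w"
  unfolding form_w_def[abs_def]
  by (intro sesq_plus sesq_mult sesq_pullback[OF clin_W2_W1 clin_W2_W1 sesq_form_a]
      sesq_pullback[OF clin_W2_V2 clin_W2_V2 sesq_form_c] sesq_pullback[OF _ _ sesq_L2_inner] clin_W2_L2)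

lemma inner_self:
  "f \<in> L2 a b \<Longrightarrow> L2_inner a b f f = of_real ((L2_norm a b f)\<^sup>2)"
  using L2.ip_self by (simp add: L2_norm_form_norm)

lemma Re_form_c:
  assumes "(u, y, \<theta>) \<in> V2 P"
  shows "form_c P (u, y, \<theta>) (u, y, \<theta>) = of_real (rho1 P * (n0 u)\<^sup>2 + alpha1 P * (n0 (Dx0 P u))\<^sup>2
     + rho2 P * (n1 y)\<^sup>2 + alpha2 P * (n1 (Dx1 P y))\<^sup>2 + rho0 P * (n0 \<theta>)\<^sup>2)"
  using assms V1_D[of u y] by (simp add: V2_iff inner_self)

lemma Re_form_a:
  assumes "(u, y) \<in> W1 P"
  shows "form_a P (u, y) (u, y) = of_real (beta1 P * (n0 (Dx0 P (Dx0 P u)))\<^sup>2 + beta2 P * (n1 (Dx1 P (Dx1 P y)))\<^sup>2)"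
  using W1_D[OF assms] by (simp add: inner_self)

lemma Re_form_w:
  assumes "(u, y, \<theta>) \<in> W2 P"
  shows "form_w (u, y, \<theta>) (u, y, \<theta>) = form_c P (u, y, \<theta>) (u, y, \<theta>) + form_a P (u, y) (u, y)
     + of_real (kappa P * (n0 (Dx0 P \<theta>))\<^sup>2)"
  using assms H10_Sob1[of \<theta>] Sob1_L2(2)[of \<theta>] by (simp add: form_w_def W2_iff inner_self)

lemma V_semi_inner: "semi_inner (V2 P) (form_c P)"
proof
  show "cnj (form_c P U V) = form_c P V U" if "U \<in> V2 P" "V \<in> V2 P" for U V
    using that V1_D[of "fst U" "fst (snd U)"] V1_D[of "fst V" "fst (snd V)"]
    by (cases U; cases V) (simp add: V2_iff L2.cnj_ip)
  show "0 \<le> Re (form_c P U U)" if "U \<in> V2 P" for U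
    using that pos by (cases U) (simp only: Re_form_c, simp)
qed (rule csub_V2 sesq_form_c)+

lemma A_semi_inner: "semi_inner (W1 P) (form_a P)"
proof
  show "cnj (form_a P U V) = form_a P V U" if "U \<in> W1 P" "V \<in> W1 P" for U V
    using that W1_D[of "fst U" "snd U"] W1_D[of "fst V" "snd V"]
    by (cases U; cases V) (simp add: L2.cnj_ip)
  show "0 \<le> Re (form_a P U U)" if "U \<in> W1 P" for U
    using that pos by (cases U) (simp only: Re_form_a, simp)
qed (rule csub_W1 sesq_form_a)+

lemma W_semi_inner: "semi_inner (W2 P) form_w"
proof
  interpret V: semi_inner "V2 P" "form_c P" by (rule V_semi_inner)
  interpret A: semi_inner "W1 P" "form_a P" by (rule A_semi_inner)
  show "cnj (form_w U V) = form_w V U" if "U \<in> W2 P" "V \<in> W2 P" for U V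
    using that W2_V2[OF that(1)] W2_V2[OF that(2)] V.cnj_ip[of U V] A.cnj_ip
      Sob1_L2(2)[OF H10_Sob1[of "snd (snd U)"]] Sob1_L2(2)[OF H10_Sob1[of "snd (snd V)"]]
    by (cases U; cases V) (simp add: form_w_def W2_iff L2.cnj_ip del: form_c.simps form_a.simps)
  show "0 \<le> Re (form_w U U)" if "U \<in> W2 P" for U
    using that pos V.Re_ip_nonneg[OF W2_V2[OF that]] A.Re_ip_nonneg[of "(fst U, fst (snd U))"]
    by (cases U) (simp add: Re_form_w W2_iff del: form_c.simps form_a.simps)
qed (rule csub_W2 sesq_form_w)+

end

lemma tendsto_zero_le:
  fixes f g :: "nat \<Rightarrow> real"
  assumes "g \<longlonglongrightarrow> 0" "\<And>n. 0 \<le> f n" "\<And>n. f n \<le> C * g n"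
  shows "f \<longlonglongrightarrow> 0"
proof (rule tendsto_sandwich[OF _ _ tendsto_const])
  show "(\<lambda>n. C * g n) \<longlonglongrightarrow> 0" using tendsto_mult_left[OF assms(1), of C] by simp
qed (use assms in auto)

context beam
begin

sublocale V: semi_inner "V2 P" "form_c P" by (rule V_semi_inner)
sublocale A: semi_inner "W1 P" "form_a P" by (rule A_semi_inner)
sublocale W: semi_inner "W2 P" form_w by (rule W_semi_inner)

abbreviation "nV \<equiv> form_norm (form_c P)"
abbreviation "nA \<equiv> form_norm (form_a P)"
abbreviation "nW \<equiv> form_norm form_w"

text \<open>One lower and one upper bound for all coefficients, so that norms compare with the
  unweighted ones by the factors \<open>sqrt (1 / kmin)\<close> and \<open>sqrt kmax\<close>
  only.\<close>

definition "kmin = Min {rho0 P, rho1 P, rho2 P, alpha1 P, alpha2 P, beta1 P, beta2 P, kappa P}"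
definition "kmax = rho0 P + rho1 P + rho2 P + alpha1 P + alpha2 P + beta1 P + beta2 P + kappa P"

lemma kmin: "0 < kmin" "kmin \<le> rho0 P" "kmin \<le> rho1 P" "kmin \<le> rho2 P" "kmin \<le> alpha1 P"
    "kmin \<le> alpha2 P" "kmin \<le> beta1 P" "kmin \<le> beta2 P" "kmin \<le> kappa P"
  unfolding kmin_def by ((subst Min_gr_iff; use pos in simp) | rule Min_le; simp)+

lemma kmax: "0 \<le> kmax" "rho0 P \<le> kmax" "rho1 P \<le> kmax" "rho2 P \<le> kmax" "alpha1 P \<le> kmax"
    "alpha2 P \<le> kmax" "beta1 P \<le> kmax" "beta2 P \<le> kmax" "kappa P \<le> kmax"
  using pos by (auto simp: kmax_def)

lemma le_of_kmin_square:
  assumes "kmin * x\<^sup>2 \<le> y\<^sup>2" "0 \<le> y"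
  shows "x \<le> sqrt (1 / kmin) * y"
proof (rule power2_le_imp_le)
  show "x\<^sup>2 \<le> (sqrt (1 / kmin) * y)\<^sup>2"
    using assms kmin(1) by (simp add: power_mult_distrib field_simps)
qed (use assms kmin(1) in auto)

lemma h1_sq:
  assumes "f \<in> Sob 1 a b"
  shows "(form_norm (h1_inner a b) f)\<^sup>2 = (L2_norm a b f)\<^sup>2 + (L2_norm a b (weak_deriv a b f))\<^sup>2"
  by (simp add: form_norm_h1[OF assms])

lemma nV_sq:
  assumes "(u, y, \<theta>) \<in> V2 P"
  shows "(nV (u, y, \<theta>))\<^sup>2 = rho1 P * (n0 u)\<^sup>2 + alpha1 P * (n0 (Dx0 P u))\<^sup>2
     + rho2 P * (n1 y)\<^sup>2 + alpha2 P * (n1 (Dx1 P y))\<^sup>2 + rho0 P * (n0 \<theta>)\<^sup>2"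
  by (simp only: V.nrm_sq[OF assms] Re_form_c[OF assms] Re_complex_of_real)

lemma nA_sq:
  assumes "(u, y) \<in> W1 P"
  shows "(nA (u, y))\<^sup>2 = beta1 P * (n0 (Dx0 P (Dx0 P u)))\<^sup>2 + beta2 P * (n1 (Dx1 P (Dx1 P y)))\<^sup>2"
  by (simp only: A.nrm_sq[OF assms] Re_form_a[OF assms] Re_complex_of_real)

lemma nW_sq:
  assumes "(u, y, \<theta>) \<in> W2 P"
  shows "(nW (u, y, \<theta>))\<^sup>2 = (nV (u, y, \<theta>))\<^sup>2 + (nA (u, y))\<^sup>2 + kappa P * (n0 (Dx0 P \<theta>))\<^sup>2"
proof -
  have "(u, y) \<in> W1 P" using assms by (simp add: W2_iff)
  then show ?thesis
    by (simp only: W.nrm_sq[OF assms] Re_form_w[OF assms] plus_complex.simps Re_complex_of_real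
        V.nrm_sq[OF W2_V2[OF assms]] A.nrm_sq)
qed

text \<open>The squared norm of \<open>V2\<close> is a positively weighted sum of the five squares
  in the norm of H^1 x H^1 x L2, so coefficients are compared term by term.\<close>

lemma V_bounds:
  assumes U: "(u, y, \<theta>) \<in> V2 P"
  shows "h0 u \<le> sqrt (1 / kmin) * nV (u, y, \<theta>)" "h1 y \<le> sqrt (1 / kmin) * nV (u, y, \<theta>)"
    "n0 \<theta> \<le> sqrt (1 / kmin) * nV (u, y, \<theta>)"
    "nV (u, y, \<theta>) \<le> sqrt kmax * (h0 u + h1 y + n0 \<theta>)"
proof -
  have S: "u \<in> Sob 1 0 (len0 P)" "y \<in> Sob 1 (len0 P) (len P)" "\<theta> \<in> L2 0 (len0 P)"
    using U V1_D[of u y] by (auto simp: V2_iff)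
  have nn: "0 \<le> h0 u" "0 \<le> h1 y" "0 \<le> n0 \<theta>"
    using h1.nrm_nonneg[OF S(1)] h1.nrm_nonneg[OF S(2)] L2_norm_nonneg[OF S(3)] by auto
  define A where "A = (n0 u)\<^sup>2" define B where "B = (n0 (Dx0 P u))\<^sup>2" define C where "C = (n1 y)\<^sup>2"
  define D where "D = (n1 (Dx1 P y))\<^sup>2" define E where "E = (n0 \<theta>)\<^sup>2"
  have p: "0 \<le> A" "0 \<le> B" "0 \<le> C" "0 \<le> D" "0 \<le> E" by (simp_all add: A_def B_def C_def D_def E_def)
  have sq: "(nV (u, y, \<theta>))\<^sup>2 = rho1 P * A + alpha1 P * B + rho2 P * C + alpha2 P * D + rho0 P * E"
    unfolding nV_sq[OF U] A_def B_def C_def D_def E_def ..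
  have hs: "(h0 u)\<^sup>2 = A + B" "(h1 y)\<^sup>2 = C + D"
    unfolding h1_sq[OF S(1)] h1_sq[OF S(2)] A_def B_def C_def D_def by auto
  note lo = mult_right_mono[OF kmin(3) p(1)] mult_right_mono[OF kmin(5) p(2)]
    mult_right_mono[OF kmin(4) p(3)] mult_right_mono[OF kmin(6) p(4)] mult_right_mono[OF kmin(2) p(5)]
  note hi = mult_right_mono[OF kmax(3) p(1)] mult_right_mono[OF kmax(5) p(2)]
    mult_right_mono[OF kmax(4) p(3)] mult_right_mono[OF kmax(6) p(4)] mult_right_mono[OF kmax(2) p(5)]
  have kp: "0 \<le> kmin * A" "0 \<le> kmin * B" "0 \<le> kmin * C" "0 \<le> kmin * D" "0 \<le> kmin * E"
    using kmin(1) p by auto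
  show "h0 u \<le> sqrt (1 / kmin) * nV (u, y, \<theta>)"
    by (rule le_of_kmin_square[OF _ V.nrm_nonneg[OF U]]) (use lo kp in \<open>simp add: sq hs distrib_left\<close>)
  show "h1 y \<le> sqrt (1 / kmin) * nV (u, y, \<theta>)"
    by (rule le_of_kmin_square[OF _ V.nrm_nonneg[OF U]]) (use lo kp in \<open>simp add: sq hs distrib_left\<close>)
  show "n0 \<theta> \<le> sqrt (1 / kmin) * nV (u, y, \<theta>)"
    by (rule le_of_kmin_square[OF _ V.nrm_nonneg[OF U]]) (use lo kp in \<open>simp add: sq E_def[symmetric] distrib_left\<close>)
  show "nV (u, y, \<theta>) \<le> sqrt kmax * (h0 u + h1 y + n0 \<theta>)"
  proof (rule power2_le_imp_le)
    have "(nV (u, y, \<theta>))\<^sup>2 \<le> kmax * ((h0 u)\<^sup>2 + (h1 y)\<^sup>2 + (n0 \<theta>)\<^sup>2)"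
      using hi by (simp add: sq hs E_def[symmetric] distrib_left)
    also have "\<dots> \<le> kmax * (h0 u + h1 y + n0 \<theta>)\<^sup>2"
      using nn kmax(1) by (intro mult_left_mono) (auto simp: power2_eq_square algebra_simps)
    finally show "(nV (u, y, \<theta>))\<^sup>2 \<le> (sqrt kmax * (h0 u + h1 y + n0 \<theta>))\<^sup>2"
      using kmax(1) by (simp add: power_mult_distrib)
  qed (use nn kmax(1) in auto)
qed

lemma nW_ge:
  assumes U: "(u, y, \<theta>) \<in> W2 P"
  shows "nV (u, y, \<theta>) \<le> nW (u, y, \<theta>)" "nA (u, y) \<le> nW (u, y, \<theta>)"
    "n0 (Dx0 P \<theta>) \<le> sqrt (1 / kmin) * nW (u, y, \<theta>)"
proof -
  have Z: "(u, y) \<in> W1 P" using U by (simp add: W2_iff)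
  have k: "0 \<le> kappa P * (n0 (Dx0 P \<theta>))\<^sup>2" using pos by simp
  note sq = nW_sq[OF U] and nn = W.nrm_nonneg[OF U]
  show "nV (u, y, \<theta>) \<le> nW (u, y, \<theta>)"
    by (rule power2_le_imp_le[OF _ nn]) (use sq k in simp)
  show "nA (u, y) \<le> nW (u, y, \<theta>)"
    by (rule power2_le_imp_le[OF _ nn]) (use sq k in simp)
  show "n0 (Dx0 P \<theta>) \<le> sqrt (1 / kmin) * nW (u, y, \<theta>)"
  proof (rule le_of_kmin_square[OF _ nn])
    have "kmin * (n0 (Dx0 P \<theta>))\<^sup>2 \<le> kappa P * (n0 (Dx0 P \<theta>))\<^sup>2"
      by (intro mult_right_mono kmin) simp
    moreover have "0 \<le> (nV (u, y, \<theta>))\<^sup>2" "0 \<le> (nA (u, y))\<^sup>2" by simp_all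
    ultimately show "kmin * (n0 (Dx0 P \<theta>))\<^sup>2 \<le> (nW (u, y, \<theta>))\<^sup>2" unfolding sq by linarith
  qed
qed

lemma A_bounds:
  assumes Z: "(u, y) \<in> W1 P"
  shows "n0 (Dx0 P (Dx0 P u)) \<le> sqrt (1 / kmin) * nA (u, y)"
    "n1 (Dx1 P (Dx1 P y)) \<le> sqrt (1 / kmin) * nA (u, y)"
    "nA (u, y) \<le> sqrt kmax * (n0 (Dx0 P (Dx0 P u)) + n1 (Dx1 P (Dx1 P y)))"
proof -
  note L = W1_D(3,4)[OF Z]
  define A where "A = (n0 (Dx0 P (Dx0 P u)))\<^sup>2" define B where "B = (n1 (Dx1 P (Dx1 P y)))\<^sup>2"
  have p: "0 \<le> A" "0 \<le> B" by (simp_all add: A_def B_def)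
  have sq: "(nA (u, y))\<^sup>2 = beta1 P * A + beta2 P * B" unfolding nA_sq[OF Z] A_def B_def ..
  have kp: "0 \<le> kmin * A" "0 \<le> kmin * B" using kmin(1) p by auto
  note lo = mult_right_mono[OF kmin(7) p(1)] mult_right_mono[OF kmin(8) p(2)]
  note hi = mult_right_mono[OF kmax(7) p(1)] mult_right_mono[OF kmax(8) p(2)]
  note nn = L2_norm_nonneg[OF L(1)] L2_norm_nonneg[OF L(2)]
  show "n0 (Dx0 P (Dx0 P u)) \<le> sqrt (1 / kmin) * nA (u, y)"
    by (rule le_of_kmin_square[OF _ A.nrm_nonneg[OF Z]]) (use lo kp in \<open>simp add: sq A_def[symmetric]\<close>)
  show "n1 (Dx1 P (Dx1 P y)) \<le> sqrt (1 / kmin) * nA (u, y)"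
    by (rule le_of_kmin_square[OF _ A.nrm_nonneg[OF Z]]) (use lo kp in \<open>simp add: sq B_def[symmetric]\<close>)
  show "nA (u, y) \<le> sqrt kmax * (n0 (Dx0 P (Dx0 P u)) + n1 (Dx1 P (Dx1 P y)))"
  proof (rule power2_le_imp_le)
    have "(nA (u, y))\<^sup>2 \<le> kmax * ((n0 (Dx0 P (Dx0 P u)))\<^sup>2 + (n1 (Dx1 P (Dx1 P y)))\<^sup>2)"
      using hi by (simp add: sq A_def[symmetric] B_def[symmetric] distrib_left)
    also have "\<dots> \<le> kmax * (n0 (Dx0 P (Dx0 P u)) + n1 (Dx1 P (Dx1 P y)))\<^sup>2"
      using nn kmax(1) by (intro mult_left_mono) (auto simp: power2_eq_square algebra_simps)
    finally show "(nA (u, y))\<^sup>2 \<le> (sqrt kmax * (n0 (Dx0 P (Dx0 P u)) + n1 (Dx1 P (Dx1 P y))))\<^sup>2"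
      using kmax(1) by (simp add: power_mult_distrib)
  qed (use nn kmax(1) in auto)
qed

lemma nW_le:
  assumes U: "(u, y, \<theta>) \<in> W2 P"
  shows "nW (u, y, \<theta>) \<le> nV (u, y, \<theta>) + nA (u, y) + sqrt kmax * n0 (Dx0 P \<theta>)"
proof (rule power2_le_imp_le)
  have Z: "(u, y) \<in> W1 P" using U by (simp add: W2_iff)
  have t: "0 \<le> n0 (Dx0 P \<theta>)"
    using U by (auto simp: W2_iff intro!: L2_norm_nonneg Sob1_L2(2) H10_Sob1)
  note nn = V.nrm_nonneg[OF W2_V2[OF U]] A.nrm_nonneg[OF Z]
  have "kappa P * (n0 (Dx0 P \<theta>))\<^sup>2 \<le> (sqrt kmax * n0 (Dx0 P \<theta>))\<^sup>2"
    using kmax(1,9) by (simp add: power_mult_distrib mult_right_mono)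
  then have "(nW (u, y, \<theta>))\<^sup>2 \<le> (nV (u, y, \<theta>))\<^sup>2 + (nA (u, y))\<^sup>2 + (sqrt kmax * n0 (Dx0 P \<theta>))\<^sup>2"
    unfolding nW_sq[OF U] by simp
  also have "\<dots> \<le> (nV (u, y, \<theta>) + nA (u, y) + sqrt kmax * n0 (Dx0 P \<theta>))\<^sup>2"
  proof -
    have "0 \<le> sqrt kmax * n0 (Dx0 P \<theta>)" using t kmax(1) by simp
    then show ?thesis using nn by (simp add: power2_sum)
  qed
  finally show "(nW (u, y, \<theta>))\<^sup>2 \<le> (nV (u, y, \<theta>) + nA (u, y) + sqrt kmax * n0 (Dx0 P \<theta>))\<^sup>2" .
  show "0 \<le> nV (u, y, \<theta>) + nA (u, y) + sqrt kmax * n0 (Dx0 P \<theta>)" using t nn kmax(1) by simp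
qed

text \<open>The form \<open>c\<close> contains the L2 norms of all three components with positive
  weights. This is what turns estimates into uniqueness.\<close>

lemma V_definite:
  assumes "U \<in> V2 P" "nV U = 0"
  shows "U = 0"
proof (cases U)
  fix u y \<theta> assume U: "U = (u, y, \<theta>)"
  have S: "u \<in> Sob 1 0 (len0 P)" "y \<in> Sob 1 (len0 P) (len P)" "\<theta> \<in> L2 0 (len0 P)"
    using assms(1) V1_D[of u y] by (auto simp: U V2_iff)
  note b = V_bounds[OF assms(1)[unfolded U]]
  have "n0 u = 0" "n1 y = 0" "n0 \<theta> = 0"
    using b assms(2) L2_norm_le_h1(1)[OF S(1)] L2_norm_le_h1(1)[OF S(2)]
      L2_norm_nonneg[OF Sob1_L2(1)[OF S(1)]] L2_norm_nonneg[OF Sob1_L2(1)[OF S(2)]] L2_norm_nonneg[OF S(3)]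
    by (auto simp: U)
  then show ?thesis
    using L2_norm_eq_0 Sob1_L2(1)[OF S(1)] Sob1_L2(1)[OF S(2)] S(3) by (simp add: U zero_prod_def)
qed

text \<open>Apart from regularity, membership is a matter of values at three points, which converge
  under H^1 convergence of the components.\<close>

lemma V1_closed:
  assumes Z: "\<And>n. (u n, y n) \<in> V1 P"
    and u: "u' \<in> Sob 1 0 (len0 P)" "(\<lambda>n. h0 (u n - u')) \<longlonglongrightarrow> 0"
    and y: "y' \<in> Sob 1 (len0 P) (len P)" "(\<lambda>n. h1 (y n - y')) \<longlonglongrightarrow> 0"
  shows "(u', y') \<in> V1 P"
proof -
  have S: "u n \<in> Sob 1 0 (len0 P)" "y n \<in> Sob 1 (len0 P) (len P)" for n using Z V1_D by blast+
  have pu: "(\<lambda>n. val0 P (u n) x) \<longlonglongrightarrow> val0 P u' x" if "x \<in> {0..len0 P}" for x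
    by (rule point_val_tendsto[OF len0_pos S(1) u(1) that u(2)])
  have py: "(\<lambda>n. val1 P (y n) x) \<longlonglongrightarrow> val1 P y' x" if "x \<in> {len0 P..len P}" for x
    by (rule point_val_tendsto[OF len0_less S(2) y(1) that y(2)])
  have v: "val0 P (u n) 0 = 0" "val1 P (y n) (len P) = 0" "val0 P (u n) (len0 P) = val1 P (y n) (len0 P)" for n
    using Z[of n] by (auto simp: V1_iff)
  have "val0 P u' 0 = 0" using pu[of 0] len0_pos by (simp add: v LIMSEQ_const_iff)
  moreover have "val1 P y' (len P) = 0" using py[of "len P"] len0_less by (simp add: v LIMSEQ_const_iff)
  moreover have "val0 P u' (len0 P) = val1 P y' (len0 P)"
    using pu[of "len0 P"] py[of "len0 P"] len0_less len0_pos by (auto simp: v intro: LIMSEQ_unique)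
  ultimately show ?thesis using u y by (simp add: V1_iff)
qed

lemma V_complete: "form_complete (V2 P) (form_c P)"
  unfolding form_complete_def
proof (intro allI impI)
  fix X assume X: "\<forall>n. X n \<in> V2 P" and C: "form_Cauchy (form_c P) X"
  define u where "u n = fst (X n)" for n
  define y where "y n = fst (snd (X n))" for n
  define \<theta> where "\<theta> n = snd (snd (X n))" for n
  have Xn: "X n = (u n, y n, \<theta> n)" for n by (simp add: u_def y_def \<theta>_def)
  have S: "(u n, y n) \<in> V1 P" "u n \<in> Sob 1 0 (len0 P)" "y n \<in> Sob 1 (len0 P) (len P)" "\<theta> n \<in> L2 0 (len0 P)" for n
    using X[rule_format, of n] V1_D[of "u n" "y n"] by (auto simp: Xn V2_iff)
  have d: "(u m - u n, y m - y n, \<theta> m - \<theta> n) \<in> V2 P" for m n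
    using X V.S_closed(6)[of "X m" "X n"] by (simp add: Xn)
  have k: "0 \<le> sqrt (1 / kmin)" using kmin(1) by simp
  have "form_Cauchy (h1_inner 0 (len0 P)) u"
    by (rule form_CauchyI[OF C k]) (use V_bounds(1)[OF d] in \<open>simp add: Xn\<close>)
  then obtain u' where u': "u' \<in> Sob 1 0 (len0 P)" "(\<lambda>n. h0 (u n - u')) \<longlonglongrightarrow> 0"
    using h1.completeD[of u] S(2) by blast
  have "form_Cauchy (h1_inner (len0 P) (len P)) y"
    by (rule form_CauchyI[OF C k]) (use V_bounds(2)[OF d] in \<open>simp add: Xn\<close>)
  then obtain y' where y': "y' \<in> Sob 1 (len0 P) (len P)" "(\<lambda>n. h1 (y n - y')) \<longlonglongrightarrow> 0"
    using h1.completeD[of y] S(3) by blast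
  have "form_Cauchy (L2_inner 0 (len0 P)) \<theta>"
    by (rule form_CauchyI[OF C k]) (use V_bounds(3)[OF d] in \<open>simp add: Xn L2_norm_form_norm\<close>)
  then obtain \<theta>' where \<theta>': "\<theta>' \<in> L2 0 (len0 P)" "(\<lambda>n. n0 (\<theta> n - \<theta>')) \<longlonglongrightarrow> 0"
    using L2.completeD[of \<theta>] S(4) unfolding L2_norm_form_norm by blast
  have l: "(u', y', \<theta>') \<in> V2 P"
    unfolding V2_iff using V1_closed[OF S(1) u' y'] \<theta>'(1) by blast
  have dl: "(u n - u', y n - y', \<theta> n - \<theta>') \<in> V2 P" for n
    using V.S_closed(6)[OF X[rule_format, of n] l] by (simp add: Xn)
  have "(\<lambda>n. h0 (u n - u') + h1 (y n - y') + n0 (\<theta> n - \<theta>')) \<longlonglongrightarrow> 0"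
    using tendsto_add[OF tendsto_add[OF u'(2) y'(2)] \<theta>'(2)] by simp
  then have "(\<lambda>n. nV (X n - (u', y', \<theta>'))) \<longlonglongrightarrow> 0"
    by (rule tendsto_zero_le[where C="sqrt kmax"]) (use V_bounds(4)[OF dl] V.nrm_nonneg[OF dl] in \<open>simp_all add: Xn\<close>)
  then show "\<exists>l\<in>V2 P. (\<lambda>n. nV (X n - l)) \<longlonglongrightarrow> 0" using l by blast
qed

sublocale V: semi_hilbert "V2 P" "form_c P" by standard (rule V_complete)

lemma h1_of_parts_tendsto:
  assumes X: "\<And>n. X n \<in> Sob 1 a b" "\<And>n. weak_deriv a b (X n) \<in> Sob 1 a b"
    and f: "f \<in> Sob 1 a b" "(\<lambda>n. form_norm (h1_inner a b) (X n - f)) \<longlonglongrightarrow> 0"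
    and g: "g \<in> Sob 1 a b" "(\<lambda>n. form_norm (h1_inner a b) (weak_deriv a b (X n) - g)) \<longlonglongrightarrow> 0"
  shows "weak_deriv a b f = g"
proof (rule weak_deriv_eqI, rule has_weak_deriv_closed)
  show "has_weak_deriv a b (X n) (weak_deriv a b (X n))" for n using X(1) Sob1_iff by blast
  show "f \<in> L2 a b" "g \<in> L2 a b" using f g by (auto intro: Sob1_L2)
  show "(\<lambda>n. form_norm (L2_inner a b) (X n - f)) \<longlonglongrightarrow> 0"
    by (rule tendsto_zero_le[OF f(2), where C=1])
       (use X f L2_norm_le_h1(1)[OF h1.S_closed(6)] L2_norm_nonneg[OF Sob1_L2(1)[OF h1.S_closed(6)]]
        in \<open>simp_all add: L2_norm_form_norm\<close>)
  show "(\<lambda>n. form_norm (L2_inner a b) (weak_deriv a b (X n) - g)) \<longlonglongrightarrow> 0"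
    by (rule tendsto_zero_le[OF g(2), where C=1])
       (use X g L2_norm_le_h1(1)[OF h1.S_closed(6)] L2_norm_nonneg[OF Sob1_L2(1)[OF h1.S_closed(6)]]
        in \<open>simp_all add: L2_norm_form_norm\<close>)
qed

text \<open>The form \<open>a\<close> sees second derivatives only. Each component vanishes with its
  derivative at a clamped end, so two applications of the Poincare inequality recover the H^1 norms
  of function and derivative.\<close>

lemma W1_bounds:
  obtains C where "0 \<le> C"
    "\<And>u y. (u, y) \<in> W1 P \<Longrightarrow> h0 u \<le> C * nA (u, y) \<and> h0 (Dx0 P u) \<le> C * nA (u, y) \<and>
      h1 y \<le> C * nA (u, y) \<and> h1 (Dx1 P y) \<le> C * nA (u, y)"
proof -
  define l where "l = len P"
  define s where "s = sqrt (1 / kmin)"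
  define C where "C = (l + 1) * (l + 1) * s"
  have l: "0 < l" using len0_pos len0_less by (simp add: l_def)
  have s: "0 \<le> s" using kmin(1) by (simp add: s_def)
  \<comment> \<open>\<open>c\<close> is the clamped end of the piece, and \<open>l\<close> bounds
    the length of both intervals; each use of the Poincare inequality contributes a factor
    \<open>l + 1\<close>.\<close>
  have two: "form_norm (h1_inner a b) f \<le> C * N \<and> form_norm (h1_inner a b) (weak_deriv a b f) \<le> C * N"
    if "a < b" "b - a \<le> l" "f \<in> Sob 1 a b" "weak_deriv a b f \<in> Sob 1 a b" "c \<in> {a..b}"
      "point_val a b f c = 0" "point_val a b (weak_deriv a b f) c = 0"
      "L2_norm a b (weak_deriv a b (weak_deriv a b f)) \<le> s * N" for a b f c N
  proof -
    define n2 where "n2 = L2_norm a b (weak_deriv a b (weak_deriv a b f))"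
    define n1 where "n1 = L2_norm a b (weak_deriv a b f)"
    define n where "n = L2_norm a b f"
    have nn: "0 \<le> n2" "0 \<le> n1"
      unfolding n2_def n1_def using that by (auto intro!: L2_norm_nonneg Sob1_L2)
    have "n1 \<le> (b - a) * n2" unfolding n1_def n2_def using that by (intro poincare)
    also have "\<dots> \<le> l * n2" using that nn by (intro mult_right_mono)
    finally have 1: "n1 \<le> l * n2" .
    have "n \<le> (b - a) * n1" unfolding n1_def n_def using that by (intro poincare)
    also have "\<dots> \<le> l * n1" using that nn by (intro mult_right_mono)
    finally have 2: "n \<le> l * n1" .
    have "n + n1 \<le> (l + 1) * n1" using 2 by (simp add: distrib_right)
    also have "\<dots> \<le> (l + 1) * ((l + 1) * n2)"
      using 1 l nn by (intro mult_left_mono) (auto simp: distrib_right)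
    finally have a: "n + n1 \<le> (l + 1) * (l + 1) * n2" by simp
    have "n1 + n2 \<le> 1 * ((l + 1) * n2)" using 1 by (simp add: distrib_right)
    also have "\<dots> \<le> (l + 1) * ((l + 1) * n2)"
      using l nn by (intro mult_right_mono) auto
    finally have b: "n1 + n2 \<le> (l + 1) * (l + 1) * n2" by simp
    have c: "(l + 1) * (l + 1) * n2 \<le> (l + 1) * (l + 1) * (s * N)"
      using that(8) l by (intro mult_left_mono) (auto simp: n2_def)
    show ?thesis
      using L2_norm_le_h1(3)[OF that(3)] L2_norm_le_h1(3)[OF that(4)] a b c
      unfolding C_def n_def n1_def n2_def by (simp add: mult.assoc)
  qed
  show thesis
  proof (rule that[of C])
    show "0 \<le> C" using l s by (simp add: C_def)
    fix u y assume Z: "(u, y) \<in> W1 P"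
    note S = V1_D[OF W1_V1[OF Z]] W1_D[OF Z]
    have v: "val0 P u 0 = 0" "val1 P y (len P) = 0" "val0 P (Dx0 P u) 0 = 0" "val1 P (Dx1 P y) (len P) = 0"
      using Z by (auto simp: W1_iff V1_iff)
    have "h0 u \<le> C * nA (u, y) \<and> h0 (Dx0 P u) \<le> C * nA (u, y)"
      by (rule two[where c=0]) (use len0_pos len0_less S v A_bounds(1)[OF Z] in \<open>auto simp: l_def s_def\<close>)
    moreover have "h1 y \<le> C * nA (u, y) \<and> h1 (Dx1 P y) \<le> C * nA (u, y)"
      by (rule two[where c="len P"]) (use len0_pos len0_less S v A_bounds(2)[OF Z] in \<open>auto simp: l_def s_def\<close>)
    ultimately show "h0 u \<le> C * nA (u, y) \<and> h0 (Dx0 P u) \<le> C * nA (u, y) \<and>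
      h1 y \<le> C * nA (u, y) \<and> h1 (Dx1 P y) \<le> C * nA (u, y)" by blast
  qed
qed

text \<open>By \<open>W1_bounds\<close> the functions and their first derivatives are Cauchy in H^1.
  The limit of the derivatives is the derivative of the limit, and both limits inherit the
  conditions of \<open>V1\<close>.\<close>

lemma A_complete: "form_complete (W1 P) (form_a P)"
  unfolding form_complete_def
proof (intro allI impI)
  fix X assume X: "\<forall>n. X n \<in> W1 P" and C: "form_Cauchy (form_a P) X"
  obtain K where K: "0 \<le> K" "\<And>u y. (u, y) \<in> W1 P \<Longrightarrow> h0 u \<le> K * nA (u, y) \<and> h0 (Dx0 P u) \<le> K * nA (u, y) \<and>
      h1 y \<le> K * nA (u, y) \<and> h1 (Dx1 P y) \<le> K * nA (u, y)" using W1_bounds by blast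
  define u where "u n = fst (X n)" for n
  define y where "y n = snd (X n)" for n
  have Xn: "X n = (u n, y n)" for n by (simp add: u_def y_def)
  have Z: "(u n, y n) \<in> W1 P" for n using X by (simp add: Xn[symmetric])
  note S = V1_D[OF W1_V1[OF Z]] W1_D[OF Z]
  have d: "(u m - u n, y m - y n) \<in> W1 P" for m n
    using X A.S_closed(6)[of "X m" "X n"] by (simp add: Xn)
  have Du: "Dx0 P (u m - u n) = Dx0 P (u m) - Dx0 P (u n)" for m n by (rule weak_deriv_diff[OF S(1) S(1)])
  have Dy: "Dx1 P (y m - y n) = Dx1 P (y m) - Dx1 P (y n)" for m n by (rule weak_deriv_diff[OF S(2) S(2)])
  have "form_Cauchy (h1_inner 0 (len0 P)) u"
    by (rule form_CauchyI[OF C K(1)]) (use K(2)[OF d] in \<open>simp add: Xn\<close>)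
  then obtain u' where u': "u' \<in> Sob 1 0 (len0 P)" "(\<lambda>n. h0 (u n - u')) \<longlonglongrightarrow> 0"
    using h1.completeD[of u] S(1) by blast
  have "form_Cauchy (h1_inner 0 (len0 P)) (\<lambda>n. Dx0 P (u n))"
    by (rule form_CauchyI[OF C K(1)]) (use K(2)[OF d] in \<open>simp add: Xn Du\<close>)
  then obtain p where p: "p \<in> Sob 1 0 (len0 P)" "(\<lambda>n. h0 (Dx0 P (u n) - p)) \<longlonglongrightarrow> 0"
    using h1.completeD[of "\<lambda>n. Dx0 P (u n)"] S(7) by blast
  have "form_Cauchy (h1_inner (len0 P) (len P)) y"
    by (rule form_CauchyI[OF C K(1)]) (use K(2)[OF d] in \<open>simp add: Xn\<close>)
  then obtain y' where y': "y' \<in> Sob 1 (len0 P) (len P)" "(\<lambda>n. h1 (y n - y')) \<longlonglongrightarrow> 0"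
    using h1.completeD[of y] S(2) by blast
  have "form_Cauchy (h1_inner (len0 P) (len P)) (\<lambda>n. Dx1 P (y n))"
    by (rule form_CauchyI[OF C K(1)]) (use K(2)[OF d] in \<open>simp add: Xn Dy\<close>)
  then obtain q where q: "q \<in> Sob 1 (len0 P) (len P)" "(\<lambda>n. h1 (Dx1 P (y n) - q)) \<longlonglongrightarrow> 0"
    using h1.completeD[of "\<lambda>n. Dx1 P (y n)"] S(8) by blast
  have pu: "Dx0 P u' = p" by (rule h1_of_parts_tendsto[OF S(1) S(7) u' p])
  have qy: "Dx1 P y' = q" by (rule h1_of_parts_tendsto[OF S(2) S(8) y' q])
  have "(u', y') \<in> V1 P" by (rule V1_closed[OF W1_V1[OF Z] u' y'])
  moreover have "(Dx0 P u', Dx1 P y') \<in> V1 P"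
    unfolding pu qy by (rule V1_closed[OF _ p q]) (use Z in \<open>auto simp: W1_iff\<close>)
  ultimately have l: "(u', y') \<in> W1 P" by (simp add: W1_iff)
  have dl: "(u n - u', y n - y') \<in> W1 P" for n
    using A.S_closed(6)[OF Z l] by simp
  have "(\<lambda>n. h0 (Dx0 P (u n) - p) + h1 (Dx1 P (y n) - q)) \<longlonglongrightarrow> 0"
    using tendsto_add[OF p(2) q(2)] by simp
  then have "(\<lambda>n. nA (X n - (u', y'))) \<longlonglongrightarrow> 0"
  proof (rule tendsto_zero_le[where C="sqrt kmax"])
    fix n
    note SS = W1_D[OF dl[of n]]
    have e: "Dx0 P (u n - u') = Dx0 P (u n) - p" "Dx1 P (y n - y') = Dx1 P (y n) - q"
      using weak_deriv_diff[OF S(1) u'(1)] weak_deriv_diff[OF S(2) y'(1)] pu qy by auto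
    show "0 \<le> nA (X n - (u', y'))" using A.nrm_nonneg[OF dl] by (simp add: Xn)
    have "nA (X n - (u', y')) \<le> sqrt kmax * (n0 (Dx0 P (Dx0 P (u n - u'))) + n1 (Dx1 P (Dx1 P (y n - y'))))"
      using A_bounds(3)[OF dl[of n]] by (simp add: Xn)
    also have "\<dots> \<le> sqrt kmax * (h0 (Dx0 P (u n) - p) + h1 (Dx1 P (y n) - q))"
      using L2_norm_le_h1(2)[OF SS(1)] L2_norm_le_h1(2)[OF SS(2)] kmax(1)
      by (intro mult_left_mono add_mono) (auto simp: e)
    finally show "nA (X n - (u', y')) \<le> sqrt kmax * (h0 (Dx0 P (u n) - p) + h1 (Dx1 P (y n) - q))" .
  qed
  then show "\<exists>l\<in>W1 P. (\<lambda>n. nA (X n - l)) \<longlonglongrightarrow> 0" using l by blast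
qed

sublocale A: semi_hilbert "W1 P" "form_a P" by standard (rule A_complete)

lemma nV_le_nA:
  obtains C where "0 \<le> C" "\<And>u y. (u, y) \<in> W1 P \<Longrightarrow> nV (u, y, 0) \<le> C * nA (u, y)"
proof -
  obtain K where K: "0 \<le> K" "\<And>u y. (u, y) \<in> W1 P \<Longrightarrow> h0 u \<le> K * nA (u, y) \<and> h0 (Dx0 P u) \<le> K * nA (u, y) \<and>
      h1 y \<le> K * nA (u, y) \<and> h1 (Dx1 P y) \<le> K * nA (u, y)" using W1_bounds by blast
  show thesis
  proof (rule that[of "sqrt kmax * (K + K)"])
    show "0 \<le> sqrt kmax * (K + K)" using K(1) kmax(1) by simp
    fix u y assume Z: "(u, y) \<in> W1 P"
    have "(u, y, 0) \<in> V2 P" using W1_V1[OF Z] by (simp add: V2_iff L2.S_closed)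
    moreover have "n0 0 = 0" using L2.ip_simps(9)[OF L2.S_closed(1)] by (simp add: L2_norm_def)
    ultimately have "nV (u, y, 0) \<le> sqrt kmax * (h0 u + h1 y)" using V_bounds(4) by fastforce
    also have "\<dots> \<le> sqrt kmax * (K * nA (u, y) + K * nA (u, y))"
      using K(2)[OF Z] kmax(1) by (intro mult_left_mono add_mono) auto
    finally show "nV (u, y, 0) \<le> sqrt kmax * (K + K) * nA (u, y)" by (simp add: algebra_simps)
  qed
qed

text \<open>The pair converges in \<open>W1\<close> and the third component in H^1, where H^1_0 is
  closed; the seminorm of the difference is then estimated by these two convergences.\<close>

lemma W_complete: "form_complete (W2 P) form_w"
  unfolding form_complete_def
proof (intro allI impI)
  fix X assume X: "\<forall>n. X n \<in> W2 P" and C: "form_Cauchy form_w X"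
  define u where "u n = fst (X n)" for n
  define y where "y n = fst (snd (X n))" for n
  define \<theta> where "\<theta> n = snd (snd (X n))" for n
  have Xn: "X n = (u n, y n, \<theta> n)" for n by (simp add: u_def y_def \<theta>_def)
  have S: "(u n, y n) \<in> W1 P" "\<theta> n \<in> H10 0 (len0 P)" "\<theta> n \<in> Sob 1 0 (len0 P)" for n
    using X[rule_format, of n] by (auto simp: Xn W2_iff intro: H10_Sob1)
  have d: "(u m - u n, y m - y n, \<theta> m - \<theta> n) \<in> W2 P" for m n
    using X W.S_closed(6)[of "X m" "X n"] by (simp add: Xn)
  have k: "0 \<le> sqrt (1 / kmin)" using kmin(1) by simp
  have "form_Cauchy (form_a P) (\<lambda>n. (u n, y n))"
    by (rule form_CauchyI[OF C, where C=1]) (use nW_ge(2)[OF d] in \<open>simp_all add: Xn\<close>)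
  then obtain Z where Z: "Z \<in> W1 P" "(\<lambda>n. nA ((u n, y n) - Z)) \<longlonglongrightarrow> 0"
    using A.completeD[of "\<lambda>n. (u n, y n)"] S(1) by blast
  obtain u' y' where Zeq: "Z = (u', y')" by (cases Z)
  have "form_Cauchy (h1_inner 0 (len0 P)) \<theta>"
  proof (rule form_CauchyI[OF C, where C="sqrt (1 / kmin) + sqrt (1 / kmin)"])
    fix m n
    have "h0 (\<theta> m - \<theta> n) \<le> n0 (\<theta> m - \<theta> n) + n0 (Dx0 P (\<theta> m - \<theta> n))"
      by (rule L2_norm_le_h1(3)[OF h1.S_closed(6)[OF S(3) S(3)]])
    also have "n0 (\<theta> m - \<theta> n) \<le> sqrt (1 / kmin) * nV (X m - X n)"
      using V_bounds(3)[OF W2_V2[OF d]] by (simp add: Xn)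
    also have "\<dots> \<le> sqrt (1 / kmin) * nW (X m - X n)"
      using nW_ge(1)[OF d] k by (intro mult_left_mono) (auto simp: Xn)
    also have "n0 (Dx0 P (\<theta> m - \<theta> n)) \<le> sqrt (1 / kmin) * nW (X m - X n)"
      using nW_ge(3)[OF d] by (simp add: Xn)
    finally show "h0 (\<theta> m - \<theta> n) \<le> (sqrt (1 / kmin) + sqrt (1 / kmin)) * nW (X m - X n)"
      by (simp add: distrib_right)
  qed (use k in simp)
  then obtain \<theta>' where \<theta>': "\<theta>' \<in> Sob 1 0 (len0 P)" "(\<lambda>n. h0 (\<theta> n - \<theta>')) \<longlonglongrightarrow> 0"
    using h1.completeD[of \<theta>] S(3) by blast
  have H: "\<theta>' \<in> H10 0 (len0 P)" by (rule H10_closed[OF S(2) \<theta>'])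
  have l: "(u', y', \<theta>') \<in> W2 P" using Z(1) H by (simp add: Zeq W2_iff)
  have dl: "(u n - u', y n - y', \<theta> n - \<theta>') \<in> W2 P" for n
    using W.S_closed(6)[OF X[rule_format, of n] l] by (simp add: Xn)
  obtain K where K: "0 \<le> K" "\<And>u y. (u, y) \<in> W1 P \<Longrightarrow> nV (u, y, 0) \<le> K * nA (u, y)" using nV_le_nA by blast
  \<comment> \<open>\<open>1 + K\<close> collects the two contributions of the pair, through
    \<open>nA\<close> and through its share of \<open>nV\<close>; \<open>sqrt kmax\<close> weights
    the terms of the third component.\<close>
  define T where "T = 1 + K + sqrt kmax"
  have T: "0 \<le> T" "sqrt kmax \<le> T" "1 + K \<le> T" using K(1) kmax(1) by (auto simp: T_def)
  have "(\<lambda>n. nA ((u n, y n) - Z) + (h0 (\<theta> n - \<theta>') + h0 (\<theta> n - \<theta>'))) \<longlonglongrightarrow> 0"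
    using tendsto_add[OF Z(2) tendsto_add[OF \<theta>'(2) \<theta>'(2)]] by simp
  then have "(\<lambda>n. nW (X n - (u', y', \<theta>'))) \<longlonglongrightarrow> 0"
  proof (rule tendsto_zero_le[where C=T])
    fix n
    show "0 \<le> nW (X n - (u', y', \<theta>'))" using W.nrm_nonneg[OF dl] by (simp add: Xn)
    define a where "a = u n - u'" define b where "b = y n - y'" define c where "c = \<theta> n - \<theta>'"
    have abc: "(a, b, c) \<in> W2 P" using dl[of n] by (simp add: a_def b_def c_def)
    then have ab: "(a, b) \<in> W1 P" and c: "c \<in> Sob 1 0 (len0 P)" by (auto simp: W2_iff intro: H10_Sob1)
    \<comment> \<open>The difference is split into \<open>(a, b, 0)\<close> and
      \<open>(0, 0, c)\<close>, because \<open>nV_le_nA\<close> controls only the former by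
      \<open>nA\<close>.\<close>
    have ab0: "(a, b, 0) \<in> V2 P" using W1_V1[OF ab] by (simp add: V2_iff L2.S_closed)
    have z0: "(0, 0, c) \<in> V2 P"
      using c csub_zero[OF csub_V1] by (auto simp: V2_iff zero_prod_def intro: Sob1_L2)
    have h00: "h0 0 = 0" "h1 0 = 0"
      using h1.ip_simps(9)[OF h1.S_closed(1)] by (simp_all add: form_norm_def)
    have nAn: "0 \<le> nA (a, b)" by (rule A.nrm_nonneg[OF ab])
    have hc: "n0 c \<le> h0 c" "n0 (Dx0 P c) \<le> h0 c" "0 \<le> h0 c"
      using L2_norm_le_h1[OF c] h1.nrm_nonneg[OF c] by auto
    have "nV (a, b, c) \<le> nV (a, b, 0) + nV (0, 0, c)"
      using V.nrm_triangle[OF ab0 z0] by simp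
    also have "\<dots> \<le> K * nA (a, b) + sqrt kmax * n0 c"
      using K(2)[OF ab] V_bounds(4)[OF z0] by (simp add: h00)
    finally have 1: "nV (a, b, c) \<le> K * nA (a, b) + sqrt kmax * h0 c"
      using mult_left_mono[OF hc(1), of "sqrt kmax"] kmax(1) by simp
    have "nW (a, b, c) \<le> (1 + K) * nA (a, b) + (sqrt kmax * h0 c + sqrt kmax * h0 c)"
      using nW_le[OF abc] 1 mult_left_mono[OF hc(2), of "sqrt kmax"] kmax(1) by (simp add: distrib_right)
    also have "\<dots> \<le> T * nA (a, b) + (T * h0 c + T * h0 c)"
      using T nAn hc by (intro add_mono mult_right_mono) auto
    finally have "nW (a, b, c) \<le> T * (nA (a, b) + (h0 c + h0 c))" by (simp add: algebra_simps)
    then show "nW (X n - (u', y', \<theta>')) \<le> T * (nA ((u n, y n) - Z) + (h0 (\<theta> n - \<theta>') + h0 (\<theta> n - \<theta>')))"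
      by (simp add: Xn a_def b_def c_def Zeq)
  qed
  then show "\<exists>l\<in>W2 P. (\<lambda>n. nW (X n - l)) \<longlonglongrightarrow> 0" using l by blast
qed

sublocale W: semi_hilbert "W2 P" form_w by standard (rule W_complete)

end

section \<open>Regularity in the domain of the generator\<close>

lemma cscale_cscale: "j *\<^sub>C k *\<^sub>C f = (j * k) *\<^sub>C (f :: aefun)"
  by transfer (auto simp: mult.assoc)

lemma cscale_one: "1 *\<^sub>C f = (f :: aefun)"
  by transfer auto

lemma Sob1_cscale_cancel:
  assumes "k *\<^sub>C f \<in> Sob 1 a b" "k \<noteq> 0"
  shows "f \<in> Sob 1 a b"
  using csub_scaleC[OF csub_Sob1 assms(1), of "1 / k"] assms(2) by (simp add: cscale_cscale cscale_one)

context beam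
begin

section \<open>Test elements, and the density of \<open>W2 P\<close> in \<open>V2 P\<close>\<close>

lemma len_pos: "0 < len P"
  using len0_pos len0_less by simp

abbreviation "f0 \<equiv> restr 0 (len0 P)"
abbreviation "f1 \<equiv> restr (len0 P) (len P)"
abbreviation "ddx \<phi> \<equiv> (\<lambda>x. vector_derivative \<phi> (at x))"

text \<open>The two pieces come from one smooth function on the line with support inside
  \<open>(0, L)\<close>, so the conditions at both ends and at the interface hold
  automatically.\<close>

lemma test_V1:
  assumes "test_function 0 (len P) \<phi>"
  shows "(f0 \<phi>, f1 \<phi>) \<in> V1 P" "Dx0 P (f0 \<phi>) = f0 (ddx \<phi>)" "Dx1 P (f1 \<phi>) = f1 (ddx \<phi>)"
proof -
  note s = test_function_smooth[OF assms]
  note 0 = restr_smooth[OF len0_pos s] and 1 = restr_smooth[OF len0_less s]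
  show "(f0 \<phi>, f1 \<phi>) \<in> V1 P"
    using has_weak_deriv_Sob1[OF 0(1)] has_weak_deriv_Sob1[OF 1(1)] 0(2) 1(2) len0_pos len0_less
      test_function_outside[OF assms, of 0] test_function_outside[OF assms, of "len P"]
    by (simp add: V1_iff)
  show "Dx0 P (f0 \<phi>) = f0 (ddx \<phi>)" "Dx1 P (f1 \<phi>) = f1 (ddx \<phi>)"
    using 0(1) 1(1) by (auto intro: weak_deriv_eqI)
qed

lemma test_W1:
  assumes "test_function 0 (len P) \<phi>"
  shows "(f0 \<phi>, f1 \<phi>) \<in> W1 P"
  using test_V1[OF assms] test_V1(1)[OF test_function_deriv[OF assms]] by (simp add: W1_iff)

lemma test_W2:
  assumes "test_function 0 (len P) \<phi>"
  shows "(f0 \<phi>, f1 \<phi>, 0) \<in> W2 P"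
  using test_W1[OF assms] csub_zero[OF csub_H10] by (simp add: W2_iff)

lemma test_theta_W2:
  assumes "test_function 0 (len0 P) \<phi>"
  shows "(0, 0, f0 \<phi>) \<in> W2 P"
  using test_function_H10[OF len0_pos assms] csub_zero[OF csub_W1] by (simp add: W2_iff zero_prod_def)

lemma inner_glue_test:
  assumes "f \<in> L2 0 (len0 P)" "g \<in> L2 (len0 P) (len P)" "test_function 0 (len P) \<phi>"
  shows "L2_inner 0 (len P) (f + g) (restr 0 (len P) \<phi>) = inner0 P f (f0 \<phi>) + inner1 P g (f1 \<phi>)"
  using test_function_continuous(1)[OF assms(3)] assms len0_pos len0_less
  by (simp add: restr_split[of 0 "len0 P" "len P"] L2_inner_glue fn_L2)

text \<open>An element of \<open>V1 P\<close> is viewed as a single \<open>H\<^sup>1\<close> function on \<open>(0, L)\<close>, namely the sum of the two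
  extensions by zero.\<close>

lemma glue_V1:
  assumes "(u, y) \<in> V1 P"
  shows "u + y \<in> Sob 1 0 (len P)" "weak_deriv 0 (len P) (u + y) = Dx0 P u + Dx1 P y"
    "point_val 0 (len P) (u + y) 0 = 0" "point_val 0 (len P) (u + y) (len P) = 0"
proof -
  have S: "has_weak_deriv 0 (len0 P) u (Dx0 P u)" "has_weak_deriv (len0 P) (len P) y (Dx1 P y)"
    using V1_D(1,2)[OF assms] Sob1_iff by blast+
  have v: "val0 P u 0 = 0" "val1 P y (len P) = 0" "val0 P u (len0 P) = val1 P y (len0 P)"
    using assms by (auto simp: V1_iff)
  note g = glue_weak_deriv[OF len0_pos len0_less S v(3)]
  show "u + y \<in> Sob 1 0 (len P)" "weak_deriv 0 (len P) (u + y) = Dx0 P u + Dx1 P y"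
    "point_val 0 (len P) (u + y) 0 = 0" "point_val 0 (len P) (u + y) (len P) = 0"
    using has_weak_deriv_Sob1[OF g(1)] weak_deriv_eqI[OF g(1)] g(2,3) v by auto
qed

lemma L2_glue: "f \<in> L2 0 (len0 P) \<Longrightarrow> g \<in> L2 (len0 P) (len P) \<Longrightarrow> f + g \<in> L2 0 (len P)"
  using len0_pos len0_less L2_mono[of f 0 "len0 P" 0 "len P"] L2_mono[of g "len0 P" "len P" 0 "len P"]
  by (simp add: L2.S_closed)

lemma inner_zero [simp]:
  "f \<in> L2 a b \<Longrightarrow> L2_inner a b f 0 = 0" "f \<in> L2 a b \<Longrightarrow> L2_inner a b 0 f = 0"
  by (simp_all add: L2.ip_simps)

lemma form_c_theta_test:
  assumes "(p, q, r) \<in> V2 P"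
  shows "form_c P (p, q, r) (0, 0, s) = of_real (rho0 P) * inner0 P r s"
  using assms V1_D[of p q] by (simp add: V2_iff weak_deriv_zero)

text \<open>The form becomes a pairing on the whole interval: the weighted functions against
  \<open>\<phi>\<close> and the weighted derivatives against \<open>\<phi>'\<close>. The interface
  disappears from view.\<close>

lemma form_c_test:
  assumes "(p, q, r) \<in> V2 P" "test_function 0 (len P) \<phi>"
  shows "form_c P (p, q, r) (f0 \<phi>, f1 \<phi>, 0) =
      L2_inner 0 (len P) (of_real (rho1 P) *\<^sub>C p + of_real (rho2 P) *\<^sub>C q) (restr 0 (len P) \<phi>)
    + L2_inner 0 (len P) (of_real (alpha1 P) *\<^sub>C Dx0 P p + of_real (alpha2 P) *\<^sub>C Dx1 P q) (restr 0 (len P) (ddx \<phi>))"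
proof -
  note S = V1_D[of p q]
  have V: "(p, q) \<in> V1 P" "r \<in> L2 0 (len0 P)" using assms(1) by (auto simp: V2_iff)
  have L: "f0 \<phi> \<in> L2 0 (len0 P)" "f1 \<phi> \<in> L2 (len0 P) (len P)"
     "f0 (ddx \<phi>) \<in> L2 0 (len0 P)" "f1 (ddx \<phi>) \<in> L2 (len0 P) (len P)"
    using test_function_continuous[OF assms(2)] by (auto intro: fn_L2)
  show ?thesis
    using S[OF V(1)] V(2) L assms(2) test_function_deriv[OF assms(2)]
    by (simp add: inner_glue_test test_V1(2,3) L2.S_closed L2.ip_simps)
qed

text \<open>Density in dual form. Orthogonality to test elements says that the weighted derivative
  \<open>F\<close> of \<open>(p, q)\<close> has the weak derivative \<open>G\<close>; integrating by
  parts against \<open>p + q\<close> itself then gives \<open>c w w = 0\<close>.\<close>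

lemma W2_dense:
  assumes w: "w \<in> V2 P" and z: "\<And>U. U \<in> W2 P \<Longrightarrow> form_c P w U = 0"
  shows "w = 0"
proof -
  obtain p q r where pqr: "w = (p, q, r)" by (cases w)
  have V: "(p, q) \<in> V1 P" "r \<in> L2 0 (len0 P)" using w by (auto simp: V2_iff pqr)
  note S = V1_D[OF V(1)]
  have r0: "r = 0"
  proof (rule L2_zero_of_test[OF V(2)])
    fix \<phi> assume "test_function 0 (len0 P) \<phi>"
    from z[OF test_theta_W2[OF this]] show "inner0 P r (f0 \<phi>) = 0"
      using form_c_theta_test[OF w[unfolded pqr]] pos(1) by (simp add: pqr del: form_c.simps)
  qed
  define F where "F = of_real (alpha1 P) *\<^sub>C Dx0 P p + of_real (alpha2 P) *\<^sub>C Dx1 P q"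
  define G where "G = of_real (rho1 P) *\<^sub>C p + of_real (rho2 P) *\<^sub>C q"
  have FG: "F \<in> L2 0 (len P)" "G \<in> L2 0 (len P)"
    unfolding F_def G_def by (intro L2_glue L2.S_closed(3) S)+
  have hwd: "has_weak_deriv 0 (len P) F G"
    unfolding has_weak_deriv_inner_iff
  proof (intro conjI FG allI impI)
    fix \<phi> assume \<phi>: "test_function 0 (len P) \<phi>"
    show "L2_inner 0 (len P) F (restr 0 (len P) (ddx \<phi>)) = - L2_inner 0 (len P) G (restr 0 (len P) \<phi>)"
      using z[OF test_W2[OF \<phi>]] form_c_test[OF w[unfolded pqr] \<phi>]
      by (simp add: pqr F_def G_def add_eq_0_iff del: form_c.simps)
  qed
  note gl = glue_V1[OF V(1)]
  \<comment> \<open>The boundary terms vanish because \<open>p + q\<close> is zero at both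
    ends.\<close>
  have "L2_inner 0 (len P) G (p + q) + L2_inner 0 (len P) F (Dx0 P p + Dx1 P q) = 0"
    using L2_inner_parts[OF len_pos has_weak_deriv_Sob1[OF hwd] gl(1)] weak_deriv_eqI[OF hwd] gl by simp
  moreover have "L2_inner 0 (len P) G (p + q) = of_real (rho1 P) * inner0 P p p + of_real (rho2 P) * inner1 P q q"
    unfolding G_def using S len0_pos len0_less by (simp add: L2_inner_glue L2.S_closed L2.ip_simps)
  moreover have "L2_inner 0 (len P) F (Dx0 P p + Dx1 P q) = of_real (alpha1 P) * inner0 P (Dx0 P p) (Dx0 P p)
      + of_real (alpha2 P) * inner1 P (Dx1 P q) (Dx1 P q)"
    unfolding F_def using S len0_pos len0_less by (simp add: L2_inner_glue L2.S_closed L2.ip_simps)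
  ultimately have "form_c P w w = 0" using r0 by (simp add: pqr algebra_simps L2.S_closed)
  then have "nV w = 0" by (simp add: form_norm_def)
  then show ?thesis by (rule V_definite[OF w])
qed

text \<open>Surjectivity of \<open>C\<close> by Riesz representation. Both functionals are
  \<open>undefined\<close> off \<open>V2 P\<close>, so agreement on \<open>V2 P\<close> is
  equality.\<close>

lemma V2_dual_iff: "f \<in> V2_dual P \<longleftrightarrow> (\<exists>w\<in>V2 P. f = op_C P w)"
proof
  assume f: "f \<in> V2_dual P"
  then obtain M where M: "\<And>U. U \<in> V2 P \<Longrightarrow> cmod (f U) \<le> M * nV U"
    unfolding V2_dual_def norm_V2_def form_norm_def by blast
  have "antilinear_on (V2 P) f" using f unfolding V2_dual_def antilinear_on_def by blast
  then obtain w where w: "w \<in> V2 P" "\<And>V. V \<in> V2 P \<Longrightarrow> form_c P w V = f V"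
    using V.riesz[of f M] M by blast
  have "f = op_C P w"
  proof
    fix U show "f U = op_C P w U"
    proof (cases "U \<in> V2 P")
      case True then show ?thesis by (simp only: op_C_def restrict_apply if_True w(2))
    next
      case False
      moreover have "f \<in> extensional (V2 P)" using f unfolding V2_dual_def by blast
      ultimately have "f U = undefined" by (metis extensional_arb)
      then show ?thesis using False by (simp only: op_C_def restrict_apply if_False)
    qed
  qed
  then show "\<exists>w\<in>V2 P. f = op_C P w" using w by blast
next
  assume "\<exists>w\<in>V2 P. f = op_C P w"
  then obtain w where w: "w \<in> V2 P" and f: "f = op_C P w" by blast
  have "\<forall>U\<in>V2 P. cmod (f U) \<le> nV w * norm_V2 P U"
    using V.cauchy_schwarz[OF w] by (simp add: f op_C_def norm_V2_def form_norm_def)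
  then show "f \<in> V2_dual P"
    unfolding V2_dual_def using w by (auto simp: f op_C_def V.S_closed V.ip_simps)
qed

lemma inj_op_C: "inj_on (op_C P) (V2 P)"
proof (rule inj_onI)
  fix w w' assume w: "w \<in> V2 P" "w' \<in> V2 P" "op_C P w = op_C P w'"
  have "form_c P w V = form_c P w' V" if "V \<in> V2 P" for V
    using fun_cong[OF w(3), of V] that by (simp add: op_C_def)
  then have "form_c P (w - w') U = 0" if "U \<in> W2 P" for U
    using W2_V2[OF that] w by (simp add: V.ip_simps)
  then show "w = w'" using W2_dense[of "w - w'"] w by (simp add: V.S_closed)
qed

text \<open>An extension is of the form \<open>op_C P w'\<close>, and \<open>w' - w\<close> is
  orthogonal to \<open>W2 P\<close>, hence zero by density. This resolves both the description of
  the extension and the inverse of \<open>op_C\<close>.\<close>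

lemma C_inv_eq:
  assumes w: "w \<in> V2 P" and F: "\<And>U. U \<in> W2 P \<Longrightarrow> form_c P w U = F U"
  shows "V2_extension P F (op_C P w)" "C_inv P F = w"
proof -
  show ext: "V2_extension P F (op_C P w)"
    unfolding V2_extension_def V2_dual_iff using w F W2_V2 by (auto simp: op_C_def)
  have "f = op_C P w" if "V2_extension P F f" for f
  proof -
    have f: "f \<in> V2_dual P" "\<And>U. U \<in> W2 P \<Longrightarrow> f U = F U"
      using that by (auto simp: V2_extension_def)
    obtain w' where w': "w' \<in> V2 P" "f = op_C P w'" using f(1) unfolding V2_dual_iff by blast
    have "form_c P (w' - w) U = 0" if "U \<in> W2 P" for U
      using W2_V2[OF that] w w'(1) F[OF that] f(2)[OF that] by (simp add: V.ip_simps w'(2) op_C_def)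
    then have "w' - w = 0" using W2_dense[of "w' - w"] w w'(1) by (simp add: V.S_closed)
    then show ?thesis using w'(2) by simp
  qed
  then have "(THE f. V2_extension P F f) = op_C P w" using ext by blast
  then show "C_inv P F = w" unfolding C_inv_def using the_inv_into_f_f[OF inj_op_C w] by simp
qed

definition form_a2 :: "pair \<Rightarrow> triple \<Rightarrow> complex" where
  "form_a2 Z U = form_a P Z (fst U, fst (snd U))"

lemma op_sum_eq:
  "U \<in> W2 P \<Longrightarrow> op_B P \<Phi>2 U + op_A1 P \<Phi>1 U = form_b P \<Phi>2 U + form_a2 \<Phi>1 U"
  by (cases U) (simp add: op_B_def op_A1_def form_a2_def)

text \<open>The domain in variational terms. The vector \<open>w\<close> is the value of
  \<open>C_inv\<close> that enters \<open>op_A\<close>, so functionals are not mentioned from here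
  on.\<close>

lemma dom_A_iff:
  "(\<Phi>1, \<Phi>2) \<in> dom_A P \<longleftrightarrow> \<Phi>1 \<in> W1 P \<and> \<Phi>2 \<in> W2 P \<and>
    (\<exists>w\<in>V2 P. \<forall>U\<in>W2 P. form_c P w U = form_b P \<Phi>2 U + form_a2 \<Phi>1 U)"
proof -
  define F where "F = (\<lambda>U. op_B P \<Phi>2 U + op_A1 P \<Phi>1 U)"
  have "(\<exists>f. V2_extension P F f) \<longleftrightarrow> (\<exists>w\<in>V2 P. \<forall>U\<in>W2 P. form_c P w U = F U)"
  proof
    assume "\<exists>f. V2_extension P F f"
    then obtain w where w: "w \<in> V2 P" "\<And>U. U \<in> W2 P \<Longrightarrow> op_C P w U = F U"
      unfolding V2_extension_def V2_dual_iff by blast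
    then have "form_c P w U = F U" if "U \<in> W2 P" for U
      using w(2)[OF that] W2_V2[OF that] by (simp add: op_C_def)
    then show "\<exists>w\<in>V2 P. \<forall>U\<in>W2 P. form_c P w U = F U" using w(1) by blast
  qed (use C_inv_eq(1) in blast)
  then show ?thesis unfolding dom_A_def F_def by (auto simp: op_sum_eq)
qed

lemma op_A_eq:
  assumes "w \<in> V2 P" "\<And>U. U \<in> W2 P \<Longrightarrow> form_c P w U = form_b P \<Phi>2 U + form_a2 \<Phi>1 U"
  shows "op_A P (\<Phi>1, \<Phi>2) = ((fst \<Phi>2, fst (snd \<Phi>2)), - w)"
proof -
  have "C_inv P (\<lambda>U. op_B P \<Phi>2 U + op_A1 P \<Phi>1 U) = w"
    by (rule C_inv_eq(2)) (use assms in \<open>simp_all add: op_sum_eq\<close>)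
  then show ?thesis by (cases \<Phi>2) simp
qed

lemma regularity:
  assumes "((u, y), (v, z, \<theta>)) \<in> dom_A P"
  shows "\<theta> \<in> Sob 2 0 (len0 P)" "u \<in> Sob 3 0 (len0 P)" "y \<in> Sob 3 (len0 P) (len P)"
    "of_real (beta1 P) * val0 P (Dx0 P (Dx0 P u)) (len0 P) = of_real (beta2 P) * val1 P (Dx1 P (Dx1 P y)) (len0 P)"
proof -
  obtain w where Z: "(u, y) \<in> W1 P" and W: "(v, z, \<theta>) \<in> W2 P" and w: "w \<in> V2 P"
    and eq: "\<And>U. U \<in> W2 P \<Longrightarrow> form_c P w U = form_b P (v, z, \<theta>) U + form_a2 (u, y) U"
    using assms unfolding dom_A_iff by blast
  obtain p q r where pqr: "w = (p, q, r)" by (cases w)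
  have V: "(p, q) \<in> V1 P" "r \<in> L2 0 (len0 P)" using w by (auto simp: V2_iff pqr)
  note S = V1_D[OF V(1)]
  have vz: "(v, z) \<in> W1 P" "\<theta> \<in> Sob 1 0 (len0 P)" using W by (auto simp: W2_iff intro: H10_Sob1)
  note uy = V1_D[OF W1_V1[OF Z]] W1_D[OF Z]
  note vS = V1_D[OF W1_V1[OF vz(1)]] W1_D[OF vz(1)]
  note \<theta>L = Sob1_L2[OF vz(2)]
  \<comment> \<open>Testing with \<open>(0, 0, \<phi>)\<close> pairs this combination with
    \<open>\<phi>'\<close>, while \<open>c\<close> contributes only \<open>rho0 P\<close> times
    \<open>r\<close> paired with \<open>\<phi>\<close>.\<close>
  define H where "H = of_real (gamma P) *\<^sub>C Dx0 P v + of_real (kappa P) *\<^sub>C Dx0 P \<theta>"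
  have "has_weak_deriv 0 (len0 P) H (- (of_real (rho0 P) *\<^sub>C r))"
    unfolding has_weak_deriv_inner_iff
  proof (intro conjI allI impI)
    show "H \<in> L2 0 (len0 P)" "- (of_real (rho0 P) *\<^sub>C r) \<in> L2 0 (len0 P)"
      using vS \<theta>L V(2) by (simp_all add: H_def L2.S_closed)
    fix \<phi> assume \<phi>: "test_function 0 (len0 P) \<phi>"
    have D: "Dx0 P (f0 \<phi>) = f0 (ddx \<phi>)"
      by (rule weak_deriv_eqI[OF restr_smooth(1)[OF len0_pos test_function_smooth[OF \<phi>]]])
    have L: "f0 \<phi> \<in> L2 0 (len0 P)" "f0 (ddx \<phi>) \<in> L2 0 (len0 P)"
      using test_function_continuous[OF \<phi>] by (auto intro: fn_L2)
    show "inner0 P H (f0 (ddx \<phi>)) = - inner0 P (- (of_real (rho0 P) *\<^sub>C r)) (f0 \<phi>)"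
      using eq[OF test_theta_W2[OF \<phi>]] form_c_theta_test[OF w[unfolded pqr]] vS \<theta>L V(2) L uy
      by (simp add: pqr H_def D form_a2_def weak_deriv_zero L2.S_closed L2.ip_simps algebra_simps del: form_c.simps)
  qed
  then have "H \<in> Sob 1 0 (len0 P)" by (rule has_weak_deriv_Sob1)
  \<comment> \<open>Since \<open>v\<close> has two weak derivatives, the coupling term can be
    removed within H^1.\<close>
  then have "H - of_real (gamma P) *\<^sub>C Dx0 P v \<in> Sob 1 0 (len0 P)" using vS by (simp add: h1.S_closed)
  then have "of_real (kappa P) *\<^sub>C Dx0 P \<theta> \<in> Sob 1 0 (len0 P)" by (simp add: H_def)
  then have "Dx0 P \<theta> \<in> Sob 1 0 (len0 P)" by (rule Sob1_cscale_cancel) (use pos in simp)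
  then show "\<theta> \<in> Sob 2 0 (len0 P)" using vz(2) by (simp add: Sob2_iff)
  define b1 where "b1 = of_real (beta1 P) *\<^sub>C Dx0 P (Dx0 P u)"
  define b2 where "b2 = of_real (beta2 P) *\<^sub>C Dx1 P (Dx1 P y)"
  have b: "b1 \<in> L2 0 (len0 P)" "b2 \<in> L2 (len0 P) (len P)" using uy by (simp_all add: b1_def b2_def L2.S_closed)
  define G where "G = of_real (rho1 P) *\<^sub>C p + of_real (rho2 P) *\<^sub>C q"
  define F where "F = of_real (alpha1 P) *\<^sub>C Dx0 P p + of_real (alpha2 P) *\<^sub>C Dx1 P q"
  define T where "T = of_real (gamma P) *\<^sub>C Dx0 P \<theta>"
  have T: "T \<in> L2 0 (len0 P)" using \<theta>L by (simp add: T_def L2.S_closed)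
  \<comment> \<open>The coupling term lives on the left piece and is zero on the right one; it may
    jump at the interface, but as an L2 function it is admissible on the whole interval.\<close>
  then have T': "T \<in> L2 0 (len P)" using L2_mono[of T 0 "len0 P" 0 "len P"] len0_less by simp
  have FG: "F \<in> L2 0 (len P)" "G \<in> L2 0 (len P)"
    unfolding F_def G_def by (intro L2_glue L2.S_closed(3) S)+
  \<comment> \<open>A primitive of the zero-order term: \<open>G\<close> paired with
    \<open>\<phi>\<close> becomes \<open>- R\<close> paired with \<open>\<phi>'\<close>, so that
    only \<open>\<phi>'\<close> and \<open>\<phi>''\<close> remain.\<close>
  define R where "R = restr 0 (len P) (prim (rep_aefun G))"
  have R: "has_weak_deriv 0 (len P) R G"
  proof (rule has_weak_deriv_primI[OF _ FG(2)])
    have c: "continuous_on UNIV (prim (rep_aefun G))" by (rule continuous_on_prim[OF FG(2)])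
    show "R \<in> L2 0 (len P)" unfolding R_def by (rule fn_L2[OF c])
    show "agrees_on 0 (len P) R (\<lambda>x. 0 + prim (rep_aefun G) x)"
      unfolding agrees_on_iff R_def using rep_restr[OF c, of 0 "len P"] by eventually_elim auto
  qed
  then have RL: "R \<in> L2 0 (len P)" by (simp add: has_weak_deriv_def)
  have "\<exists>k. has_weak_deriv 0 (len P) (b1 + b2) ((R - F - T) - restr 0 (len P) (\<lambda>_. k))"
  proof (rule weak_deriv_of_second_order_identity[OF len_pos L2_glue[OF b]])
    show "R - F - T \<in> L2 0 (len P)" using RL FG T' by (simp add: L2.S_closed)
    fix \<phi> assume \<phi>: "test_function 0 (len P) \<phi>"
    note \<phi>' = test_function_deriv[OF \<phi>]
    note \<phi>'' = test_function_deriv[OF \<phi>']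
    have L: "f0 \<phi> \<in> L2 0 (len0 P)" "f1 \<phi> \<in> L2 (len0 P) (len P)"
      "f0 (ddx \<phi>) \<in> L2 0 (len0 P)" "f1 (ddx \<phi>) \<in> L2 (len0 P) (len P)"
      "f0 (ddx (ddx \<phi>)) \<in> L2 0 (len0 P)" "f1 (ddx (ddx \<phi>)) \<in> L2 (len0 P) (len P)"
      "restr 0 (len P) (ddx \<phi>) \<in> L2 0 (len P)"
      using test_function_continuous[OF \<phi>] test_function_continuous[OF \<phi>'] by (auto intro: fn_L2)
    have 1: "L2_inner 0 (len P) (b1 + b2) (restr 0 (len P) (ddx (ddx \<phi>))) = form_a2 (u, y) (f0 \<phi>, f1 \<phi>, 0)"
      using inner_glue_test[OF b \<phi>''] uy L test_V1(2,3)[OF \<phi>] test_V1(2,3)[OF \<phi>']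
      by (simp add: form_a2_def b1_def b2_def L2.ip_simps)
    have 2: "form_b P (v, z, \<theta>) (f0 \<phi>, f1 \<phi>, 0) = - L2_inner 0 (len P) T (restr 0 (len P) (ddx \<phi>))"
    proof -
      have "L2_inner 0 (len P) T (restr 0 (len P) (ddx \<phi>)) = inner0 P T (f0 (ddx \<phi>))"
        using inner_glue_test[OF T L2.S_closed(1) \<phi>'] L by simp
      then show ?thesis
        using vS \<theta>L L test_V1(2)[OF \<phi>] by (simp add: T_def weak_deriv_zero L2.ip_simps)
    qed
    have 3: "L2_inner 0 (len P) R (restr 0 (len P) (ddx \<phi>)) = - L2_inner 0 (len P) G (restr 0 (len P) \<phi>)"
      using R \<phi> unfolding has_weak_deriv_inner_iff by blast
    show "L2_inner 0 (len P) (b1 + b2) (restr 0 (len P) (ddx (ddx \<phi>)))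
        = - L2_inner 0 (len P) (R - F - T) (restr 0 (len P) (ddx \<phi>))"
    proof -
      have "L2_inner 0 (len P) G (restr 0 (len P) \<phi>) + L2_inner 0 (len P) F (restr 0 (len P) (ddx \<phi>))
          = - L2_inner 0 (len P) T (restr 0 (len P) (ddx \<phi>)) + L2_inner 0 (len P) (b1 + b2) (restr 0 (len P) (ddx (ddx \<phi>)))"
        using eq[OF test_W2[OF \<phi>]] form_c_test[OF w[unfolded pqr] \<phi>]
        unfolding 1 2 pqr G_def[symmetric] F_def[symmetric] by (rule back_subst[of "\<lambda>c. c = _"])
      then have "L2_inner 0 (len P) (b1 + b2) (restr 0 (len P) (ddx (ddx \<phi>)))
          = L2_inner 0 (len P) G (restr 0 (len P) \<phi>) + L2_inner 0 (len P) F (restr 0 (len P) (ddx \<phi>))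
            + L2_inner 0 (len P) T (restr 0 (len P) (ddx \<phi>))" by simp
      then show ?thesis using RL FG T' L(7) by (simp add: 3 L2.S_closed L2.ip_simps)
    qed
  qed
  then obtain K where K: "has_weak_deriv 0 (len P) (b1 + b2) K" by blast
  then have "K \<in> L2 0 (len P)" by (simp add: has_weak_deriv_def)
  \<comment> \<open>The derivative \<open>K\<close> is merely in L2 and may jump at the interface,
    so it is cut there. Its primitive \<open>b1 + b2\<close> cannot jump, which is the transmission
    condition.\<close>
  then obtain k1 k2 where k: "k1 \<in> L2 0 (len0 P)" "k2 \<in> L2 (len0 P) (len P)" "K = k1 + k2"
    using L2_split[OF len0_pos len0_less] by blast
  note un = unglue_weak_deriv[OF len0_pos len0_less b(1) k(1) b(2) k(2) K[unfolded k(3)]]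
  have u2: "Dx0 P (Dx0 P u) \<in> Sob 1 0 (len0 P)"
    by (rule Sob1_cscale_cancel[OF has_weak_deriv_Sob1[OF un(1)[unfolded b1_def]]]) (use pos in simp)
  have y2: "Dx1 P (Dx1 P y) \<in> Sob 1 (len0 P) (len P)"
    by (rule Sob1_cscale_cancel[OF has_weak_deriv_Sob1[OF un(2)[unfolded b2_def]]]) (use pos in simp)
  show "u \<in> Sob 3 0 (len0 P)" "y \<in> Sob 3 (len0 P) (len P)"
    using uy u2 y2 by (simp_all add: Sob3_iff Sob2_iff)
  show "of_real (beta1 P) * val0 P (Dx0 P (Dx0 P u)) (len0 P) = of_real (beta2 P) * val1 P (Dx1 P (Dx1 P y)) (len0 P)"
    using un(3) u2 y2 len0_pos len0_less by (simp add: b1_def b2_def point_val_scaleC)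
qed

end

section \<open>The resolvent\<close>

lemma dcauchy_add:
  assumes "dcauchy d" "dcauchy d'"
  shows "dcauchy (\<lambda>m n. d m n + d' m n)"
  unfolding dcauchy_def
proof (intro allI impI)
  fix e :: real assume e: "e > 0"
  obtain N where N: "\<And>m n. m \<ge> N \<Longrightarrow> n \<ge> N \<Longrightarrow> d m n < e / 2"
    using assms(1) e unfolding dcauchy_def by (meson half_gt_zero)
  obtain N' where N': "\<And>m n. m \<ge> N' \<Longrightarrow> n \<ge> N' \<Longrightarrow> d' m n < e / 2"
    using assms(2) e unfolding dcauchy_def by (meson half_gt_zero)
  show "\<exists>N. \<forall>m\<ge>N. \<forall>n\<ge>N. d m n + d' m n < e"
  proof (intro exI[of _ "max N N'"] allI impI)
    fix m n assume "max N N' \<le> m" "max N N' \<le> n"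
    then show "d m n + d' m n < e" using N[of m n] N'[of m n] by simp
  qed
qed

text \<open>Needed because the estimate for differences of solutions bounds the square of their
  \<open>a\<close>-norm.\<close>

lemma dcauchy_sqrt:
  assumes "dcauchy (\<lambda>m n. (d m n)\<^sup>2)"
  shows "dcauchy d"
  unfolding dcauchy_def
proof (intro allI impI)
  fix e :: real assume e: "e > 0"
  then have "0 < e\<^sup>2" by simp
  then obtain N where N: "\<And>m n. m \<ge> N \<Longrightarrow> n \<ge> N \<Longrightarrow> (d m n)\<^sup>2 < e\<^sup>2"
    using assms unfolding dcauchy_def by meson
  show "\<exists>N. \<forall>m\<ge>N. \<forall>n\<ge>N. d m n < e"
    using N e by (meson less_imp_le power2_less_imp_less)
qed

context beam
begin

section \<open>The form of the eliminated problem, its boundedness and coercivity\<close>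

definition pr :: "triple \<Rightarrow> pair" where "pr U = (fst U, fst (snd U))"

lemma pr_simps [simp]: "pr (u, y, \<theta>) = (u, y)" "pr (U + U') = pr U + pr U'" "pr (U - U') = pr U - pr U'"
    "pr (k *\<^sub>C U) = k *\<^sub>C pr U" "pr 0 = 0"
  by (simp_all add: pr_def scaleC_prod_def zero_prod_def)

lemma pr_W1: "U \<in> W2 P \<Longrightarrow> pr U \<in> W1 P"
  by (cases U) (simp add: W2_iff)

lemma clin_pr: "clinear_on (W2 P) (W1 P) pr"
  using clin_W2_W1 by (simp add: pr_def[abs_def])

lemma form_a2_pr: "form_a2 Z U = form_a P Z (pr U)"
  by (simp add: form_a2_def pr_def)

definition form_B :: "triple \<Rightarrow> triple \<Rightarrow> complex" where
  "form_B U V = form_c P U V + form_b P U V + form_a P (pr U) (pr V)"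

lemma sesq_form_B: "sesquilinear_on (W2 P) form_B"
  unfolding form_B_def[abs_def]
  by (intro sesq_plus sesq_form_b sesq_pullback[OF clin_pr clin_pr sesq_form_a] sesq_subset[OF sesq_form_c])
     (use W2_V2 in auto)

lemma W2_norms:
  assumes "(u, y, \<theta>) \<in> W2 P"
  shows "n0 (Dx0 P u) \<le> sqrt (1 / kmin) * nV (u, y, \<theta>)"
    "n0 (Dx0 P u) \<le> sqrt (1 / kmin) * nW (u, y, \<theta>)" "n0 (Dx0 P \<theta>) \<le> sqrt (1 / kmin) * nW (u, y, \<theta>)"
    "0 \<le> n0 (Dx0 P u)" "0 \<le> n0 (Dx0 P \<theta>)" "Dx0 P u \<in> L2 0 (len0 P)" "Dx0 P \<theta> \<in> L2 0 (len0 P)"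
    "h0 \<theta> \<le> (sqrt (1 / kmin) + sqrt (1 / kmin)) * nW (u, y, \<theta>)"
proof -
  have Z: "(u, y) \<in> W1 P" and t: "\<theta> \<in> Sob 1 0 (len0 P)" using assms by (auto simp: W2_iff intro: H10_Sob1)
  note S = V1_D[OF W1_V1[OF Z]]
  have k: "0 \<le> sqrt (1 / kmin)" using kmin(1) by simp
  have VW: "sqrt (1 / kmin) * nV (u, y, \<theta>) \<le> sqrt (1 / kmin) * nW (u, y, \<theta>)"
    by (rule mult_left_mono[OF nW_ge(1)[OF assms] k])
  show 1: "n0 (Dx0 P u) \<le> sqrt (1 / kmin) * nV (u, y, \<theta>)"
    using L2_norm_le_h1(2)[OF S(1)] V_bounds(1)[OF W2_V2[OF assms]] by simp
  show "n0 (Dx0 P u) \<le> sqrt (1 / kmin) * nW (u, y, \<theta>)" using 1 VW by simp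
  show 2: "n0 (Dx0 P \<theta>) \<le> sqrt (1 / kmin) * nW (u, y, \<theta>)" by (rule nW_ge(3)[OF assms])
  show L: "Dx0 P u \<in> L2 0 (len0 P)" "Dx0 P \<theta> \<in> L2 0 (len0 P)" using S Sob1_L2(2)[OF t] by auto
  show "0 \<le> n0 (Dx0 P u)" "0 \<le> n0 (Dx0 P \<theta>)" using L by (auto intro: L2_norm_nonneg)
  show "h0 \<theta> \<le> (sqrt (1 / kmin) + sqrt (1 / kmin)) * nW (u, y, \<theta>)"
    using L2_norm_le_h1(3)[OF t] V_bounds(3)[OF W2_V2[OF assms]] VW 2 by (simp add: distrib_right)
qed

lemma inner_le: "f \<in> L2 a b \<Longrightarrow> g \<in> L2 a b \<Longrightarrow> cmod (L2_inner a b f g) \<le> L2_norm a b f * L2_norm a b g"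
  using L2.cauchy_schwarz by (simp add: L2_norm_form_norm)

lemma form_b_bound:
  obtains M where "0 \<le> M" "\<And>U V. U \<in> W2 P \<Longrightarrow> V \<in> W2 P \<Longrightarrow> cmod (form_b P U V) \<le> M * nW U * nW V"
proof -
  define s where "s = sqrt (1 / kmin)"
  define M where "M = \<bar>gamma P\<bar> * (s * s + s * s) + kappa P * (s * s)"
  have s: "0 \<le> s" using kmin(1) by (simp add: s_def)
  have "cmod (form_b P U V) \<le> M * nW U * nW V" if U: "U \<in> W2 P" and V: "V \<in> W2 P" for U V
  proof -
    obtain u y \<theta> where Ueq: "U = (u, y, \<theta>)" by (cases U)
    obtain u' y' \<theta>' where Veq: "V = (u', y', \<theta>')" by (cases V)
    note a = W2_norms[OF U[unfolded Ueq], folded Ueq s_def] and b = W2_norms[OF V[unfolded Veq], folded Veq s_def]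
    have prod: "cmod (inner0 P f g) \<le> s * s * (nW U * nW V)"
      if "f \<in> L2 0 (len0 P)" "g \<in> L2 0 (len0 P)" "n0 f \<le> s * nW U" "n0 g \<le> s * nW V" for f g
    proof -
      have "cmod (inner0 P f g) \<le> n0 f * n0 g" by (rule inner_le[OF that(1,2)])
      also have "\<dots> \<le> (s * nW U) * (s * nW V)"
        using that s W.nrm_nonneg[OF U] by (intro mult_mono L2_norm_nonneg mult_nonneg_nonneg)
      finally show ?thesis by (simp add: mult_ac)
    qed
    have "cmod (form_b P U V) \<le> \<bar>gamma P\<bar> * (cmod (inner0 P (Dx0 P u) (Dx0 P \<theta>')) + cmod (inner0 P (Dx0 P \<theta>) (Dx0 P u')))
        + kappa P * cmod (inner0 P (Dx0 P \<theta>) (Dx0 P \<theta>'))"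
      unfolding Ueq Veq form_b.simps using pos
      by (intro order_trans[OF norm_triangle_ineq] add_mono)
         (auto simp: norm_mult intro!: mult_left_mono norm_triangle_ineq4)
    also have "\<dots> \<le> \<bar>gamma P\<bar> * (s * s * (nW U * nW V) + s * s * (nW U * nW V)) + kappa P * (s * s * (nW U * nW V))"
      using pos a b by (intro add_mono mult_left_mono prod) auto
    also have "\<dots> = M * nW U * nW V" by (simp add: M_def algebra_simps)
    finally show ?thesis .
  qed
  moreover have "0 \<le> M" using s pos by (simp add: M_def)
  ultimately show thesis using that by blast
qed

lemma nA_pr_le: "U \<in> W2 P \<Longrightarrow> nA (pr U) \<le> nW U"
  by (cases U) (use nW_ge(2) in simp)

lemma nV_le: "U \<in> W2 P \<Longrightarrow> nV U \<le> nW U"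
  by (cases U) (use nW_ge(1) in simp)

lemma form_B_bound:
  obtains M where "\<And>U V. U \<in> W2 P \<Longrightarrow> V \<in> W2 P \<Longrightarrow> cmod (form_B U V) \<le> M * nW U * nW V"
proof -
  obtain M where M: "0 \<le> M" "\<And>U V. U \<in> W2 P \<Longrightarrow> V \<in> W2 P \<Longrightarrow> cmod (form_b P U V) \<le> M * nW U * nW V"
    using form_b_bound by blast
  \<comment> \<open>\<open>M\<close> bounds \<open>b\<close>; the two ones stand for
    \<open>c\<close> and \<open>a\<close>, whose norms are both below \<open>nW\<close>.\<close>
  have "cmod (form_B U V) \<le> (1 + M + 1) * nW U * nW V" if UV: "U \<in> W2 P" "V \<in> W2 P" for U V
  proof -
    have "cmod (form_c P U V) \<le> nV U * nV V" using UV by (intro V.cauchy_schwarz W2_V2)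
    also have "\<dots> \<le> nW U * nW V"
      using UV by (intro mult_mono nV_le W.nrm_nonneg V.nrm_nonneg W2_V2)
    finally have 1: "cmod (form_c P U V) \<le> nW U * nW V" .
    have "cmod (form_a P (pr U) (pr V)) \<le> nA (pr U) * nA (pr V)" using UV by (intro A.cauchy_schwarz pr_W1)
    also have "\<dots> \<le> nW U * nW V"
      using UV by (intro mult_mono nA_pr_le W.nrm_nonneg A.nrm_nonneg pr_W1)
    finally have 2: "cmod (form_a P (pr U) (pr V)) \<le> nW U * nW V" .
    have "cmod (form_B U V) \<le> cmod (form_c P U V) + cmod (form_b P U V) + cmod (form_a P (pr U) (pr V))"
      unfolding form_B_def by (intro order_trans[OF norm_triangle_ineq] add_right_mono norm_triangle_ineq)
    then show ?thesis using 1 2 M(2)[OF UV] by (simp add: algebra_simps)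
  qed
  then show thesis by (rule that)
qed

text \<open>On the diagonal the two \<open>gamma\<close> terms are conjugate to each other with
  opposite signs, so their sum is imaginary. Of \<open>b\<close> only the \<open>kappa\<close> term
  remains, and \<open>form_w\<close> is made to match.\<close>

lemma form_B_coercive:
  assumes "U \<in> W2 P"
  shows "Re (form_B U U) = (nW U)\<^sup>2"
proof -
  obtain u y \<theta> where U: "U = (u, y, \<theta>)" by (cases U)
  note W = assms[unfolded U]
  note L = W2_norms(6,7)[OF W]
  have "inner0 P (Dx0 P \<theta>) (Dx0 P u) = cnj (inner0 P (Dx0 P u) (Dx0 P \<theta>))" using L by (simp add: L2.cnj_ip)
  then have "Re (form_b P U U) = kappa P * (n0 (Dx0 P \<theta>))\<^sup>2" by (simp add: U inner_self[OF L(2)])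
  then show ?thesis
    unfolding form_B_def U pr_simps plus_complex.simps
    by (simp add: nW_sq[OF W] V.nrm_sq[OF W2_V2[OF W]] A.nrm_sq[OF pr_W1[OF W], unfolded pr_simps]
        del: form_c.simps form_a.simps form_b.simps)
qed

text \<open>The resolvent equation for \<open>\<Phi>\<close> and the datum \<open>F\<close> with
  \<open>C\<close> applied to its second component. It is free of inverses and descriptions and
  compatible with sums and multiples.\<close>

definition solves :: "pair \<times> triple \<Rightarrow> pair \<times> triple \<Rightarrow> bool" where
  "solves \<Phi> F \<longleftrightarrow> fst \<Phi> \<in> W1 P \<and> snd \<Phi> \<in> W2 P \<and> fst \<Phi> - pr (snd \<Phi>) = fst F \<and>
    (\<forall>U\<in>W2 P. form_c P (snd \<Phi>) U + form_b P (snd \<Phi>) U + form_a P (fst \<Phi>) (pr U) = form_c P (snd F) U)"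

lemma energy_space_iff: "F \<in> energy_space P \<longleftrightarrow> fst F \<in> W1 P \<and> snd F \<in> V2 P"
  by (cases F) (simp add: energy_space_def)

lemma csub_energy: "csubspace (energy_space P)"
  unfolding energy_space_def by (rule csub_prod[OF csub_W1 csub_V2])

lemma dom_A_image:
  assumes "\<Phi> \<in> dom_A P"
  shows "\<Phi> - op_A P \<Phi> \<in> energy_space P" "solves \<Phi> (\<Phi> - op_A P \<Phi>)"
proof -
  obtain \<Phi>1 \<Phi>2 where \<Phi>: "\<Phi> = (\<Phi>1, \<Phi>2)" by (cases \<Phi>)
  obtain w where W: "\<Phi>1 \<in> W1 P" "\<Phi>2 \<in> W2 P" and w: "w \<in> V2 P"
    and eq: "\<And>U. U \<in> W2 P \<Longrightarrow> form_c P w U = form_b P \<Phi>2 U + form_a2 \<Phi>1 U"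
    using assms unfolding \<Phi> dom_A_iff by blast
  have d: "\<Phi> - op_A P \<Phi> = (\<Phi>1 - pr \<Phi>2, \<Phi>2 + w)"
  proof -
    have "op_A P (\<Phi>1, \<Phi>2) = ((fst \<Phi>2, fst (snd \<Phi>2)), - w)" by (rule op_A_eq[OF w]) (rule eq)
    then show ?thesis unfolding \<Phi> by (simp add: pr_def)
  qed
  show "\<Phi> - op_A P \<Phi> \<in> energy_space P"
    unfolding d energy_space_iff using W w by (simp add: A.S_closed V.S_closed pr_W1 W2_V2)
  show "solves \<Phi> (\<Phi> - op_A P \<Phi>)"
    unfolding d unfolding solves_def \<Phi> fst_conv snd_conv
  proof (intro conjI W refl ballI)
    fix U assume U: "U \<in> W2 P"
    have "form_c P (\<Phi>2 + w) U = form_c P \<Phi>2 U + form_c P w U"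
      by (rule V.ip_simps(1)[OF W2_V2[OF W(2)] w W2_V2[OF U]])
    then show "form_c P \<Phi>2 U + form_b P \<Phi>2 U + form_a P \<Phi>1 (pr U) = form_c P (\<Phi>2 + w) U"
      unfolding eq[OF U] form_a2_pr by (simp only: add.assoc)
  qed
qed

text \<open>The vector \<open>w = F2 - \<Phi>2\<close> is the witness for the domain, because the
  variational equation says that \<open>C\<close> maps it to
  \<open>B \<Phi>2 + A1 \<Phi>1\<close>.\<close>

lemma solves_dom_A:
  assumes s: "solves \<Phi> F" and F: "F \<in> energy_space P"
  shows "\<Phi> \<in> dom_A P" "\<Phi> - op_A P \<Phi> = F"
proof -
  obtain \<Phi>1 \<Phi>2 where \<Phi>: "\<Phi> = (\<Phi>1, \<Phi>2)" by (cases \<Phi>)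
  obtain F1 F2 where Feq: "F = (F1, F2)" by (cases F)
  have W: "\<Phi>1 \<in> W1 P" "\<Phi>2 \<in> W2 P" "\<Phi>1 - pr \<Phi>2 = F1" and F2: "F2 \<in> V2 P"
    and eq: "\<And>U. U \<in> W2 P \<Longrightarrow> form_c P \<Phi>2 U + form_b P \<Phi>2 U + form_a P \<Phi>1 (pr U) = form_c P F2 U"
    using s F by (auto simp: solves_def \<Phi> Feq energy_space_iff)
  define w where "w = F2 - \<Phi>2"
  have w: "w \<in> V2 P" using F2 W2_V2[OF W(2)] by (simp add: w_def V.S_closed)
  have eqw: "form_c P w U = form_b P \<Phi>2 U + form_a2 \<Phi>1 U" if U: "U \<in> W2 P" for U
    unfolding w_def V.ip_simps(7)[OF F2 W2_V2[OF W(2)] W2_V2[OF U]] form_a2_pr eq[OF U, symmetric] by (simp only: add_diff_cancel_left' add.assoc)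
  show "\<Phi> \<in> dom_A P" unfolding \<Phi> dom_A_iff using W w eqw by blast
  show "\<Phi> - op_A P \<Phi> = F"
  proof -
    have "op_A P (\<Phi>1, \<Phi>2) = ((fst \<Phi>2, fst (snd \<Phi>2)), - w)" by (rule op_A_eq[OF w]) (rule eqw)
    then show ?thesis unfolding \<Phi> Feq using W(3) by (simp add: w_def pr_def)
  qed
qed

lemma solves_add: "solves \<Phi> F \<Longrightarrow> solves \<Psi> G \<Longrightarrow> F \<in> energy_space P \<Longrightarrow> G \<in> energy_space P \<Longrightarrow> solves (\<Phi> + \<Psi>) (F + G)"
  unfolding solves_def energy_space_iff
proof (elim conjE, intro conjI ballI)
  assume W: "fst \<Phi> \<in> W1 P" "snd \<Phi> \<in> W2 P" "fst \<Psi> \<in> W1 P" "snd \<Psi> \<in> W2 P"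
    and F: "snd F \<in> V2 P" "snd G \<in> V2 P"
    and e: "fst \<Phi> - pr (snd \<Phi>) = fst F" "fst \<Psi> - pr (snd \<Psi>) = fst G"
    and eq: "\<forall>U\<in>W2 P. form_c P (snd \<Phi>) U + form_b P (snd \<Phi>) U + form_a P (fst \<Phi>) (pr U) = form_c P (snd F) U"
      "\<forall>U\<in>W2 P. form_c P (snd \<Psi>) U + form_b P (snd \<Psi>) U + form_a P (fst \<Psi>) (pr U) = form_c P (snd G) U"
  show "fst (\<Phi> + \<Psi>) \<in> W1 P" "snd (\<Phi> + \<Psi>) \<in> W2 P" using W by (simp_all add: A.S_closed W.S_closed)
  show "fst (\<Phi> + \<Psi>) - pr (snd (\<Phi> + \<Psi>)) = fst (F + G)" by (simp add: e[symmetric])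
  fix U assume U: "U \<in> W2 P"
  show "form_c P (snd (\<Phi> + \<Psi>)) U + form_b P (snd (\<Phi> + \<Psi>)) U + form_a P (fst (\<Phi> + \<Psi>)) (pr U) = form_c P (snd (F + G)) U"
    unfolding snd_add fst_add V.ip_simps(1)[OF F W2_V2[OF U]] eq[rule_format, OF U, symmetric]
      V.ip_simps(1)[OF W2_V2[OF W(2)] W2_V2[OF W(4)] W2_V2[OF U]] sesq_addL[OF sesq_form_b W(2,4) U]
      A.ip_simps(1)[OF W(1,3) pr_W1[OF U]]
    by (simp only: ac_simps)
qed

lemma solves_scaleC: "solves \<Phi> F \<Longrightarrow> F \<in> energy_space P \<Longrightarrow> solves (k *\<^sub>C \<Phi>) (k *\<^sub>C F)"
  unfolding solves_def energy_space_iff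
proof (elim conjE, intro conjI ballI)
  assume W: "fst \<Phi> \<in> W1 P" "snd \<Phi> \<in> W2 P" and F: "snd F \<in> V2 P"
    and e: "fst \<Phi> - pr (snd \<Phi>) = fst F"
    and eq: "\<forall>U\<in>W2 P. form_c P (snd \<Phi>) U + form_b P (snd \<Phi>) U + form_a P (fst \<Phi>) (pr U) = form_c P (snd F) U"
  have sc: "fst (k *\<^sub>C X) = k *\<^sub>C fst X" "snd (k *\<^sub>C X) = k *\<^sub>C snd X" for X :: "pair \<times> triple"
    by (simp_all add: scaleC_prod_def)
  show "fst (k *\<^sub>C \<Phi>) \<in> W1 P" "snd (k *\<^sub>C \<Phi>) \<in> W2 P" using W by (simp_all add: sc A.S_closed W.S_closed)
  have "k *\<^sub>C f - k *\<^sub>C g = k *\<^sub>C (f - g)" for f g :: aefun by transfer (auto simp: algebra_simps)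
  then have "k *\<^sub>C Z - k *\<^sub>C Z' = k *\<^sub>C (Z - Z')" for Z Z' :: pair by (simp add: scaleC_prod_def)
  then show "fst (k *\<^sub>C \<Phi>) - pr (snd (k *\<^sub>C \<Phi>)) = fst (k *\<^sub>C F)" by (simp add: sc e[symmetric])
  fix U assume U: "U \<in> W2 P"
  show "form_c P (snd (k *\<^sub>C \<Phi>)) U + form_b P (snd (k *\<^sub>C \<Phi>)) U + form_a P (fst (k *\<^sub>C \<Phi>)) (pr U) = form_c P (snd (k *\<^sub>C F)) U"
    unfolding sc V.ip_simps(3)[OF F W2_V2[OF U]] eq[rule_format, OF U, symmetric]
      V.ip_simps(3)[OF W2_V2[OF W(2)] W2_V2[OF U]] sesq_scaleL[OF sesq_form_b W(2) U]
      A.ip_simps(3)[OF W(1) pr_W1[OF U]]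
    by (simp only: distrib_left)
qed

lemma solves_diff:
  assumes "solves \<Phi> F" "solves \<Psi> G" "F \<in> energy_space P" "G \<in> energy_space P"
  shows "solves (\<Phi> - \<Psi>) (F - G)"
proof -
  have m: "(-1) *\<^sub>C X = - X" for X :: "pair \<times> triple"
    using scaleR_eq_scaleC[of "-1" X] by simp
  have "solves (- \<Psi>) (- G)" using solves_scaleC[OF assms(2,4), of "-1"] by (simp only: m)
  then show ?thesis
    using solves_add[OF assms(1) _ assms(3) csub_minus[OF csub_energy assms(4)], of "- \<Psi>"] by simp
qed

lemma energy_norm_eq:
  assumes "F \<in> energy_space P"
  shows "energy_norm P F = sqrt ((nA (fst F))\<^sup>2 + (nV (snd F))\<^sup>2)"
  using assms A.nrm_sq[of "fst F"] V.nrm_sq[of "snd F"]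
  by (cases F) (simp add: energy_norm_def energy_space_iff)

lemma energy_norm_bounds:
  assumes "F \<in> energy_space P"
  shows "nA (fst F) \<le> energy_norm P F" "nV (snd F) \<le> energy_norm P F"
    "energy_norm P F \<le> nA (fst F) + nV (snd F)" "0 \<le> energy_norm P F"
  unfolding energy_norm_eq[OF assms]
  using A.nrm_nonneg[of "fst F"] V.nrm_nonneg[of "snd F"] assms
  by (auto simp: energy_space_iff intro: real_le_rsqrt sqrt_sum_squares_le_sum)

text \<open>The equation is tested with \<open>snd \<Phi>\<close>. Replacing
  \<open>fst \<Phi>\<close> by \<open>fst F + pr (snd \<Phi>)\<close> makes the left side
  \<open>form_B\<close> on the diagonal, which is \<open>(nW (snd \<Phi>))^2\<close>; one factor is
  then divided out.\<close>

lemma solves_estimate: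
  assumes s: "solves \<Phi> F" and F: "F \<in> energy_space P"
  shows "nW (snd \<Phi>) \<le> nA (fst F) + nV (snd F)"
proof (cases "nW (snd \<Phi>) = 0")
  case True
  then show ?thesis using F A.nrm_nonneg V.nrm_nonneg by (simp add: energy_space_iff)
next
  case False
  have W: "fst \<Phi> \<in> W1 P" "snd \<Phi> \<in> W2 P" and F2: "fst F \<in> W1 P" "snd F \<in> V2 P"
    and e: "fst \<Phi> - pr (snd \<Phi>) = fst F"
    and eq: "form_c P (snd \<Phi>) (snd \<Phi>) + form_b P (snd \<Phi>) (snd \<Phi>) + form_a P (fst \<Phi>) (pr (snd \<Phi>)) = form_c P (snd F) (snd \<Phi>)"
    using s F by (auto simp: solves_def energy_space_iff)
  note p = pr_W1[OF W(2)]
  have "form_a P (fst \<Phi>) (pr (snd \<Phi>)) = form_a P (fst F) (pr (snd \<Phi>)) + form_a P (pr (snd \<Phi>)) (pr (snd \<Phi>))"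
    using A.ip_simps(1)[OF F2(1) p p] e by (simp add: algebra_simps)
  then have "form_B (snd \<Phi>) (snd \<Phi>) = form_c P (snd F) (snd \<Phi>) - form_a P (fst F) (pr (snd \<Phi>))"
    using eq by (simp add: form_B_def algebra_simps)
  then have "(nW (snd \<Phi>))\<^sup>2 = Re (form_c P (snd F) (snd \<Phi>) - form_a P (fst F) (pr (snd \<Phi>)))"
    using form_B_coercive[OF W(2)] by simp
  also have "\<dots> \<le> cmod (form_c P (snd F) (snd \<Phi>)) + cmod (form_a P (fst F) (pr (snd \<Phi>)))"
    by (rule order_trans[OF complex_Re_le_cmod norm_triangle_ineq4])
  also have "\<dots> \<le> nV (snd F) * nV (snd \<Phi>) + nA (fst F) * nA (pr (snd \<Phi>))"
    by (intro add_mono V.cauchy_schwarz A.cauchy_schwarz F2 p W2_V2 W)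
  also have "\<dots> \<le> nV (snd F) * nW (snd \<Phi>) + nA (fst F) * nW (snd \<Phi>)"
    by (intro add_mono mult_left_mono nV_le nA_pr_le W V.nrm_nonneg A.nrm_nonneg F2)
  finally show ?thesis
    using False W.nrm_nonneg[OF W(2)] by (simp add: power2_eq_square distrib_right[symmetric] add.commute)
qed

text \<open>The difference solves the homogeneous equation, so the estimate and
  \<open>V_definite\<close> remove its second component; the first one is determined by the
  second.\<close>

lemma solves_unique:
  assumes "solves \<Phi> F" "solves \<Psi> F" "F \<in> energy_space P"
  shows "\<Phi> = \<Psi>"
proof -
  have s: "solves (\<Phi> - \<Psi>) 0" using solves_diff[OF assms(1,2,3,3)] by simp
  have n0: "nA 0 = 0" "nV 0 = 0"
    using A.ip_simps(9)[OF A.S_closed(1)] V.ip_simps(9)[OF V.S_closed(1)] by (simp_all add: form_norm_def)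
  have W: "snd (\<Phi> - \<Psi>) \<in> W2 P" and e: "fst (\<Phi> - \<Psi>) - pr (snd (\<Phi> - \<Psi>)) = 0"
    using s by (auto simp: solves_def)
  have "nW (snd (\<Phi> - \<Psi>)) \<le> 0" using solves_estimate[OF s csub_zero[OF csub_energy]] by (simp add: n0)
  then have "nV (snd (\<Phi> - \<Psi>)) = 0"
    using nV_le[OF W] V.nrm_nonneg[OF W2_V2[OF W]] by simp
  then have 2: "snd (\<Phi> - \<Psi>) = 0" by (rule V_definite[OF W2_V2[OF W]])
  then have "fst (\<Phi> - \<Psi>) = 0" using e by simp
  with 2 show ?thesis by (simp add: prod_eq_iff)
qed

lemma solves_exists:
  assumes F: "F \<in> energy_space P"
  shows "\<exists>\<Phi>. solves \<Phi> F"
proof -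
  have F2: "fst F \<in> W1 P" "snd F \<in> V2 P" using F by (auto simp: energy_space_iff)
  obtain M where M: "\<And>U V. U \<in> W2 P \<Longrightarrow> V \<in> W2 P \<Longrightarrow> cmod (form_B U V) \<le> M * nW U * nW V"
    using form_B_bound by blast
  \<comment> \<open>Eliminating the first component moves the part of \<open>a\<close> that involves
    \<open>fst F\<close> to the right side.\<close>
  define l where "l U = form_c P (snd F) U - form_a P (fst F) (pr U)" for U
  have "\<exists>U\<in>W2 P. \<forall>V\<in>W2 P. form_B U V = l V"
  proof (rule W.lax_milgram[OF sesq_form_B M])
    show "(nW U)\<^sup>2 \<le> Re (form_B U U)" if "U \<in> W2 P" for U using form_B_coercive[OF that] by simp
    show "antilinear_on (W2 P) l"
      unfolding antilinear_on_def l_def using F2 pr_W1 W2_V2 by (simp add: V.ip_simps A.ip_simps right_diff_distrib)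
    show "cmod (l V) \<le> (nV (snd F) + nA (fst F)) * nW V" if V: "V \<in> W2 P" for V
    proof -
      have "cmod (l V) \<le> nV (snd F) * nV V + nA (fst F) * nA (pr V)"
        unfolding l_def
        by (intro order_trans[OF norm_triangle_ineq4] add_mono V.cauchy_schwarz A.cauchy_schwarz F2 pr_W1 W2_V2 V)
      also have "\<dots> \<le> nV (snd F) * nW V + nA (fst F) * nW V"
        by (intro add_mono mult_left_mono nV_le nA_pr_le V V.nrm_nonneg A.nrm_nonneg F2)
      finally show ?thesis by (simp add: distrib_right)
    qed
  qed
  then obtain U where U: "U \<in> W2 P" "\<And>V. V \<in> W2 P \<Longrightarrow> form_B U V = l V" by blast
  have "solves (fst F + pr U, U) F"
    unfolding solves_def fst_conv snd_conv
  proof (intro conjI ballI U(1))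
    show "fst F + pr U \<in> W1 P" using F2(1) pr_W1[OF U(1)] by (rule A.S_closed)
    fix V assume V: "V \<in> W2 P"
    show "form_c P U V + form_b P U V + form_a P (fst F + pr U) (pr V) = form_c P (snd F) V"
      using U(2)[OF V] A.ip_simps(1)[OF F2(1) pr_W1[OF U(1)] pr_W1[OF V]]
      by (simp add: form_B_def l_def algebra_simps)
  qed simp
  then show ?thesis by blast
qed

lemma bij_resolvent: "bij_betw (\<lambda>\<Phi>. \<Phi> - op_A P \<Phi>) (dom_A P) (energy_space P)"
  unfolding bij_betw_def
proof
  show "inj_on (\<lambda>\<Phi>. \<Phi> - op_A P \<Phi>) (dom_A P)"
  proof (rule inj_onI)
    fix \<Phi> \<Psi> assume *: "\<Phi> \<in> dom_A P" "\<Psi> \<in> dom_A P" "\<Phi> - op_A P \<Phi> = \<Psi> - op_A P \<Psi>"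
    show "\<Phi> = \<Psi>"
      by (rule solves_unique[OF dom_A_image(2)[OF *(1)] _ dom_A_image(1)[OF *(1)]])
         (simp only: *(3) dom_A_image(2)[OF *(2)])
  qed
  show "(\<lambda>\<Phi>. \<Phi> - op_A P \<Phi>) ` dom_A P = energy_space P"
  proof (intro equalityI subsetI)
    fix F assume F: "F \<in> energy_space P"
    then obtain \<Phi> where s: "solves \<Phi> F" using solves_exists by blast
    show "F \<in> (\<lambda>\<Phi>. \<Phi> - op_A P \<Phi>) ` dom_A P"
      using imageI[OF solves_dom_A(1)[OF s F], of "\<lambda>\<Phi>. \<Phi> - op_A P \<Phi>"] solves_dom_A(2)[OF s F] by simp
  qed (use dom_A_image in auto)
qed

text \<open>Values of the inverse are recognised by the equation they solve, so linearity of the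
  resolvent reduces to that of \<open>solves\<close>.\<close>

lemma resolvent_eq:
  assumes "solves \<Phi> F" "F \<in> energy_space P"
  shows "resolvent_A P F = \<Phi>"
  unfolding resolvent_A_def
  using the_inv_into_f_f[OF bij_betw_imp_inj_on[OF bij_resolvent] solves_dom_A(1)[OF assms]]
    solves_dom_A(2)[OF assms] by simp

lemma resolvent_solves:
  assumes "F \<in> energy_space P"
  shows "solves (resolvent_A P F) F"
  using solves_exists[OF assms] resolvent_eq[OF _ assms] by metis

text \<open>The difference of two solutions tested with \<open>(\<Delta>u, \<Delta>y, 0)\<close> bounds \<open>a(\<Delta>\<Phi>1, \<Delta>\<Phi>1)\<close> by the \<open>V2\<close>-norm
  of \<open>(\<Delta>u, \<Delta>y)\<close>, which is compact relative to the energy norm.\<close>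

lemma solves_compact_estimate:
  obtains K where "0 \<le> K" "\<And>\<Phi> F. solves \<Phi> F \<Longrightarrow> F \<in> energy_space P \<Longrightarrow>
    (nA (fst \<Phi>))\<^sup>2 \<le> K * energy_norm P F * nV (fst (fst \<Phi>), snd (fst \<Phi>), 0)"
proof -
  define s where "s = sqrt (1 / kmin)"
  have s: "0 \<le> s" using kmin(1) by (simp add: s_def)
  \<comment> \<open>The summands come from the datum, from \<open>c\<close> on the second component,
    and from the coupling term; the factors 2 reflect the bound \<open>2 * E\<close> for
    \<open>nW\<close> of the second component.\<close>
  define K where "K = 1 + 2 + \<bar>gamma P\<bar> * (s * 2 * s)"
  have K: "0 \<le> K" using s by (simp add: K_def)
  have "(nA (fst \<Phi>))\<^sup>2 \<le> K * energy_norm P F * nV (fst (fst \<Phi>), snd (fst \<Phi>), 0)"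
    if sol: "solves \<Phi> F" and F: "F \<in> energy_space P" for \<Phi> F
  proof -
    obtain u y v z \<theta> where \<Phi>: "\<Phi> = ((u, y), (v, z, \<theta>))" by (cases \<Phi>) auto
    define E where "E = energy_norm P F"
    define N where "N = nV (u, y, 0)"
    have W: "(u, y) \<in> W1 P" "(v, z, \<theta>) \<in> W2 P" and F2: "snd F \<in> V2 P"
      and eq: "\<And>U. U \<in> W2 P \<Longrightarrow> form_c P (v, z, \<theta>) U + form_b P (v, z, \<theta>) U + form_a P (u, y) (pr U) = form_c P (snd F) U"
      using sol F by (auto simp: solves_def energy_space_iff \<Phi>)
    have U: "(u, y, 0) \<in> W2 P" using W(1) csub_zero[OF csub_H10] by (simp add: W2_iff)
    note UV = W2_V2[OF U] and N0 = V.nrm_nonneg[OF W2_V2[OF U], folded N_def]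
    have E: "nV (snd F) \<le> E" "0 \<le> E" "nW (v, z, \<theta>) \<le> 2 * E"
      using energy_norm_bounds[OF F] solves_estimate[OF sol F] by (auto simp: E_def \<Phi>)
    note a = W2_norms[OF W(2), folded s_def] and b = W2_norms[OF U, folded s_def N_def]
    have 1: "cmod (form_c P (snd F) (u, y, 0)) \<le> E * N"
      by (rule order_trans[OF V.cauchy_schwarz[OF F2 UV]]) (use E N0 in \<open>auto simp: N_def intro: mult_right_mono\<close>)
    have "cmod (form_c P (v, z, \<theta>) (u, y, 0)) \<le> nV (v, z, \<theta>) * N"
      unfolding N_def by (rule V.cauchy_schwarz[OF W2_V2[OF W(2)] UV])
    also have "\<dots> \<le> 2 * E * N" using nV_le[OF W(2)] E N0 by (intro mult_right_mono) auto
    finally have 2: "cmod (form_c P (v, z, \<theta>) (u, y, 0)) \<le> 2 * E * N" .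
    \<comment> \<open>The zero third component leaves a single coupling term, in which
      \<open>u\<close> occurs with one derivative only and is thus controlled by the
      \<open>V2\<close> norm.\<close>
    have "form_b P (v, z, \<theta>) (u, y, 0) = - of_real (gamma P) * inner0 P (Dx0 P \<theta>) (Dx0 P u)"
      using a b by (simp add: weak_deriv_zero)
    then have "cmod (form_b P (v, z, \<theta>) (u, y, 0)) = \<bar>gamma P\<bar> * cmod (inner0 P (Dx0 P \<theta>) (Dx0 P u))"
      by (simp add: norm_mult)
    also have "\<dots> \<le> \<bar>gamma P\<bar> * (n0 (Dx0 P \<theta>) * n0 (Dx0 P u))"
      using a b by (intro mult_left_mono inner_le) auto
    also have "\<dots> \<le> \<bar>gamma P\<bar> * ((s * (2 * E)) * (s * N))"
    proof (intro mult_left_mono mult_mono)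
      show "n0 (Dx0 P \<theta>) \<le> s * (2 * E)" using a(3) mult_left_mono[OF E(3) s] by simp
    qed (use a b s E in auto)
    finally have 3: "cmod (form_b P (v, z, \<theta>) (u, y, 0)) \<le> \<bar>gamma P\<bar> * (s * 2 * s) * (E * N)"
      by (simp add: mult_ac)
    have "(nA (u, y))\<^sup>2 = Re (form_a P (u, y) (pr (u, y, 0)))" by (simp only: A.nrm_sq[OF W(1)] pr_simps)
    also have "form_a P (u, y) (pr (u, y, 0)) = form_c P (snd F) (u, y, 0) - form_c P (v, z, \<theta>) (u, y, 0) - form_b P (v, z, \<theta>) (u, y, 0)"
      unfolding eq[OF U, symmetric] by (simp only: add_diff_cancel_left' add.assoc)
    also have "Re \<dots> \<le> cmod (form_c P (snd F) (u, y, 0)) + cmod (form_c P (v, z, \<theta>) (u, y, 0)) + cmod (form_b P (v, z, \<theta>) (u, y, 0))"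
      by (intro order_trans[OF complex_Re_le_cmod] order_trans[OF norm_triangle_ineq4] add_right_mono norm_triangle_ineq4)
    also have "\<dots> \<le> E * N + 2 * E * N + \<bar>gamma P\<bar> * (s * 2 * s) * (E * N)"
      by (intro add_mono 1 2 3)
    also have "\<dots> = K * E * N" by (simp add: K_def algebra_simps)
    finally show ?thesis by (simp add: \<Phi> E_def N_def)
  qed
  then show thesis using that K by blast
qed

lemma resolvent_compact: "compact_operator (energy_space P) (energy_norm P) (resolvent_A P)"
  unfolding compact_operator_def
proof (intro conjI ballI allI impI)
  show "resolvent_A P F \<in> energy_space P" if "F \<in> energy_space P" for F
    using resolvent_solves[OF that] W2_V2 by (auto simp: solves_def energy_space_iff)
  show "resolvent_A P (F + G) = resolvent_A P F + resolvent_A P G"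
    if "F \<in> energy_space P" "G \<in> energy_space P" for F G
    by (intro resolvent_eq solves_add resolvent_solves that csub_add[OF csub_energy])
  show "resolvent_A P (k *\<^sub>C F) = k *\<^sub>C resolvent_A P F" if "F \<in> energy_space P" for k F
    by (intro resolvent_eq solves_scaleC resolvent_solves that csub_scaleC[OF csub_energy])
next
  fix F :: "nat \<Rightarrow> pair \<times> triple"
  assume "(\<forall>n. F n \<in> energy_space P) \<and> (\<exists>M. \<forall>n. energy_norm P (F n) \<le> M)"
  then obtain M where F: "\<And>n. F n \<in> energy_space P" and M: "\<And>n. energy_norm P (F n) \<le> M" by blast
  have M0: "0 \<le> M" using energy_norm_bounds(4)[OF F] M order_trans by blast
  define \<Phi> where "\<Phi> n = resolvent_A P (F n)" for n
  have sol: "solves (\<Phi> n) (F n)" for n unfolding \<Phi>_def by (rule resolvent_solves[OF F])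
  define u where "u n = fst (fst (\<Phi> n))" for n
  define y where "y n = snd (fst (\<Phi> n))" for n
  define v where "v n = fst (snd (\<Phi> n))" for n
  define z where "z n = fst (snd (snd (\<Phi> n)))" for n
  define \<theta> where "\<theta> n = snd (snd (snd (\<Phi> n)))" for n
  have \<Phi>eq: "\<Phi> n = ((u n, y n), (v n, z n, \<theta> n))" for n
    by (simp add: u_def y_def v_def z_def \<theta>_def)
  have W: "(u n, y n) \<in> W1 P" "(v n, z n, \<theta> n) \<in> W2 P" "(v n, z n) \<in> W1 P"
    and \<theta>: "\<theta> n \<in> Sob 1 0 (len0 P)" for n
    using sol[of n] by (auto simp: solves_def \<Phi>eq W2_iff intro: H10_Sob1)
  \<comment> \<open>The estimate involves both components of the datum, each bounded by
    \<open>M\<close>.\<close>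
  have nW2: "nW (v n, z n, \<theta> n) \<le> 2 * M" for n
    using solves_estimate[OF sol[of n] F] energy_norm_bounds(1,2)[OF F[of n]] M[of n] by (simp add: \<Phi>eq)
  have nA2: "nA (v n, z n) \<le> 2 * M" for n using nA_pr_le[OF W(2)[of n]] nW2[of n] by simp
  have nA1: "nA (u n, y n) \<le> 3 * M" for n
  proof -
    have e: "(u n, y n) - (v n, z n) = fst (F n)" using sol[of n] by (simp add: solves_def \<Phi>eq)
    have F1: "fst (F n) \<in> W1 P" using F[of n] by (simp add: energy_space_iff)
    have "(u n, y n) = fst (F n) + (v n, z n)" unfolding e[symmetric] by simp
    then have "nA (u n, y n) \<le> nA (fst (F n)) + nA (v n, z n)" using A.nrm_triangle[OF F1 W(3)] by simp
    then show ?thesis using nA2[of n] energy_norm_bounds(1)[OF F[of n]] M[of n] by simp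
  qed
  obtain C where C: "0 \<le> C" "\<And>u y. (u, y) \<in> W1 P \<Longrightarrow> h0 u \<le> C * nA (u, y) \<and> h0 (Dx0 P u) \<le> C * nA (u, y) \<and>
      h1 y \<le> C * nA (u, y) \<and> h1 (Dx1 P y) \<le> C * nA (u, y)"
    using W1_bounds by blast
  have b1: "h0 (u n) \<le> C * (3 * M)" "h0 (Dx0 P (u n)) \<le> C * (3 * M)" "h1 (y n) \<le> C * (3 * M)" "h1 (Dx1 P (y n)) \<le> C * (3 * M)" for n
    using C(2)[OF W(1)[of n]] mult_left_mono[OF nA1[of n] C(1)] by auto
  have b2: "h0 (v n) \<le> C * (2 * M)" "h0 (Dx0 P (v n)) \<le> C * (2 * M)" "h1 (z n) \<le> C * (2 * M)" "h1 (Dx1 P (z n)) \<le> C * (2 * M)" for n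
    using C(2)[OF W(3)[of n]] mult_left_mono[OF nA2[of n] C(1)] by auto
  have b3: "h0 (\<theta> n) \<le> (sqrt (1 / kmin) + sqrt (1 / kmin)) * (2 * M)" for n
    by (rule order_trans[OF W2_norms(8)[OF W(2)] mult_left_mono[OF nW2]]) (use kmin(1) in simp)
  note S1 = V1_D[OF W1_V1[OF W(1)]] W1_D[OF W(1)]
  note S2 = V1_D[OF W1_V1[OF W(3)]] W1_D[OF W(3)]
  \<comment> \<open>These are the functions and derivatives whose L2 norms make up the
    \<open>V2\<close> norms of \<open>(u, y, 0)\<close> and \<open>(v, z, \<theta>)\<close>. Each is
    bounded in H^1; \<open>\<theta>\<close> enters without its derivative because \<open>V2\<close>
    measures it in L2.\<close>
  define Q where "Q = [(0, len0 P, u), (0, len0 P, \<lambda>n. Dx0 P (u n)), (len0 P, len P, y), (len0 P, len P, \<lambda>n. Dx1 P (y n)),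
      (0, len0 P, v), (0, len0 P, \<lambda>n. Dx0 P (v n)), (len0 P, len P, z), (len0 P, len P, \<lambda>n. Dx1 P (z n)), (0, len0 P, \<theta>)]"
  have "\<exists>r. strict_mono (r :: nat \<Rightarrow> nat) \<and> (\<forall>(a, b, X) \<in> set Q. form_Cauchy (L2_inner a b) (X \<circ> r))"
  proof (rule H1_compact_list)
    fix a b X assume "(a, b, X) \<in> set Q"
    then show "a < b \<and> (\<forall>n. X n \<in> Sob 1 a b) \<and> (\<exists>M. \<forall>n. form_norm (h1_inner a b) (X n) \<le> M)"
      unfolding Q_def using len0_pos len0_less S1 S2 \<theta> b1 b2 b3 by auto
  qed
  then obtain r where r: "strict_mono (r :: nat \<Rightarrow> nat)"
    and Cau: "\<And>a b X. (a, b, X) \<in> set Q \<Longrightarrow> form_Cauchy (L2_inner a b) (X \<circ> r)" by blast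
  have Cd: "dcauchy (\<lambda>m n. L2_norm a b (X (r m) - X (r n)))" if "(a, b, X) \<in> set Q" for a b X
    using Cau[OF that] by (simp add: form_Cauchy_iff L2_norm_form_norm)
  have W1d: "(u m - u n, y m - y n) \<in> W1 P" "(v m - v n, z m - z n) \<in> W1 P" "\<theta> m - \<theta> n \<in> L2 0 (len0 P)" for m n
    using A.S_closed(6)[OF W(1) W(1), of m n] A.S_closed(6)[OF W(3) W(3), of m n] Sob1_L2(1)[OF \<theta>]
    by (simp_all add: L2.S_closed)
  have Vle: "nV (f, g, t) \<le> sqrt kmax * (n0 f + n0 (Dx0 P f) + (n1 g + n1 (Dx1 P g)) + n0 t)"
    if "(f, g) \<in> V1 P" "t \<in> L2 0 (len0 P)" for f g t
  proof -
    note S = V1_D[OF that(1)]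
    have "nV (f, g, t) \<le> sqrt kmax * (h0 f + h1 g + n0 t)" using V_bounds(4) that by (simp add: V2_iff)
    also have "\<dots> \<le> sqrt kmax * (n0 f + n0 (Dx0 P f) + (n1 g + n1 (Dx1 P g)) + n0 t)"
      using L2_norm_le_h1(3)[OF S(1)] L2_norm_le_h1(3)[OF S(2)] kmax(1) by (intro mult_left_mono add_mono) auto
    finally show ?thesis .
  qed
  have k: "0 \<le> sqrt kmax" using kmax(1) by simp
  have n00: "n0 0 = 0" using L2.ip_simps(9)[OF L2.S_closed(1)] by (simp add: L2_norm_def)
  have CV1: "dcauchy (\<lambda>m n. nV (u (r m) - u (r n), y (r m) - y (r n), 0))"
  proof (rule dcauchy_mult_le[OF _ k])
    show "dcauchy (\<lambda>m n. L2_norm 0 (len0 P) (u (r m) - u (r n)) + L2_norm 0 (len0 P) (Dx0 P (u (r m)) - Dx0 P (u (r n)))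
        + (L2_norm (len0 P) (len P) (y (r m) - y (r n)) + L2_norm (len0 P) (len P) (Dx1 P (y (r m)) - Dx1 P (y (r n)))))"
      by (intro dcauchy_add) (rule Cd, simp add: Q_def)+
    show "nV (u (r m) - u (r n), y (r m) - y (r n), 0) \<le> sqrt kmax * (n0 (u (r m) - u (r n)) + n0 (Dx0 P (u (r m)) - Dx0 P (u (r n)))
        + (n1 (y (r m) - y (r n)) + n1 (Dx1 P (y (r m)) - Dx1 P (y (r n)))))" for m n
      using Vle[OF W1_V1[OF W1d(1)] L2.S_closed(1), of "r m" "r n"]
      by (simp add: n00 weak_deriv_diff S1)
  qed
  have CV2: "dcauchy (\<lambda>m n. nV (v (r m) - v (r n), z (r m) - z (r n), \<theta> (r m) - \<theta> (r n)))"
  proof (rule dcauchy_mult_le[OF _ k])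
    show "dcauchy (\<lambda>m n. L2_norm 0 (len0 P) (v (r m) - v (r n)) + L2_norm 0 (len0 P) (Dx0 P (v (r m)) - Dx0 P (v (r n)))
        + (L2_norm (len0 P) (len P) (z (r m) - z (r n)) + L2_norm (len0 P) (len P) (Dx1 P (z (r m)) - Dx1 P (z (r n))))
        + L2_norm 0 (len0 P) (\<theta> (r m) - \<theta> (r n)))"
      by (intro dcauchy_add) (rule Cd, simp add: Q_def)+
    show "nV (v (r m) - v (r n), z (r m) - z (r n), \<theta> (r m) - \<theta> (r n)) \<le> sqrt kmax * (n0 (v (r m) - v (r n)) + n0 (Dx0 P (v (r m)) - Dx0 P (v (r n)))
        + (n1 (z (r m) - z (r n)) + n1 (Dx1 P (z (r m)) - Dx1 P (z (r n)))) + n0 (\<theta> (r m) - \<theta> (r n)))" for m n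
      using Vle[OF W1_V1[OF W1d(2)] W1d(3), of "r m" "r n" "r m" "r n"]
      by (simp add: weak_deriv_diff S2)
  qed
  obtain K where K: "0 \<le> K" "\<And>\<Phi> F. solves \<Phi> F \<Longrightarrow> F \<in> energy_space P \<Longrightarrow>
    (nA (fst \<Phi>))\<^sup>2 \<le> K * energy_norm P F * nV (fst (fst \<Phi>), snd (fst \<Phi>), 0)"
    using solves_compact_estimate by blast
  \<comment> \<open>The constant 4 counts two components of each of the two data.\<close>
  have Fd: "F m - F n \<in> energy_space P" "energy_norm P (F m - F n) \<le> 4 * M" for m n
  proof -
    show 1: "F m - F n \<in> energy_space P" by (rule csub_diff[OF csub_energy F F])
    have E: "fst (F k) \<in> W1 P" "snd (F k) \<in> V2 P" for k using F[of k] by (auto simp: energy_space_iff)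
    have "nA (fst (F m) - fst (F n)) \<le> nA (fst (F m)) + nA (fst (F n))"
      using A.nrm_triangle[OF E(1) A.S_closed(5)[OF E(1)], of m n] A.nrm_minus[OF E(1), of n] by simp
    moreover have "nV (snd (F m) - snd (F n)) \<le> nV (snd (F m)) + nV (snd (F n))"
      using V.nrm_triangle[OF E(2) V.S_closed(5)[OF E(2)], of m n] V.nrm_minus[OF E(2), of n] by simp
    ultimately show "energy_norm P (F m - F n) \<le> 4 * M"
      using energy_norm_bounds(3)[OF 1] energy_norm_bounds(1,2)[OF F[of m]] energy_norm_bounds(1,2)[OF F[of n]] M[of m] M[of n]
      by simp
  qed
  \<comment> \<open>In the product bounding the squared \<open>a\<close>-norm only the factor
    \<open>nV\<close> becomes small; the differences of the data merely stay bounded.\<close>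
  have CA: "dcauchy (\<lambda>m n. nA ((u (r m), y (r m)) - (u (r n), y (r n))))"
  proof (rule dcauchy_sqrt, rule dcauchy_mult_le[OF CV1, of "K * (4 * M)"])
    show "0 \<le> K * (4 * M)" using K(1) M0 by simp
    fix m n
    have UV: "(u (r m) - u (r n), y (r m) - y (r n), 0) \<in> V2 P"
      using W1_V1[OF W1d(1)] by (simp add: V2_iff L2.S_closed)
    have "(nA ((u (r m), y (r m)) - (u (r n), y (r n))))\<^sup>2
        \<le> K * energy_norm P (F (r m) - F (r n)) * nV (u (r m) - u (r n), y (r m) - y (r n), 0)"
      using K(2)[OF solves_diff[OF sol sol F F] Fd(1), of "r m" "r n"] by (simp add: \<Phi>eq)
    also have "\<dots> \<le> K * (4 * M) * nV (u (r m) - u (r n), y (r m) - y (r n), 0)"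
      using Fd(2) K(1) V.nrm_nonneg[OF UV] by (intro mult_right_mono mult_left_mono)
    finally show "(nA ((u (r m), y (r m)) - (u (r n), y (r n))))\<^sup>2
        \<le> K * (4 * M) * nV (u (r m) - u (r n), y (r m) - y (r n), 0)" .
  qed
  obtain x1 where x1: "x1 \<in> W1 P" "(\<lambda>n. nA ((u (r n), y (r n)) - x1)) \<longlonglongrightarrow> 0"
    using A.completeD[of "\<lambda>n. (u (r n), y (r n))"] W(1) CA unfolding form_Cauchy_iff by blast
  have "dcauchy (\<lambda>m n. nV ((v (r m), z (r m), \<theta> (r m)) - (v (r n), z (r n), \<theta> (r n))))"
    using CV2 by simp
  then obtain x2 where x2: "x2 \<in> V2 P" "(\<lambda>n. nV ((v (r n), z (r n), \<theta> (r n)) - x2)) \<longlonglongrightarrow> 0"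
    using V.completeD[of "\<lambda>n. (v (r n), z (r n), \<theta> (r n))"] W2_V2[OF W(2)] unfolding form_Cauchy_iff by blast
  have x: "(x1, x2) \<in> energy_space P" using x1 x2 by (simp add: energy_space_iff)
  have \<Phi>E: "\<Phi> n - (x1, x2) \<in> energy_space P" for n
    using csub_diff[OF csub_energy _ x, of "\<Phi> n"] W(1)[of n] W2_V2[OF W(2)[of n]]
    by (simp add: energy_space_iff \<Phi>eq)
  have "(\<lambda>n. energy_norm P (\<Phi> (r n) - (x1, x2))) \<longlonglongrightarrow> 0"
  proof (rule tendsto_zero_le[where C=1])
    show "(\<lambda>n. nA ((u (r n), y (r n)) - x1) + nV ((v (r n), z (r n), \<theta> (r n)) - x2)) \<longlonglongrightarrow> 0"
      using tendsto_add[OF x1(2) x2(2)] by simp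
    show "0 \<le> energy_norm P (\<Phi> (r n) - (x1, x2))" for n by (rule energy_norm_bounds(4)[OF \<Phi>E])
    show "energy_norm P (\<Phi> (r n) - (x1, x2)) \<le> 1 * (nA ((u (r n), y (r n)) - x1) + nV ((v (r n), z (r n), \<theta> (r n)) - x2))" for n
      using energy_norm_bounds(3)[OF \<Phi>E[of "r n"]] by (simp add: \<Phi>eq)
  qed
  then show "\<exists>r x. strict_mono r \<and> x \<in> energy_space P \<and> (\<lambda>n. energy_norm P (resolvent_A P (F (r n)) - x)) \<longlonglongrightarrow> 0"
    using r x unfolding \<Phi>_def by blast
qed

end

text \<open>\<open>resolvent_A\<close> is a \<open>the_inv_into\<close>, which is a true inverse on
  the energy space only thanks to bijectivity; this is why the bijection stands next to
  compactness.\<close>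

theorem lemma3p4:
  fixes P :: beam_params
  assumes "0 < len0 P" and "len0 P < len P"
    and "rho0 P > 0" and "rho1 P > 0" and "rho2 P > 0"
    and "alpha1 P > 0" and "alpha2 P > 0"
    and "beta1 P > 0" and "beta2 P > 0"
    and "kappa P > 0" and "gamma P \<noteq> 0"
  shows "(\<forall>u y v z \<theta>. ((u, y), (v, z, \<theta>)) \<in> dom_A P \<longrightarrow>
            (v, z) \<in> W1 P \<and>
            \<theta> \<in> Sob 2 0 (len0 P) \<inter> H10 0 (len0 P) \<and>
            (u, y) \<in> W1 P \<inter> (Sob 3 0 (len0 P) \<times> Sob 3 (len0 P) (len P)) \<and>
            of_real (beta1 P) * val0 P (Dx0 P (Dx0 P u)) (len0 P)
              = of_real (beta2 P) * val1 P (Dx1 P (Dx1 P y)) (len0 P))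
         \<and> bij_betw (\<lambda>\<Phi>. \<Phi> - op_A P \<Phi>) (dom_A P) (energy_space P)
         \<and> compact_operator (energy_space P) (energy_norm P) (resolvent_A P)"
proof -
  interpret beam P by standard (fact assms)+
  have "(v, z) \<in> W1 P \<and> \<theta> \<in> Sob 2 0 (len0 P) \<inter> H10 0 (len0 P) \<and>
      (u, y) \<in> W1 P \<inter> (Sob 3 0 (len0 P) \<times> Sob 3 (len0 P) (len P)) \<and>
      of_real (beta1 P) * val0 P (Dx0 P (Dx0 P u)) (len0 P) = of_real (beta2 P) * val1 P (Dx1 P (Dx1 P y)) (len0 P)"
    if d: "((u, y), (v, z, \<theta>)) \<in> dom_A P" for u y v z \<theta>
  proof -
    have "(u, y) \<in> W1 P" "(v, z, \<theta>) \<in> W2 P" using d unfolding dom_A_iff by blast+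
    then show ?thesis using regularity[OF d] by (simp add: W2_iff)
  qed
  then show ?thesis using bij_resolvent resolvent_compact by blast
qed

end
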